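(* Let $m\ge1$, let $Q=(q_{i,j})$ be an $m\times m$ matrix of complex-valued, $\pi$-periodic, locally square integrable functions, and let $A=\int_0^\pi Q(x)\,dx$. If the matrix $A$ has no real eigenvalues, then the real component $\sigma(L(Q))\cap\mathbb R$ of the spectrum of $L(Q)$ is contained in a finite interval $[a,b]$.
   Context: $L(Q)$ is the operator generated in $L_2^m(-\infty,\infty)=L_2(\mathbb R;\mathbb C^m)$ by the differential expression $-y''+Qy$. Its spectrum is known to be $\sigma(L(Q))=\bigcup_{t\in(-1,1]}\sigma(L_t(Q))$, where $L_t(Q)$ is the operator in $L_2([0,\pi];\mathbb C^m)$ generated by $-y''+Qy$ and the conditions $y(\pi)=e^{i\pi t}y(0)$, $y'(\pi)=e^{i\pi t}y'(0)$. *)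

theory Defs
  imports "HOL-Analysis.Analysis"
begin

text \<open>
  Elements of \<open>L\<^sub>2(\<real>; \<complex>\<^sup>m)\<close> are represented by functions, so equality in that space is
  equality almost everywhere. The norm on \<^typ>\<open>complex ^ 'm\<close> is the Hermitian one.
\<close>

definition L2_space :: "(real \<Rightarrow> complex ^ 'm::finite) set" where
  "L2_space = {f. f \<in> borel_measurable lebesgue \<and> integrable lebesgue (\<lambda>x. (norm (f x))\<^sup>2)}"

definition L2_space_norm :: "(real \<Rightarrow> complex ^ 'm::finite) \<Rightarrow> real" where
  "L2_space_norm f = sqrt (LINT x|lebesgue. (norm (f x))\<^sup>2)"

definition locally_square_integrable :: "(real \<Rightarrow> complex) \<Rightarrow> bool" where
  "locally_square_integrable q \<longleftrightarrow>
     q \<in> borel_measurable lebesgue \<and>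
     (\<forall>a b. set_integrable lebesgue {a..b} (\<lambda>x. (norm (q x))\<^sup>2))"

text \<open>
  \<open>f\<close> is locally absolutely continuous and \<open>f'\<close> is its derivative almost everywhere:
  \<open>f\<close> is the indefinite Lebesgue integral of the locally integrable function \<open>f'\<close>.
\<close>

definition has_ac_derivative ::
    "(real \<Rightarrow> complex ^ 'm::finite) \<Rightarrow> (real \<Rightarrow> complex ^ 'm) \<Rightarrow> bool" where
  "has_ac_derivative f f' \<longleftrightarrow>
     (\<forall>a b. set_integrable lebesgue {a..b} f') \<and>
     (\<forall>a b. a \<le> b \<longrightarrow> f b - f a = (LINT x:{a..b}|lebesgue. f' x))"

text \<open>
  Graph of the operator \<open>L(Q)\<close>, with the usual maximal domain: all \<open>y\<close> in \<open>L\<^sub>2\<close> for which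
  \<open>y\<close> and \<open>y'\<close> are locally absolutely continuous and \<open>-y'' + Qy\<close> is in \<open>L\<^sub>2\<close>. In the domain
  condition \<open>y\<close> is the continuous representative; \<open>y'\<close> is forced to be continuous, hence it
  is the classical derivative of \<open>y\<close>.
\<close>

definition schroedinger_op ::
    "(real \<Rightarrow> complex ^ 'm ^ 'm::finite) \<Rightarrow>
     ((real \<Rightarrow> complex ^ 'm) \<times> (real \<Rightarrow> complex ^ 'm)) set" where
  "schroedinger_op Q =
     {(y, g). y \<in> L2_space \<and> g \<in> L2_space \<and>
        (\<exists>y' y''. has_ac_derivative y y' \<and> has_ac_derivative y' y'' \<and>
           (AE x in lebesgue. g x = - y'' x + Q x *v y x))}"

text \<open>
  For an operator given by its graph \<open>T\<close>: \<open>z\<close> is in the resolvent set if \<open>T - z\<close> maps the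
  domain bijectively onto \<open>L\<^sub>2\<close> and the inverse is bounded.
\<close>

definition resolvent_set ::
    "((real \<Rightarrow> complex ^ 'm::finite) \<times> (real \<Rightarrow> complex ^ 'm)) set \<Rightarrow> complex set" where
  "resolvent_set T =
     {z. (\<forall>f\<in>L2_space. \<exists>(y, g)\<in>T. AE x in lebesgue. g x - z *s y x = f x) \<and>
         (\<forall>(y, g)\<in>T. (AE x in lebesgue. g x - z *s y x = 0) \<longrightarrow> (AE x in lebesgue. y x = 0)) \<and>
         (\<exists>C. \<forall>(y, g)\<in>T. L2_space_norm y \<le> C * L2_space_norm (\<lambda>x. g x - z *s y x))}"

definition op_spectrum ::
    "((real \<Rightarrow> complex ^ 'm::finite) \<times> (real \<Rightarrow> complex ^ 'm)) set \<Rightarrow> complex set" where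
  "op_spectrum T = - resolvent_set T"

definition matrix_eigenvalue :: "complex ^ 'm ^ 'm::finite \<Rightarrow> complex \<Rightarrow> bool" where
  "matrix_eigenvalue A \<mu> \<longleftrightarrow> (\<exists>v. v \<noteq> 0 \<and> A *v v = \<mu> *s v)"

end

theory Submission
  imports Defs "HOL-Computational_Algebra.Fundamental_Theorem_Algebra"
begin

text \<open>
  Translation by one period acts on the data \<open>(y, y')\<close> at \<open>0\<close> of the solutions of
  \<open>-y'' + Q y = \<lambda> y\<close> by a matrix, the monodromy matrix. The real number \<open>\<lambda>\<close> lies in the resolvent
  set as soon as this matrix has no eigenvalue \<open>\<zeta>\<close> (a Floquet multiplier) of modulus one
  (\<open>resolvent_setI\<close>), and for a matrix \<open>A\<close> without real eigenvalues this is the case for every real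
  \<open>\<lambda>\<close> of large modulus (\<open>no_unimodular_multiplier\<close>).

  The second point is where the integral \<open>A\<close> of the potential over a period enters. Let \<open>\<lambda> = k\<^sup>2\<close> and write a solution
  as \<open>y = (e\<^bsup>ikx\<^esup> U - e\<^bsup>-ikx\<^esup> V) / 2ik\<close>. Then \<open>U' = (Q U - e\<^bsup>-2ikx\<^esup> Q V) / 2ik\<close>, and similarly for \<open>V\<close>, so
  that \<open>U\<close> and \<open>V\<close> change only by \<open>O(1/k)\<close> over a period. Normalizing \<open>|V(0)| \<le> |U(0)| = 1\<close>, the other
  case being symmetric, one finds \<open>2ik (U(\<pi>) - U(0)) = A U(0) + o(1)\<close>, where the coupling to \<open>V\<close> disappears in the limit by the
  Riemann-Lebesgue lemma. If the multiplier has modulus one, then \<open>U(\<pi>) = \<alpha> U(0)\<close> with \<open>|\<alpha>| = 1\<close>, and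
  \<open>\<nu> = 2ik (\<alpha> - 1)\<close>, if it remains bounded, has an imaginary part of order \<open>1/k\<close>. Hence \<open>A\<close> would
  have an almost real approximate eigenvalue, which compactness excludes. For \<open>\<lambda> = -\<kappa>\<^sup>2\<close> the
  exponentials grow and decay instead of oscillating, and a bound of the supremum of \<open>|y|\<close> by
  a small multiple of itself is enough.

  The first point replaces Floquet theory on the line by a recurrence. Rewrite the inhomogeneous
  equation as a first-order system with periodic coefficients. Its solutions satisfy
  \<open>w\<^sub>n\<^sub>+\<^sub>1 = M w\<^sub>n + g\<^sub>n\<close> at the period points, where \<open>g\<close> is square summable if the right-hand side is
  square integrable, and between the period points they are controlled by \<open>w\<close> and the right-hand side. It
  remains to invert \<open>S - M\<close> on square summable two-sided sequences, \<open>S\<close> being the shift. Some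
  product \<open>(M - \<mu>\<^sub>1) \<cdots> (M - \<mu>\<^sub>r)\<close> over eigenvalues of \<open>M\<close> vanishes, and the identity
  \<open>(S - \<mu>)(S - M) = (S - M)(S - \<mu>)\<close> reduces the inversion, one factor at a time, to the scalar case
  \<open>S - \<mu>\<close> with \<open>|\<mu>| \<noteq> 1\<close>, which is a geometric series (\<open>recurrence_exists\<close>, \<open>recurrence_bound\<close>).
  Square integrability of \<open>y\<close> and \<open>-y'' + Q y\<close> implies that of \<open>(y, y')\<close> at the period points
  (\<open>schroedinger_initial_data_l2\<close>), so the a priori bound covers the whole domain of the operator.
\<close>

section \<open>Absolutely continuous functions on an interval\<close>

text \<open>
  The interval version of \<^const>\<open>has_ac_derivative\<close>, phrased with the gauge integral, whose calculus
  of indefinite integrals is used throughout.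
\<close>

definition ac_on :: "real \<Rightarrow> real \<Rightarrow> (real \<Rightarrow> 'a::euclidean_space) \<Rightarrow> (real \<Rightarrow> 'a) \<Rightarrow> bool" where
  "ac_on a b f f' \<longleftrightarrow> f' absolutely_integrable_on {a..b} \<and>
     (\<forall>x\<in>{a..b}. f x = f a + integral {a..x} f')"

lemma ac_on_integrable: "ac_on a b f f' \<Longrightarrow> f' absolutely_integrable_on {a..b}"
  unfolding ac_on_def by blast

lemma ac_on_value: "ac_on a b f f' \<Longrightarrow> a \<le> x \<Longrightarrow> x \<le> b \<Longrightarrow> f x = f a + integral {a..x} f'"
  unfolding ac_on_def by (metis atLeastAtMost_iff)

lemma ac_on_integrable_subinterval:
  assumes "ac_on a b f f'" "a \<le> x" "y \<le> b"
  shows "f' integrable_on {x..y}" "(\<lambda>s. norm (f' s)) integrable_on {x..y}"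
proof -
  have "f' absolutely_integrable_on {x..y}"
    by (rule absolutely_integrable_on_subinterval[OF ac_on_integrable[OF assms(1)]]) (use assms in auto)
  then show "f' integrable_on {x..y}" "(\<lambda>s. norm (f' s)) integrable_on {x..y}"
    by (auto simp: absolutely_integrable_on_def)
qed

lemma ac_on_increment:
  assumes "ac_on a b f f'" "a \<le> x" "x \<le> y" "y \<le> b"
  shows "f y - f x = integral {x..y} f'"
proof -
  have "integral {a..x} f' + integral {x..y} f' = integral {a..y} f'"
    by (rule Henstock_Kurzweil_Integration.integral_combine)
       (use assms ac_on_integrable_subinterval[OF assms(1), of a y] in auto)
  moreover have "f y = f a + integral {a..y} f'" "f x = f a + integral {a..x} f'"
    using assms(2-4) by (auto intro!: ac_on_value[OF assms(1)])
  ultimately have "f y - f x = integral {a..y} f' - integral {a..x} f'"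
    by simp
  also have "\<dots> = integral {x..y} f'"
    using \<open>integral {a..x} f' + integral {x..y} f' = integral {a..y} f'\<close> by (simp add: eq_diff_eq add.commute diff_eq_eq)
  finally show ?thesis .
qed

lemma ac_onI:
  assumes "f' absolutely_integrable_on {a..b}"
    and "\<And>x. a \<le> x \<Longrightarrow> x \<le> b \<Longrightarrow> f x - f a = integral {a..x} f'"
  shows "ac_on a b f f'"
  using assms unfolding ac_on_def by (metis add.commute atLeastAtMost_iff diff_add_cancel)

lemma ac_on_subinterval:
  assumes "ac_on a b f f'" "a \<le> x" "y \<le> b"
  shows "ac_on x y f f'"
proof (rule ac_onI)
  show "f' absolutely_integrable_on {x..y}"
    by (rule absolutely_integrable_on_subinterval[OF ac_on_integrable[OF assms(1)]]) (use assms in auto)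
qed (use assms ac_on_increment[OF assms(1)] in auto)

lemma ac_on_continuous:
  assumes "ac_on a b f f'"
  shows "continuous_on {a..b} f"
proof -
  have "f' integrable_on {a..b}"
    using ac_on_integrable_subinterval(1)[OF assms, of a b] by auto
  from indefinite_integral_continuous_1[OF this]
  have "continuous_on {a..b} (\<lambda>x. f a + integral {a..x} f')"
    by (intro continuous_intros)
  then show ?thesis
    by (rule continuous_on_eq) (use ac_on_value[OF assms, symmetric] in force)
qed

lemma ac_on_linear:
  assumes "ac_on a b f f'" "bounded_linear L"
  shows "ac_on a b (\<lambda>x. L (f x)) (\<lambda>x. L (f' x))"
proof (rule ac_onI)
  show "(\<lambda>x. L (f' x)) absolutely_integrable_on {a..b}"
    using absolutely_integrable_linear[OF ac_on_integrable[OF assms(1)] assms(2)] by (simp add: o_def)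
next
  fix x assume x: "a \<le> x" "x \<le> b"
  have "L (f x) - L (f a) = L (f x - f a)"
    by (simp add: assms(2) linear_diff bounded_linear.linear)
  also have "\<dots> = L (integral {a..x} f')"
    using ac_on_increment[OF assms(1), of a x] x by simp
  also have "\<dots> = integral {a..x} (\<lambda>x. L (f' x))"
    using integral_linear[OF ac_on_integrable_subinterval(1)[OF assms(1), of a x] assms(2)] x by (simp add: o_def)
  finally show "L (f x) - L (f a) = integral {a..x} (\<lambda>x. L (f' x))" .
qed

lemma ac_on_add:
  assumes "ac_on a b f f'" "ac_on a b g g'"
  shows "ac_on a b (\<lambda>x. f x + g x) (\<lambda>x. f' x + g' x)"
proof (rule ac_onI)
  show "(\<lambda>x. f' x + g' x) absolutely_integrable_on {a..b}"
    using assms by (intro set_integral_add ac_on_integrable)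
next
  fix x assume x: "a \<le> x" "x \<le> b"
  show "f x + g x - (f a + g a) = integral {a..x} (\<lambda>x. f' x + g' x)"
    using ac_on_increment[OF assms(1), of a x] ac_on_increment[OF assms(2), of a x] x
      ac_on_integrable_subinterval(1)[OF assms(1), of a x] ac_on_integrable_subinterval(1)[OF assms(2), of a x]
    by (simp add: Henstock_Kurzweil_Integration.integral_add algebra_simps)
qed

lemma ac_on_diff:
  assumes "ac_on a b f f'" "ac_on a b g g'"
  shows "ac_on a b (\<lambda>x. f x - g x) (\<lambda>x. f' x - g' x)"
  using ac_on_add[OF assms(1) ac_on_linear[OF assms(2) bounded_linear_minus[OF bounded_linear_ident]]] by simp

lemma ac_on_cong:
  assumes "ac_on a b f f'" "\<And>x. x \<in> {a..b} \<Longrightarrow> f x = g x" "\<And>x. x \<in> {a..b} \<Longrightarrow> f' x = g' x"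
  shows "ac_on a b g g'"
proof (cases "a \<le> b")
  case True
  show ?thesis
  proof (rule ac_onI)
    show "g' absolutely_integrable_on {a..b}"
      by (rule absolutely_integrable_spike[OF ac_on_integrable[OF assms(1)], of "{}"]) (use assms(3) in auto)
    fix x assume x: "a \<le> x" "x \<le> b"
    have "integral {a..x} f' = integral {a..x} g'"
      by (rule integral_cong) (use x assms in auto)
    moreover have "g x = f x" "g a = f a" using assms(2)[of x] assms(2)[of a] x by auto
    ultimately show "g x - g a = integral {a..x} g'"
      using ac_on_increment[OF assms(1) order_refl x] by simp
  qed
qed (simp add: ac_on_def set_integrable_def)

lemma ac_on_norm_increment_le:
  assumes "ac_on a b f f'" "a \<le> x" "x \<le> y" "y \<le> b" "g integrable_on {x..y}"
    and "\<And>s. s \<in> {x..y} \<Longrightarrow> norm (f' s) \<le> g s"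
  shows "norm (f y - f x) \<le> integral {x..y} g"
  unfolding ac_on_increment[OF assms(1-4)]
  by (rule Henstock_Kurzweil_Integration.integral_norm_bound_integral)
     (use assms ac_on_integrable_subinterval(1)[OF assms(1,2,4)] in auto)

lemma absolutely_integrable_shift:
  fixes f :: "real \<Rightarrow> 'a::euclidean_space"
  shows "(\<lambda>x. f (x + c)) absolutely_integrable_on {a-c..b-c} \<longleftrightarrow> f absolutely_integrable_on {a..b}"
  unfolding absolutely_integrable_on_def
  using integrable_shift_real_ivl_iff[of f c a b] integrable_shift_real_ivl_iff[of "\<lambda>x. norm (f x)" c a b]
  by simp

lemma ac_on_shift:
  assumes "ac_on a b f f'"
  shows "ac_on (a - c) (b - c) (\<lambda>x. f (x + c)) (\<lambda>x. f' (x + c))"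
proof (rule ac_onI)
  show "(\<lambda>x. f' (x + c)) absolutely_integrable_on {a-c..b-c}"
    using ac_on_integrable[OF assms] by (simp add: absolutely_integrable_shift)
  fix x assume x: "a - c \<le> x" "x \<le> b - c"
  show "f (x + c) - f (a - c + c) = integral {a - c..x} (\<lambda>x. f' (x + c))"
    using ac_on_increment[OF assms, of a "x+c"] x integral_shift_real_ivl[of a c "x+c" f'] by simp
qed

lemma has_ac_derivative_iff_ac_on:
  "has_ac_derivative f f' \<longleftrightarrow> (\<forall>a b. a \<le> b \<longrightarrow> ac_on a b f f')"
proof
  assume L: "has_ac_derivative f f'"
  show "\<forall>a b. a \<le> b \<longrightarrow> ac_on a b f f'"
  proof (intro allI impI ac_onI)
    fix a b x :: real
    show "f' absolutely_integrable_on {a..b}" using L by (auto simp: has_ac_derivative_def)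
    assume "a \<le> x"
    then show "f x - f a = integral {a..x} f'"
      using L set_lebesgue_integral_eq_integral(2)[of "{a..x}" f'] by (auto simp: has_ac_derivative_def)
  qed
next
  assume R: "\<forall>a b. a \<le> b \<longrightarrow> ac_on a b f f'"
  have I: "f' absolutely_integrable_on {a..b}" for a b
  proof (cases "a \<le> b")
    case False then show ?thesis by (simp add: set_integrable_def)
  qed (use R ac_on_integrable in blast)
  show "has_ac_derivative f f'"
    unfolding has_ac_derivative_def
    using I set_lebesgue_integral_eq_integral(2)[OF I] R ac_on_increment by (metis order_refl)
qed

lemma ac_on_append:
  assumes "ac_on a b f f'" "ac_on b c f f'" "a \<le> b" "b \<le> c"
  shows "ac_on a c f f'"
proof (rule ac_onI)
  show I: "f' absolutely_integrable_on {a..c}"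
    using absolutely_integrable_on_combine[OF assms(1,2)[THEN ac_on_integrable] assms(3,4)] .
  fix x assume x: "a \<le> x" "x \<le> c"
  show "f x - f a = integral {a..x} f'"
  proof (cases "x \<le> b")
    case True
    then show ?thesis using ac_on_increment[OF assms(1), of a x] x by simp
  next
    case False
    have "f' absolutely_integrable_on {a..x}"
      using I by (rule absolutely_integrable_on_subinterval) (use x in auto)
    then have "integral {a..b} f' + integral {b..x} f' = integral {a..x} f'"
      by (intro Henstock_Kurzweil_Integration.integral_combine)
         (use False assms in \<open>auto simp: absolutely_integrable_on_def\<close>)
    moreover have "f b - f a = integral {a..b} f'" "f x - f b = integral {b..x} f'"
      using ac_on_increment[OF assms(1), of a b] ac_on_increment[OF assms(2), of b x] False x assms by auto
    moreover have "f x - f a = (f b - f a) + (f x - f b)" by simp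
    ultimately show ?thesis by presburger
  qed
qed

text \<open>
  Solutions on the line are built period by period; the increments over adjacent cells add up.
\<close>

lemma has_ac_derivative_from_cells:
  fixes f :: "real \<Rightarrow> complex ^ 'n::finite"
  assumes l: "l > 0"
    and cells: "\<And>n::int. ac_on (of_int n * l) (of_int (n + 1) * l) f f'"
  shows "has_ac_derivative f f'"
proof -
  have *: "ac_on (of_int n * l) (of_int (n + int j) * l) f f'" for n j
  proof (induction j)
    case 0
    then show ?case
      by (intro ac_onI) (auto intro!: absolutely_integrable_negligible)
  next
    case (Suc j)
    show ?case
      by (rule ac_on_append[OF Suc]) (use cells[of "n + int j"] l in \<open>auto simp: algebra_simps\<close>)
  qed
  show ?thesis
    unfolding has_ac_derivative_iff_ac_on
  proof (intro allI impI)
    fix a b :: real assume "a \<le> b"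
    define n where "n = \<lfloor>a / l\<rfloor>"
    define j where "j = nat (\<lceil>b / l\<rceil> - n)"
    have n: "of_int n * l \<le> a"
      using l unfolding n_def by (metis floor_correct pos_le_divide_eq)
    have "a / l \<le> b / l" using \<open>a \<le> b\<close> l by (simp add: divide_right_mono)
    then have "n \<le> \<lceil>b / l\<rceil>" unfolding n_def by linarith
    then have "of_int (n + int j) = real_of_int \<lceil>b / l\<rceil>" by (simp add: j_def)
    then have "b \<le> of_int (n + int j) * l"
      using l le_of_int_ceiling[of "b / l"] by (metis pos_divide_le_eq)
    then show "ac_on a b f f'"
      using ac_on_subinterval[OF *[of n j] n] by simp
  qed
qed

text \<open>
  The product rule for a smooth factor. Let \<open>E\<close> be the difference of the product and the indefinite
  integral of its expected derivative. Freezing \<open>\<phi>\<close> at one end and \<open>f\<close> at the other shows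
  \<open>|E y - E x| \<le> c |y - x| |G y - G x|\<close>, where \<open>G\<close> is the indefinite integral of \<open>|f'|\<close>. As \<open>G\<close> is
  continuous, \<open>E\<close> has derivative zero at every point, including those where \<open>f\<close> is not
  differentiable, and is therefore constant.
\<close>

lemma ac_on_scaled:
  fixes f :: "real \<Rightarrow> 'a::euclidean_space" and \<phi> :: "real \<Rightarrow> 'b::euclidean_space"
    and prod :: "'b \<Rightarrow> 'a \<Rightarrow> 'c::euclidean_space"
  assumes f: "ac_on a b f f'"
    and prod: "bounded_bilinear prod"
    and \<phi>: "\<And>x. (\<phi> has_vector_derivative \<phi>' x) (at x)" and \<phi>': "continuous_on UNIV \<phi>'"
  shows "ac_on a b (\<lambda>x. prod (\<phi> x) (f x)) (\<lambda>x. prod (\<phi>' x) (f x) + prod (\<phi> x) (f' x))"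
proof (cases "a \<le> b")
  case False then show ?thesis by (simp add: ac_on_def set_integrable_def)
next
  case ab: True
  interpret prod: bounded_bilinear prod by (rule prod)
  have bl: "bilinear prod" using prod by (simp add: bilinear_conv_bounded_bilinear)
  have c\<phi>: "continuous_on S \<phi>" for S
    using \<phi> by (meson continuous_at_imp_continuous_on has_vector_derivative_continuous)
  have c\<phi>': "continuous_on S \<phi>'" for S using \<phi>' continuous_on_subset by blast
  have cf: "continuous_on {a..b} f" by (rule ac_on_continuous[OF f])
  have meas: "\<phi> \<in> borel_measurable (lebesgue_on {a..b})"
    by (rule continuous_imp_measurable_on_sets_lebesgue) (use c\<phi> in auto)
  have bdd: "bounded (\<phi> ` {a..b})"
    by (intro compact_imp_bounded compact_continuous_image c\<phi>) auto
  have I1: "(\<lambda>x. prod (\<phi> x) (f' x)) absolutely_integrable_on {a..b}"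
    by (rule absolutely_integrable_bounded_measurable_product[OF bl meas _ bdd ac_on_integrable[OF f]]) auto
  have I2: "(\<lambda>x. prod (\<phi>' x) (f x)) absolutely_integrable_on {a..b}"
    by (intro absolutely_integrable_continuous_real prod.continuous_on c\<phi>' cf)
  define d where "d = (\<lambda>x. prod (\<phi>' x) (f x) + prod (\<phi> x) (f' x))"
  have I: "d absolutely_integrable_on {a..b}"
    unfolding d_def by (intro set_integral_add I1 I2)
  define E where "E x = prod (\<phi> x) (f x) - integral {a..x} d" for x
  define G where "G x = integral {a..x} (\<lambda>s. norm (f' s))" for x
  obtain K where K: "K > 0" "\<And>u v. norm (prod u v) \<le> norm u * norm v * K"
    using prod.pos_bounded by blast
  have "bounded (\<phi>' ` {a..b})"
    by (intro compact_imp_bounded compact_continuous_image c\<phi>') auto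
  then obtain L where L: "L > 0" "\<And>s. s \<in> {a..b} \<Longrightarrow> norm (\<phi>' s) \<le> L"
    using bounded_pos by (metis imageI)
  have lip: "norm (\<phi> y - \<phi> x) \<le> L * (y - x)" if "a \<le> x" "x \<le> y" "y \<le> b" for x y
  proof -
    have "(\<phi>' has_integral (\<phi> y - \<phi> x)) {x..y}"
      by (rule fundamental_theorem_of_calculus) (use that \<phi> in \<open>auto intro: has_vector_derivative_at_within\<close>)
    from has_integral_bound_real[OF _ _ this, of L "{}"] L that show ?thesis by auto
  qed
  have key: "norm (E y - E x) \<le> 2 * K * L * (y - x) * (G y - G x)" if xy: "a \<le> x" "x \<le> y" "y \<le> b" for x y
  proof -
    have Id: "d integrable_on {x..y}"
      using absolutely_integrable_on_subinterval[OF I, of x y] xy by (auto simp: absolutely_integrable_on_def)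
    have d1: "integral {a..x} d + integral {x..y} d = integral {a..y} d"
      using I xy
      by (intro Henstock_Kurzweil_Integration.integral_combine) (auto simp: absolutely_integrable_on_def intro: integrable_on_subinterval)
    have G1: "G y - G x = integral {x..y} (\<lambda>s. norm (f' s))"
      unfolding G_def
      using Henstock_Kurzweil_Integration.integral_combine[OF xy(1,2), of "\<lambda>s. norm (f' s)"] ac_on_integrable_subinterval(2)[OF f, of a y] xy by simp
    have i1: "((\<lambda>s. prod (\<phi> y) (f' s)) has_integral prod (\<phi> y) (f y - f x)) {x..y}"
      using has_integral_linear[OF integrable_integral[OF ac_on_integrable_subinterval(1)[OF f xy(1,3)]] prod.bounded_linear_right[of "\<phi> y"]]
      unfolding ac_on_increment[OF f xy] by (simp add: o_def)
    have "(\<phi>' has_integral (\<phi> y - \<phi> x)) {x..y}"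
      by (rule fundamental_theorem_of_calculus) (use xy \<phi> in \<open>auto intro: has_vector_derivative_at_within\<close>)
    from has_integral_linear[OF this prod.bounded_linear_left[of "f x"]]
    have i2: "((\<lambda>s. prod (\<phi>' s) (f x)) has_integral prod (\<phi> y - \<phi> x) (f x)) {x..y}" by (simp add: o_def)
    have "((\<lambda>s. (prod (\<phi> y) (f' s) + prod (\<phi>' s) (f x)) - d s) has_integral
        (prod (\<phi> y) (f y - f x) + prod (\<phi> y - \<phi> x) (f x)) - integral {x..y} d) {x..y}"
      by (intro has_integral_diff has_integral_add i1 i2 integrable_integral Id)
    also have "(prod (\<phi> y) (f y - f x) + prod (\<phi> y - \<phi> x) (f x)) - integral {x..y} d = E y - E x"
      unfolding E_def d1[symmetric] by (simp add: prod.diff_left prod.diff_right)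
    finally have i3: "((\<lambda>s. (prod (\<phi> y) (f' s) + prod (\<phi>' s) (f x)) - d s) has_integral E y - E x) {x..y}" .
    have "norm (integral {x..y} (\<lambda>s. (prod (\<phi> y) (f' s) + prod (\<phi>' s) (f x)) - d s))
        \<le> integral {x..y} (\<lambda>s. K * L * (y - x) * norm (f' s) + K * L * (G y - G x))"
    proof (rule Henstock_Kurzweil_Integration.integral_norm_bound_integral)
      show "(\<lambda>s. prod (\<phi> y) (f' s) + prod (\<phi>' s) (f x) - d s) integrable_on {x..y}" using i3 by blast
      show "(\<lambda>s. K * L * (y - x) * norm (f' s) + K * L * (G y - G x)) integrable_on {x..y}"
        by (intro integrable_add integrable_cmul[of "\<lambda>s. norm (f' s)", unfolded real_scaleR_def]
            ac_on_integrable_subinterval(2)[OF f] xy integrable_const_ivl)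
      fix s assume s: "s \<in> {x..y}"
      have e: "prod (\<phi> y) (f' s) + prod (\<phi>' s) (f x) - d s = prod (\<phi> y - \<phi> s) (f' s) - prod (\<phi>' s) (f s - f x)"
        by (simp add: d_def prod.diff_left prod.diff_right)
      have "norm (\<phi> y - \<phi> s) \<le> L * (y - x)"
        using lip[of s y] s xy L by (smt (verit) atLeastAtMost_iff mult_left_mono)
      then have n1: "norm (prod (\<phi> y - \<phi> s) (f' s)) \<le> K * L * (y - x) * norm (f' s)"
        using K(2)[of "\<phi> y - \<phi> s" "f' s"] K(1)
        by (smt (verit, ccfv_SIG) mult.assoc mult.commute mult_right_mono norm_ge_zero)
      have "norm (f s - f x) \<le> integral {x..s} (\<lambda>s. norm (f' s))"
        by (rule ac_on_norm_increment_le[OF f]) (use s xy ac_on_integrable_subinterval(2)[OF f, of x s] in auto)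
      also have "\<dots> \<le> G y - G x"
        unfolding G1 by (rule integral_subset_le)
          (use s xy ac_on_integrable_subinterval(2)[OF f, of x s] ac_on_integrable_subinterval(2)[OF f, of x y] in auto)
      finally have "norm (f s - f x) \<le> G y - G x" .
      then have "norm (\<phi>' s) * norm (f s - f x) \<le> L * (G y - G x)"
        using L(2)[of s] s xy L(1) by (intro mult_mono) auto
      then have "norm (prod (\<phi>' s) (f s - f x)) \<le> L * (G y - G x) * K"
        using K(2)[of "\<phi>' s" "f s - f x"] K(1) by (smt (verit) mult_right_mono)
      then have n2: "norm (prod (\<phi>' s) (f s - f x)) \<le> K * L * (G y - G x)"
        by (simp add: algebra_simps)
      show "norm (prod (\<phi> y) (f' s) + prod (\<phi>' s) (f x) - d s) \<le> K * L * (y - x) * norm (f' s) + K * L * (G y - G x)"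
        unfolding e using n1 n2 norm_triangle_ineq4[of "prod (\<phi> y - \<phi> s) (f' s)" "prod (\<phi>' s) (f s - f x)"] by linarith
    qed
    also have "\<dots> = 2 * K * L * (y - x) * (G y - G x)"
    proof (rule integral_unique)
      have "((\<lambda>s. norm (f' s)) has_integral (G y - G x)) {x..y}"
        unfolding G1 using ac_on_integrable_subinterval(2)[OF f xy(1,3)] by (rule integrable_integral)
      from has_integral_add[OF has_integral_mult_right[OF this, of "K * L * (y - x)"]
          has_integral_const_real[of "K * L * (G y - G x)" x y]] xy
      show "((\<lambda>s. K * L * (y - x) * norm (f' s) + K * L * (G y - G x)) has_integral
          2 * K * L * (y - x) * (G y - G x)) {x..y}"
        by (simp add: content_real algebra_simps)
    qed
    finally show ?thesis using i3 by (simp add: integral_unique)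
  qed
  have Gmono: "G x \<le> G y" if "a \<le> x" "x \<le> y" "y \<le> b" for x y
    unfolding G_def by (rule integral_subset_le)
      (use that ac_on_integrable_subinterval(2)[OF f, of a x] ac_on_integrable_subinterval(2)[OF f, of a y] in auto)
  have key': "norm (E y - E x) \<le> 2 * K * L * \<bar>y - x\<bar> * \<bar>G y - G x\<bar>"
    if "x \<in> {a..b}" "y \<in> {a..b}" for x y
    using that
  proof (induction x y rule: linorder_wlog)
    case (le x y)
    then show ?case using key[of x y] Gmono[of x y] by simp
  next
    case (sym x y)
    then show ?case by (simp add: norm_minus_commute abs_minus_commute)
  qed
  have cG: "continuous_on {a..b} G"
    unfolding G_def by (rule indefinite_integral_continuous_1) (use ac_on_integrable_subinterval(2)[OF f, of a b] in auto)
  have "(E has_derivative (\<lambda>h. 0)) (at x within {a..b})" if x: "x \<in> {a..b}" for x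
    unfolding has_derivative_within_alt
  proof (intro conjI allI impI)
    fix e :: real assume e: "e > 0"
    have "e / (2 * K * L) > 0" using e K L by simp
    then obtain \<delta> where \<delta>: "\<delta> > 0" "\<And>y. y \<in> {a..b} \<Longrightarrow> dist y x < \<delta> \<Longrightarrow> dist (G y) (G x) < e / (2 * K * L)"
      using cG x unfolding continuous_on_iff by meson
    show "\<exists>\<delta>>0. \<forall>y\<in>{a..b}. norm (y - x) < \<delta> \<longrightarrow> norm (E y - E x - 0) \<le> e * norm (y - x)"
    proof (intro exI conjI ballI impI)
      fix y assume y: "y \<in> {a..b}" "norm (y - x) < \<delta>"
      then have "\<bar>G y - G x\<bar> \<le> e / (2 * K * L)" using \<delta>(2)[of y] by (auto simp: dist_norm)
      then have "2 * K * L * \<bar>y - x\<bar> * \<bar>G y - G x\<bar> \<le> 2 * K * L * \<bar>y - x\<bar> * (e / (2 * K * L))"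
        using K L by (intro mult_left_mono) auto
      then show "norm (E y - E x - 0) \<le> e * norm (y - x)"
        using key'[OF x y(1)] K L by (simp add: field_simps)
    qed (rule \<delta>(1))
  qed auto
  then have Econst: "E x = E a" if "x \<in> {a..b}" for x
    using has_derivative_zero_constant[of "{a..b}" E] that ab by (metis atLeastAtMost_iff convex_real_interval(5) order_refl)
  show ?thesis
    unfolding d_def[symmetric]
  proof (rule ac_onI[OF I])
    fix x assume "a \<le> x" "x \<le> b"
    then show "prod (\<phi> x) (f x) - prod (\<phi> a) (f a) = integral {a..x} d"
      using Econst[of x] unfolding E_def by (auto simp: algebra_simps)
  qed
qed

section \<open>Square integrable functions on an interval\<close>

lemma norm_add_power2_le:
  fixes a b :: "'a::real_normed_vector"
  shows "(norm (a + b))\<^sup>2 \<le> 2 * (norm a)\<^sup>2 + 2 * (norm b)\<^sup>2"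
proof -
  have "(norm (a + b))\<^sup>2 \<le> (norm a + norm b)\<^sup>2"
    by (intro power_mono norm_triangle_ineq) auto
  also have "\<dots> \<le> 2 * (norm a)\<^sup>2 + 2 * (norm b)\<^sup>2"
    using sum_squares_bound[of "norm a" "norm b"] by (simp add: power2_sum)
  finally show ?thesis .
qed

definition L2_on :: "real \<Rightarrow> real \<Rightarrow> (real \<Rightarrow> 'a::euclidean_space) \<Rightarrow> bool" where
  "L2_on a b f \<longleftrightarrow> f \<in> borel_measurable (lebesgue_on {a..b}) \<and> (\<lambda>x. (norm (f x))\<^sup>2) integrable_on {a..b}"

text \<open>
  Holder's inequality in its weakest form: \<open>|f| |g| \<le> |f|\<^sup>2 + |g|\<^sup>2\<close> provides an integrable majorant.
\<close>

lemma L2_on_product_integrable: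
  fixes f :: "real \<Rightarrow> 'a::euclidean_space" and g :: "real \<Rightarrow> 'b::euclidean_space"
    and h :: "'a \<Rightarrow> 'b \<Rightarrow> 'c::euclidean_space"
  assumes "bilinear h" "L2_on a b f" "L2_on a b g"
  shows "(\<lambda>x. h (f x) (g x)) absolutely_integrable_on {a..b}"
proof -
  obtain B where B: "B > 0" "\<And>x y. norm (h x y) \<le> B * norm x * norm y"
    using bilinear_bounded_pos[OF assms(1)] by blast
  show ?thesis
  proof (rule measurable_bounded_by_integrable_imp_absolutely_integrable)
    show "(\<lambda>x. h (f x) (g x)) \<in> borel_measurable (lebesgue_on {a..b})"
      by (rule borel_measurable_bilinear) (use assms in \<open>auto simp: L2_on_def\<close>)
    show "(\<lambda>x. B *\<^sub>R ((norm (f x))\<^sup>2 + (norm (g x))\<^sup>2)) integrable_on {a..b}"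
      by (intro integrable_cmul integrable_add) (use assms in \<open>auto simp: L2_on_def\<close>)
    fix x
    have "norm (f x) * norm (g x) \<le> (norm (f x))\<^sup>2 + (norm (g x))\<^sup>2"
      using sum_squares_bound[of "norm (f x)" "norm (g x)"]
        mult_nonneg_nonneg[OF norm_ge_zero[of "f x"] norm_ge_zero[of "g x"]] by linarith
    then have "B * (norm (f x) * norm (g x)) \<le> B * ((norm (f x))\<^sup>2 + (norm (g x))\<^sup>2)"
      using B(1) by (intro mult_left_mono) auto
    then show "norm (h (f x) (g x)) \<le> B *\<^sub>R ((norm (f x))\<^sup>2 + (norm (g x))\<^sup>2)"
      using B(2)[of "f x" "g x"] by (simp add: mult.assoc)
  qed auto
qed

lemma L2_on_continuous: "continuous_on {a..b} f \<Longrightarrow> L2_on a b f"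
  unfolding L2_on_def
  by (intro conjI continuous_imp_measurable_on_sets_lebesgue integrable_continuous_interval continuous_intros) auto

lemma L2_on_norm: "L2_on a b f \<Longrightarrow> L2_on a b (\<lambda>x. norm (f x))"
  unfolding L2_on_def by (auto intro!: borel_measurable_norm)

lemma L2_on_imp_integrable:
  assumes "L2_on a b f"
  shows "f absolutely_integrable_on {a..b}"
  using L2_on_product_integrable[of "(*\<^sub>R)" a b "\<lambda>x. 1::real" f] assms L2_on_continuous[of a b "\<lambda>x. 1::real"]
  by (simp add: bilinear_conv_bounded_bilinear bounded_bilinear_scaleR)

lemma L2_on_subinterval:
  assumes "L2_on a b f" "a \<le> x" "y \<le> b"
  shows "L2_on x y f"
proof -
  have "{x..y} \<subseteq> {a..b}" using assms by auto
  then show ?thesis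
    using assms unfolding L2_on_def
    by (auto intro: measurable_restrict_mono integrable_on_subinterval)
qed

text \<open>
  The quadratic form \<open>\<integral>(s |f| - t |g|)\<^sup>2\<close> in \<open>(s, t)\<close> is nonnegative; evaluate it at \<open>(G, H)\<close> or
  \<open>(H, F)\<close>, according to which of \<open>F = \<integral>|f|\<^sup>2\<close> and \<open>G = \<integral>|g|\<^sup>2\<close> does not vanish, and at \<open>(1, \<plusminus>1)\<close> if
  both do.
\<close>

lemma Cauchy_Schwarz_L2_on:
  fixes f :: "real \<Rightarrow> 'a::euclidean_space" and g :: "real \<Rightarrow> 'b::euclidean_space"
  assumes f: "L2_on a b f" and g: "L2_on a b g"
  shows "(integral {a..b} (\<lambda>x. norm (f x) * norm (g x)))\<^sup>2
    \<le> integral {a..b} (\<lambda>x. (norm (f x))\<^sup>2) * integral {a..b} (\<lambda>x. (norm (g x))\<^sup>2)"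
proof -
  define F where "F = integral {a..b} (\<lambda>x. (norm (f x))\<^sup>2)"
  define G where "G = integral {a..b} (\<lambda>x. (norm (g x))\<^sup>2)"
  define H where "H = integral {a..b} (\<lambda>x. norm (f x) * norm (g x))"
  have If: "((\<lambda>x. (norm (f x))\<^sup>2) has_integral F) {a..b}" and Ig: "((\<lambda>x. (norm (g x))\<^sup>2) has_integral G) {a..b}"
    using f g unfolding L2_on_def F_def G_def by (auto intro: integrable_integral)
  have "bilinear ((*) :: real \<Rightarrow> real \<Rightarrow> real)" by (rule bilinear_times)
  from L2_on_product_integrable[OF this L2_on_norm[OF f] L2_on_norm[OF g]]
  have Ih: "((\<lambda>x. norm (f x) * norm (g x)) has_integral H) {a..b}"
    unfolding H_def absolutely_integrable_on_def by (auto intro: integrable_integral)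
  have pos: "s\<^sup>2 * F - 2 * s * t * H + t\<^sup>2 * G \<ge> 0" for s t
  proof -
    have "((\<lambda>x. s\<^sup>2 * (norm (f x))\<^sup>2 - 2 * s * t * (norm (f x) * norm (g x)) + t\<^sup>2 * (norm (g x))\<^sup>2)
        has_integral (s\<^sup>2 * F - 2 * s * t * H + t\<^sup>2 * G)) {a..b}"
      by (intro has_integral_add has_integral_diff has_integral_mult_right If Ig Ih)
    then show ?thesis
    proof (rule has_integral_nonneg)
      fix x
      have "0 \<le> (s * norm (f x) - t * norm (g x))\<^sup>2" by simp
      also have "\<dots> = s\<^sup>2 * (norm (f x))\<^sup>2 - 2 * s * t * (norm (f x) * norm (g x)) + t\<^sup>2 * (norm (g x))\<^sup>2"
        by (simp add: power2_eq_square algebra_simps)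
      finally show "0 \<le> s\<^sup>2 * (norm (f x))\<^sup>2 - 2 * s * t * (norm (f x) * norm (g x)) + t\<^sup>2 * (norm (g x))\<^sup>2" .
    qed
  qed
  have F0: "F \<ge> 0" and G0: "G \<ge> 0" using pos[of 1 0] pos[of 0 1] by auto
  have "H\<^sup>2 \<le> F * G"
  proof (cases "G = 0")
    case False
    have "0 \<le> G * (F * G - H\<^sup>2)" using pos[of G H] by (simp add: power2_eq_square algebra_simps)
    with False G0 show ?thesis by (simp add: zero_le_mult_iff)
  next
    case True
    show ?thesis
    proof (cases "F = 0")
      case True
      then show ?thesis using \<open>G = 0\<close> pos[of 1 1] pos[of 1 "-1"] by simp
    next
      case False
      have "0 \<le> F * (F * G - H\<^sup>2)" using pos[of H F] by (simp add: power2_eq_square algebra_simps)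
      with False F0 show ?thesis by (simp add: zero_le_mult_iff)
    qed
  qed
  then show ?thesis unfolding F_def G_def H_def .
qed

lemma L2_on_integral_norm_le:
  assumes "L2_on a b f" "a \<le> b"
  shows "(integral {a..b} (\<lambda>x. norm (f x)))\<^sup>2 \<le> (b - a) * integral {a..b} (\<lambda>x. (norm (f x))\<^sup>2)"
  using Cauchy_Schwarz_L2_on[OF L2_on_continuous[of a b "\<lambda>x. 1::real"] assms(1)] assms(2) by simp

lemma norm_matrix_vector_mult_le:
  fixes A :: "complex ^ 'n::finite ^ 'k::finite"
  shows "norm (A *v x) \<le> norm A * norm x"
proof -
  have "norm ((A *v x) $ i) \<le> norm (A $ i) * norm x" for i
  proof -
    have "norm ((A *v x) $ i) \<le> (\<Sum>j\<in>UNIV. \<bar>norm (A $ i $ j)\<bar> * \<bar>norm (x $ j)\<bar>)"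
      unfolding matrix_vector_mult_def by (auto simp: norm_mult intro: order_trans[OF norm_sum])
    also have "\<dots> \<le> norm (A $ i) * norm x"
      unfolding norm_vec_def by (rule L2_set_mult_ineq)
    finally show ?thesis .
  qed
  then have "norm (A *v x) \<le> L2_set (\<lambda>i. norm (A $ i) * norm x) UNIV"
    unfolding norm_vec_def[of "A *v x"] by (intro L2_set_mono) auto
  also have "\<dots> = norm A * norm x"
    unfolding norm_vec_def[of A] by (rule L2_set_left_distrib[symmetric]) auto
  finally show ?thesis .
qed

lemma bilinear_matrix_vector_mult:
  "bilinear (\<lambda>(A :: complex ^ 'n::finite ^ 'k::finite) x. A *v x)"
  unfolding bilinear_def
  by (auto intro!: linearI simp: algebra_simps matrix_vector_mult_def vec_eq_iff sum.distrib scaleR_sum_right)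

lemma norm_vector_scalar_mult: "norm ((c::complex) *s (v :: complex ^ 'n::finite)) = norm c * norm v"
  unfolding norm_vec_def by (simp add: norm_mult L2_set_right_distrib)

lemma bounded_bilinear_vector_scalar_mult:
  "bounded_bilinear ((*s) :: complex \<Rightarrow> complex ^ 'n::finite \<Rightarrow> _)"
  by (rule bounded_bilinear.intro)
     (auto simp: vec_eq_iff algebra_simps norm_vector_scalar_mult intro!: exI[of _ 1])

lemma L2_on_add:
  assumes "L2_on a b f" "L2_on a b g"
  shows "L2_on a b (\<lambda>x. f x + g x)"
proof -
  have m: "(\<lambda>x. f x + g x) \<in> borel_measurable (lebesgue_on {a..b})"
    using assms by (auto simp: L2_on_def)
  have "(\<lambda>x. (norm (f x + g x))\<^sup>2) integrable_on {a..b}"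
  proof (rule measurable_bounded_by_integrable_imp_integrable_real)
    show "(\<lambda>x. (norm (f x + g x))\<^sup>2) \<in> borel_measurable (lebesgue_on {a..b})"
      using m by measurable
    show "(\<lambda>x. 2 *\<^sub>R (norm (f x))\<^sup>2 + 2 *\<^sub>R (norm (g x))\<^sup>2) integrable_on {a..b}"
      using assms by (intro integrable_cmul integrable_add) (auto simp: L2_on_def)
    show "\<bar>(norm (f x + g x))\<^sup>2\<bar> \<le> 2 *\<^sub>R (norm (f x))\<^sup>2 + 2 *\<^sub>R (norm (g x))\<^sup>2" for x
      using norm_add_power2_le[of "f x" "g x"] by simp
  qed auto
  with m show ?thesis by (simp add: L2_on_def)
qed

lemma L2_on_linear:
  assumes f: "L2_on a b f" and L: "bounded_linear L"
  shows "L2_on a b (\<lambda>x. L (f x))"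
proof -
  obtain K where K: "\<And>x. norm (L x) \<le> norm x * K" using bounded_linear.bounded[OF L] by blast
  have m: "(\<lambda>x. L (f x)) \<in> borel_measurable (lebesgue_on {a..b})"
    by (rule measurable_compose[of f _ borel])
      (use f L in \<open>auto simp: L2_on_def intro!: borel_measurable_continuous_onI linear_continuous_on\<close>)
  have "(\<lambda>x. (norm (L (f x)))\<^sup>2) integrable_on {a..b}"
  proof (rule measurable_bounded_by_integrable_imp_integrable_real)
    show "(\<lambda>x. (norm (L (f x)))\<^sup>2) \<in> borel_measurable (lebesgue_on {a..b})"
      using m by measurable
    show "(\<lambda>x. K\<^sup>2 *\<^sub>R (norm (f x))\<^sup>2) integrable_on {a..b}"
      using f by (intro integrable_cmul) (auto simp: L2_on_def)
    fix x
    have "(norm (L (f x)))\<^sup>2 \<le> (norm (f x) * K)\<^sup>2" by (intro power_mono K) auto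
    then show "\<bar>(norm (L (f x)))\<^sup>2\<bar> \<le> K\<^sup>2 *\<^sub>R (norm (f x))\<^sup>2" by (simp add: power_mult_distrib mult.commute)
  qed auto
  with m show ?thesis by (simp add: L2_on_def)
qed

lemma L2_on_vec:
  fixes f :: "real \<Rightarrow> 'a::euclidean_space ^ 'k::finite"
  assumes "\<And>i. L2_on a b (\<lambda>x. f x $ i)"
  shows "L2_on a b f"
proof -
  have *: "L2_on a b (\<lambda>x. \<Sum>i\<in>I. axis i (f x $ i))" if "finite I" for I :: "'k set"
    using that
  proof (induction I rule: finite_induct)
    case empty
    then show ?case by (simp add: L2_on_continuous)
  next
    case (insert i I)
    have "linear (\<lambda>v::'a. axis i v :: 'a ^ 'k)" by (auto intro!: linearI simp: vec_eq_iff axis_def)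
    then have "L2_on a b (\<lambda>x. axis i (f x $ i))"
      using L2_on_linear[OF assms[of i]] by (simp add: linear_conv_bounded_linear)
    then show ?case using insert by (simp add: L2_on_add)
  qed
  have "(\<Sum>i\<in>UNIV. axis i (v $ i)) = v" for v :: "'a ^ 'k"
    by (simp add: vec_eq_iff axis_def if_distrib cong: if_cong)
  with *[of UNIV] show ?thesis by simp
qed

lemma locally_square_integrable_L2_on:
  assumes "locally_square_integrable q"
  shows "L2_on a b q"
proof -
  have "(\<lambda>x. (norm (q x))\<^sup>2) integrable_on {a..b}"
    using assms set_lebesgue_integral_eq_integral(1) unfolding locally_square_integrable_def by blast
  moreover have "q \<in> borel_measurable (lebesgue_on {a..b})"
    using assms by (auto simp: locally_square_integrable_def intro: measurable_restrict_space1)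
  ultimately show ?thesis by (simp add: L2_on_def)
qed

section \<open>Linear differential equations with square integrable coefficients\<close>

text \<open>
  With the weight \<open>e\<^bsup>-Kx\<^esup>\<close> the Volterra operator of a linear equation with coefficient \<open>h\<close> becomes
  a contraction on the whole interval. With \<open>e\<close> the exponential kernel, from \<open>2 |h| e \<le> \<delta> |h|\<^sup>2 + e\<^sup>2 / \<delta>\<close> the integral is at most
  \<open>\<delta>/2 \<parallel>h\<parallel>\<^sup>2 + 1 / (4 \<delta> K)\<close>; first \<open>\<delta>\<close> is chosen small, then \<open>K\<close> large.
\<close>

lemma weighted_kernel_small:
  fixes h :: "real \<Rightarrow> 'a::euclidean_space"
  assumes h: "L2_on 0 l h" and l: "l > 0"
  obtains K where "K > 0"
    "\<And>x. 0 \<le> x \<Longrightarrow> x \<le> l \<Longrightarrow> (\<lambda>s. norm (h s) * exp (K * (s - x))) integrable_on {0..x}"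
    "\<And>x. 0 \<le> x \<Longrightarrow> x \<le> l \<Longrightarrow> integral {0..x} (\<lambda>s. norm (h s) * exp (K * (s - x))) \<le> 1/2"
proof -
  define H where "H = integral {0..l} (\<lambda>x. (norm (h x))\<^sup>2)"
  have Ih: "(\<lambda>x. (norm (h x))\<^sup>2) integrable_on {0..l}" using h by (simp add: L2_on_def)
  have H0: "H \<ge> 0" unfolding H_def by (rule integral_nonneg[OF Ih]) auto
  \<comment> \<open>With this \<open>\<delta>\<close> and \<open>K = 1 / \<delta>\<close> both summands are at most \<open>1/4\<close>.\<close>
  define \<delta> where "\<delta> = 1 / (2 * (H + 1))"
  have \<delta>: "\<delta> > 0" "\<delta> * H \<le> 1/2" using H0 by (auto simp: \<delta>_def field_simps)
  define K where "K = 1 / \<delta>"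
  have K: "K > 0" using \<delta> by (simp add: K_def)
  have int: "(\<lambda>s. norm (h s) * exp (K * (s - x))) integrable_on {0..x}" if "0 \<le> x" "x \<le> l" for x
  proof -
    have "L2_on 0 x h" using L2_on_subinterval[OF h] that by auto
    from L2_on_product_integrable[OF bilinear_times L2_on_norm[OF this] L2_on_continuous[of 0 x "\<lambda>s. exp (K * (s - x))"]]
    have "(\<lambda>s. norm (h s) * exp (K * (s - x))) absolutely_integrable_on {0..x}"
      by (simp add: continuous_intros)
    then show ?thesis by (simp add: absolutely_integrable_on_def)
  qed
  have "integral {0..x} (\<lambda>s. norm (h s) * exp (K * (s - x))) \<le> 1/2" if x: "0 \<le> x" "x \<le> l" for x
  proof -
    have e1: "((\<lambda>s. exp (2 * K * (s - x))) has_integral (exp (2 * K * (x - x)) / (2*K) - exp (2 * K * (0 - x)) / (2*K))) {0..x}"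
      by (rule fundamental_theorem_of_calculus[OF x(1)])
         (use K in \<open>auto intro!: derivative_eq_intros simp flip: has_real_derivative_iff_has_vector_derivative\<close>)
    have Ihx: "(\<lambda>x. (norm (h x))\<^sup>2) integrable_on {0..x}"
      by (rule integrable_on_subinterval[OF Ih]) (use x in auto)
    have Hx: "integral {0..x} (\<lambda>x. (norm (h x))\<^sup>2) \<le> H"
      unfolding H_def by (rule integral_subset_le) (use x Ih Ihx in auto)
    have e2: "((\<lambda>s. \<delta>/2 * (norm (h s))\<^sup>2 + 1/(2*\<delta>) * exp (2 * K * (s - x))) has_integral
       (\<delta>/2 * integral {0..x} (\<lambda>x. (norm (h x))\<^sup>2) + 1/(2*\<delta>) * (exp (2 * K * (x - x)) / (2*K) - exp (2 * K * (0 - x)) / (2*K)))) {0..x}"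
      by (intro has_integral_add has_integral_mult_right e1 integrable_integral Ihx)
    have "integral {0..x} (\<lambda>s. norm (h s) * exp (K * (s - x))) \<le>
       \<delta>/2 * integral {0..x} (\<lambda>x. (norm (h x))\<^sup>2) + 1/(2*\<delta>) * (exp (2 * K * (x - x)) / (2*K) - exp (2 * K * (0 - x)) / (2*K))"
    proof (rule has_integral_le[OF integrable_integral[OF int[OF x]] e2])
      fix s
      have "0 \<le> (\<delta> * norm (h s) - exp (K * (s - x)))\<^sup>2 / (2*\<delta>)" using \<delta> by simp
      also have "\<dots> = \<delta>/2 * (norm (h s))\<^sup>2 + 1/(2*\<delta>) * (exp (K * (s - x)))\<^sup>2 - norm (h s) * exp (K * (s - x))"
        using \<delta> by (simp add: power2_diff power_mult_distrib field_simps power2_eq_square)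
      also have "(exp (K * (s - x)))\<^sup>2 = exp (2 * K * (s - x))"
        by (simp add: exp_double[symmetric] algebra_simps)
      finally show "norm (h s) * exp (K * (s - x)) \<le> \<delta>/2 * (norm (h s))\<^sup>2 + 1/(2*\<delta>) * exp (2 * K * (s - x))" by simp
    qed
    also have "\<dots> \<le> \<delta>/2 * H + 1/(2*\<delta>) * (1 / (2*K))"
      using \<delta> K Hx by (intro add_mono mult_left_mono) auto
    also have "1/(2*\<delta>) * (1 / (2*K)) = 1/4" using \<delta> by (simp add: K_def)
    finally show ?thesis using \<delta>(2) by simp
  qed
  with K int that show ?thesis by blast
qed

lemma linear_ode_rhs_integrable:
  fixes A :: "real \<Rightarrow> complex ^ 'n::finite ^ 'n"
  assumes "L2_on a b A" "continuous_on {a..b} W" "F absolutely_integrable_on {a..b}"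
  shows "(\<lambda>x. A x *v W x + F x) absolutely_integrable_on {a..b}"
  by (intro set_integral_add assms L2_on_product_integrable[OF bilinear_matrix_vector_mult] L2_on_continuous)

text \<open>
  Picard iteration for a coefficient that is merely square integrable: the Banach fixed point
  theorem in the weighted supremum norm. The unknown is \<open>Z(x) = e\<^bsup>-Kx\<^esup> W(x)\<close>, extended to the line by
  clamping the argument to the interval, so that the space of bounded continuous functions applies.
\<close>

lemma linear_ode_exists:
  fixes A :: "real \<Rightarrow> complex ^ 'n::finite ^ 'n"
  assumes A: "L2_on 0 l A" and l: "l > 0" and F: "F absolutely_integrable_on {0..l}"
  shows "\<exists>W. ac_on 0 l W (\<lambda>x. A x *v W x + F x) \<and> W 0 = w0"
proof -
  obtain K where K: "K > 0"
    "\<And>x. 0 \<le> x \<Longrightarrow> x \<le> l \<Longrightarrow> (\<lambda>s. norm (A s) * exp (K * (s - x))) integrable_on {0..x}"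
    "\<And>x. 0 \<le> x \<Longrightarrow> x \<le> l \<Longrightarrow> integral {0..x} (\<lambda>s. norm (A s) * exp (K * (s - x))) \<le> 1/2"
    using weighted_kernel_small[OF A l] by blast
  define R where "R Z s = A s *v (exp (K * s) *\<^sub>R apply_bcontfun Z s) + F s" for Z s
  define \<Phi> where "\<Phi> Z x = exp (- K * x) *\<^sub>R (w0 + integral {0..x} (R Z))" for Z x
  have R: "R Z absolutely_integrable_on {0..l}" for Z
    unfolding R_def by (intro linear_ode_rhs_integrable A F continuous_intros continuous_on_apply_bcontfun)
  have Rx: "R Z integrable_on {0..x}" if "0 \<le> x" "x \<le> l" for Z x
    using absolutely_integrable_on_subinterval[OF R, of 0 x] that by (auto simp: absolutely_integrable_on_def)
  have "continuous_on {0..l} (\<Phi> Z)" for Z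
    unfolding \<Phi>_def by (intro continuous_intros indefinite_integral_continuous_1 Rx) (use l in auto)
  then have "\<exists>Z'. \<forall>x. apply_bcontfun Z' x = \<Phi> Z (clamp 0 l x)" for Z
    by (metis continuous_on_cbox_bcontfunE cbox_interval)
  then obtain T where T: "\<And>Z x. apply_bcontfun (T Z) x = \<Phi> Z (clamp 0 l x)" by metis
  have "dist (T Z) (T Z') \<le> 1/2 * dist Z Z'" for Z Z'
  proof (rule dist_bound)
    fix y
    define x where "x = clamp 0 l y"
    have x: "0 \<le> x" "x \<le> l" using clamp_in_interval[of 0 l y] l unfolding x_def by auto
    have "\<Phi> Z x - \<Phi> Z' x = exp (- K * x) *\<^sub>R integral {0..x} (\<lambda>s. R Z s - R Z' s)"
      unfolding \<Phi>_def by (simp add: Henstock_Kurzweil_Integration.integral_diff Rx x algebra_simps)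
    also have "\<dots> = integral {0..x} (\<lambda>s. exp (- K * x) *\<^sub>R (R Z s - R Z' s))"
      by (simp add: integral_cmul)
    also have "norm \<dots> \<le> integral {0..x} (\<lambda>s. dist Z Z' * (norm (A s) * exp (K * (s - x))))"
    proof (rule Henstock_Kurzweil_Integration.integral_norm_bound_integral)
      show "(\<lambda>s. exp (- K * x) *\<^sub>R (R Z s - R Z' s)) integrable_on {0..x}"
        by (intro integrable_cmul integrable_diff Rx x)
      show "(\<lambda>s. dist Z Z' * (norm (A s) * exp (K * (s - x)))) integrable_on {0..x}"
        using integrable_cmul[OF K(2)[OF x], of "dist Z Z'"] by simp
      fix s
      have "R Z s - R Z' s = A s *v (exp (K * s) *\<^sub>R (apply_bcontfun Z s - apply_bcontfun Z' s))"
        unfolding R_def by (simp add: algebra_simps matrix_vector_mult_scaleR matrix_vector_mult_diff_distrib)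
      then have "norm (R Z s - R Z' s) \<le> norm (A s) * (exp (K * s) * norm (apply_bcontfun Z s - apply_bcontfun Z' s))"
        using norm_matrix_vector_mult_le[of "A s" "exp (K * s) *\<^sub>R (apply_bcontfun Z s - apply_bcontfun Z' s)"] by simp
      also have "\<dots> \<le> norm (A s) * (exp (K * s) * dist Z Z')"
        by (intro mult_left_mono) (auto simp flip: dist_norm intro: dist_bounded)
      finally have "exp (- K * x) * norm (R Z s - R Z' s) \<le> exp (- K * x) * (norm (A s) * (exp (K * s) * dist Z Z'))"
        by (intro mult_left_mono) auto
      also have "\<dots> = dist Z Z' * (norm (A s) * exp (K * (s - x)))"
        by (simp add: exp_diff exp_minus algebra_simps divide_simps)
      finally show "norm (exp (- K * x) *\<^sub>R (R Z s - R Z' s)) \<le> dist Z Z' * (norm (A s) * exp (K * (s - x)))"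
        by simp
    qed
    also have "\<dots> = dist Z Z' * integral {0..x} (\<lambda>s. norm (A s) * exp (K * (s - x)))"
      by simp
    also have "\<dots> \<le> dist Z Z' * (1/2)"
      by (rule mult_left_mono[OF K(3)[OF x]]) simp
    finally show "dist (apply_bcontfun (T Z) y) (apply_bcontfun (T Z') y) \<le> 1/2 * dist Z Z'"
      unfolding T x_def[symmetric] by (simp add: dist_norm)
  qed
  then have "\<exists>!Z. T Z = Z"
    by (intro banach_fix_type[of "1/2"]) auto
  then obtain Z where Z: "T Z = Z" by blast
  define W where "W x = exp (K * x) *\<^sub>R apply_bcontfun Z x" for x
  have W: "W x = w0 + integral {0..x} (R Z)" if "0 \<le> x" "x \<le> l" for x
  proof -
    have "clamp 0 l x = x" using that by (intro clamp_cancel_cbox) auto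
    then have "apply_bcontfun Z x = \<Phi> Z x" using T[of Z x] Z by simp
    then show ?thesis unfolding W_def \<Phi>_def by (simp add: exp_minus)
  qed
  have RW: "R Z x = A x *v W x + F x" for x unfolding R_def W_def ..
  have "ac_on 0 l W (\<lambda>x. A x *v W x + F x)"
    unfolding RW[symmetric]
  proof (rule ac_onI[OF R])
    fix x assume "0 \<le> x" "x \<le> l"
    then show "W x - W 0 = integral {0..x} (R Z)" using W[of x] W[of 0] by simp
  qed
  moreover have "W 0 = w0" using W[of 0] l by simp
  ultimately show ?thesis by blast
qed

text \<open>
  Gronwall's inequality without differentiation: at a maximum point \<open>z\<close> of \<open>e\<^bsup>-Kx\<^esup> |W(x)|\<close> the integral
  equation bounds the maximum by the data plus half of itself.
\<close>

lemma linear_ode_bound: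
  fixes A :: "real \<Rightarrow> complex ^ 'n::finite ^ 'n"
  assumes A: "L2_on 0 l A" and l: "l > 0"
  obtains C where "C > 0"
    "\<And>F W x. L2_on 0 l F \<Longrightarrow> ac_on 0 l W (\<lambda>x. A x *v W x + F x) \<Longrightarrow> 0 \<le> x \<Longrightarrow> x \<le> l
      \<Longrightarrow> norm (W x) \<le> C * (norm (W 0) + sqrt (integral {0..l} (\<lambda>x. (norm (F x))\<^sup>2)))"
proof -
  obtain K where K: "K > 0"
    "\<And>x. 0 \<le> x \<Longrightarrow> x \<le> l \<Longrightarrow> (\<lambda>s. norm (A s) * exp (K * (s - x))) integrable_on {0..x}"
    "\<And>x. 0 \<le> x \<Longrightarrow> x \<le> l \<Longrightarrow> integral {0..x} (\<lambda>s. norm (A s) * exp (K * (s - x))) \<le> 1/2"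
    using weighted_kernel_small[OF A l] by blast
  show ?thesis
  proof (rule that[of "2 * exp (K * l) * (1 + sqrt l)"])
    show "2 * exp (K * l) * (1 + sqrt l) > 0" using l by (simp add: add_pos_nonneg)
    fix F :: "real \<Rightarrow> complex ^ 'n" and W x
    assume F: "L2_on 0 l F" and W: "ac_on 0 l W (\<lambda>x. A x *v W x + F x)" and x: "0 \<le> x" "x \<le> l"
    define \<phi> where "\<phi> = integral {0..l} (\<lambda>x. (norm (F x))\<^sup>2)"
    have \<phi>: "\<phi> \<ge> 0" unfolding \<phi>_def using F by (intro integral_nonneg) (auto simp: L2_on_def)
    define N where "N = norm (W 0) + integral {0..l} (\<lambda>x. norm (F x))"
    have IF: "(\<lambda>x. norm (F x)) integrable_on {0..l}"
      using L2_on_imp_integrable[OF F] by (simp add: absolutely_integrable_on_def)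
    have "continuous_on {0..l} (\<lambda>x. exp (- K * x) * norm (W x))"
      by (intro continuous_intros ac_on_continuous[OF W])
    then obtain z where z: "z \<in> {0..l}" "\<And>y. y \<in> {0..l} \<Longrightarrow> exp (- K * y) * norm (W y) \<le> exp (- K * z) * norm (W z)"
      using continuous_attains_sup[of "{0..l}" "\<lambda>x. exp (- K * x) * norm (W x)"] l by auto
    define m where "m = exp (- K * z) * norm (W z)"
    have m0: "m \<ge> 0" by (simp add: m_def)
    have Wm: "norm (W y) \<le> exp (K * y) * m" if "y \<in> {0..l}" for y
    proof -
      have "exp (K * y) * (exp (- K * y) * norm (W y)) \<le> exp (K * y) * m"
        unfolding m_def by (intro mult_left_mono z that) auto
      then show ?thesis by (simp add: exp_minus field_simps)
    qed
    have z': "0 \<le> z" "z \<le> l" using z by auto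
    have i1: "(\<lambda>s. norm (F s)) integrable_on {0..z}"
      by (rule integrable_on_subinterval[OF IF]) (use z' in auto)
    have i2: "(\<lambda>s. exp (K * z) * m * (norm (A s) * exp (K * (s - z)))) integrable_on {0..z}"
      using integrable_cmul[OF K(2)[OF z'], of "exp (K * z) * m"] by simp
    have "norm (W z - W 0) \<le> integral {0..z} (\<lambda>s. exp (K * z) * m * (norm (A s) * exp (K * (s - z))) + norm (F s))"
    proof (rule ac_on_norm_increment_le[OF W _ z'(1) z'(2)])
      show "(\<lambda>s. exp (K * z) * m * (norm (A s) * exp (K * (s - z))) + norm (F s)) integrable_on {0..z}"
        by (intro integrable_add i1 i2)
      fix s assume s: "s \<in> {0..z}"
      have "norm (A s *v W s + F s) \<le> norm (A s) * norm (W s) + norm (F s)"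
        using norm_triangle_ineq[of "A s *v W s" "F s"] norm_matrix_vector_mult_le[of "A s" "W s"] by linarith
      also have "norm (A s) * norm (W s) \<le> norm (A s) * (exp (K * s) * m)"
        by (intro mult_left_mono Wm) (use s z' in auto)
      also have "\<dots> = exp (K * z) * m * (norm (A s) * exp (K * (s - z)))"
        by (simp add: exp_diff algebra_simps)
      finally show "norm (A s *v W s + F s) \<le> exp (K * z) * m * (norm (A s) * exp (K * (s - z))) + norm (F s)" by simp
    qed simp
    also have "\<dots> = exp (K * z) * m * integral {0..z} (\<lambda>s. norm (A s) * exp (K * (s - z))) + integral {0..z} (\<lambda>s. norm (F s))"
      by (subst Henstock_Kurzweil_Integration.integral_add[OF i2 i1]) simp
    also have "\<dots> \<le> exp (K * z) * m * (1/2) + integral {0..l} (\<lambda>s. norm (F s))"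
      by (intro add_mono mult_left_mono K(3) z' integral_subset_le i1 IF) (use m0 z' in auto)
    finally have "norm (W z) \<le> exp (K * z) * m * (1/2) + N"
      using norm_triangle_sub[of "W z" "W 0"] unfolding N_def by linarith
    then have "exp (- K * z) * norm (W z) \<le> exp (- K * z) * (exp (K * z) * m * (1/2) + N)"
      by (intro mult_left_mono) auto
    also have "\<dots> = m/2 + exp (- K * z) * N" by (simp add: algebra_simps exp_minus)
    also have "N \<ge> 0" unfolding N_def using integral_nonneg[OF IF] by auto
    then have "exp (- K * z) * N \<le> 1 * N" using K z' by (intro mult_right_mono) auto
    finally have "m \<le> 2 * N" unfolding m_def by simp
    have "norm (W x) \<le> exp (K * x) * m" using Wm[of x] x by simp
    also have "\<dots> \<le> exp (K * l) * (2 * N)"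
      using \<open>m \<le> 2 * N\<close> m0 x K by (intro mult_mono) auto
    also have "N \<le> (1 + sqrt l) * (norm (W 0) + sqrt \<phi>)"
    proof -
      have "integral {0..l} (\<lambda>x. norm (F x)) \<le> sqrt l * sqrt \<phi>"
        using L2_on_integral_norm_le[OF F] l
        by (simp add: \<phi>_def real_le_rsqrt real_sqrt_mult[symmetric])
      moreover have "0 \<le> sqrt l * norm (W 0)" "0 \<le> sqrt \<phi>" using l \<phi> by simp_all
      moreover have "(1 + sqrt l) * (norm (W 0) + sqrt \<phi>)
          = norm (W 0) + sqrt \<phi> + sqrt l * norm (W 0) + sqrt l * sqrt \<phi>"
        by (simp add: algebra_simps)
      ultimately show ?thesis unfolding N_def by linarith
    qed
    finally show "norm (W x) \<le> 2 * exp (K * l) * (1 + sqrt l) *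
        (norm (W 0) + sqrt (integral {0..l} (\<lambda>x. (norm (F x))\<^sup>2)))"
      by (simp add: \<phi>_def mult_ac)
  qed
qed

lemma linear_ode_unique:
  fixes A :: "real \<Rightarrow> complex ^ 'n::finite ^ 'n"
  assumes A: "L2_on 0 l A" and l: "l > 0"
    and "ac_on 0 l V (\<lambda>x. A x *v V x + F x)" "ac_on 0 l W (\<lambda>x. A x *v W x + F x)" "V 0 = W 0"
    and x: "0 \<le> x" "x \<le> l"
  shows "V x = W x"
proof -
  obtain C where C: "C > 0"
    "\<And>F W x. L2_on 0 l F \<Longrightarrow> ac_on 0 l W (\<lambda>x. A x *v W x + F x) \<Longrightarrow> 0 \<le> x \<Longrightarrow> x \<le> l
      \<Longrightarrow> norm (W x) \<le> C * (norm (W 0) + sqrt (integral {0..l} (\<lambda>x. (norm (F x))\<^sup>2)))"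
    using linear_ode_bound[OF A l] by blast
  have "ac_on 0 l (\<lambda>x. V x - W x) (\<lambda>x. A x *v (V x - W x) + 0)"
    using ac_on_diff[OF assms(3,4)] by (simp add: algebra_simps matrix_vector_mult_diff_distrib)
  from C(2)[OF _ this x] show ?thesis using assms(5) by (simp add: L2_on_continuous)
qed

text \<open>
  By uniqueness the value at \<open>l\<close> depends on the value at \<open>0\<close>, and does so linearly.
\<close>

lemma monodromy_matrix_exists:
  fixes A :: "real \<Rightarrow> complex ^ 'n::finite ^ 'n"
  assumes A: "L2_on 0 l A" and l: "l > 0"
  obtains M where "\<And>W. ac_on 0 l W (\<lambda>x. A x *v W x) \<Longrightarrow> W l = M *v W 0"
proof -
  have "\<exists>W. ac_on 0 l W (\<lambda>x. A x *v W x) \<and> W 0 = w" for w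
    using linear_ode_exists[OF A l, of "\<lambda>_. 0" w] by simp
  then obtain S where S: "\<And>w. ac_on 0 l (S w) (\<lambda>x. A x *v S w x)" "\<And>w. S w 0 = w"
    by metis
  have uniq: "W l = S (W 0) l" if "ac_on 0 l W (\<lambda>x. A x *v W x)" for W
    using linear_ode_unique[OF A l, of W "\<lambda>_. 0" "S (W 0)" l] S[of "W 0"] that l by simp
  have "Vector_Spaces.linear (*s) (*s) (\<lambda>w. S w l)"
  proof (rule Vector_Spaces.linear_iff[THEN iffD2], intro conjI allI vec.vector_space_axioms)
    fix v w :: "complex ^ 'n" and c :: complex
    have "ac_on 0 l (\<lambda>x. S v x + S w x) (\<lambda>x. A x *v (S v x + S w x))"
      using ac_on_add[OF S(1)[of v] S(1)[of w]] by (simp add: algebra_simps)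
    from uniq[OF this] show "S (v + w) l = S v l + S w l" by (simp add: S(2))
    have "bounded_linear (\<lambda>x :: complex ^ 'n. c *s x)"
      using bounded_bilinear.bounded_linear_right[OF bounded_bilinear_vector_scalar_mult] .
    from ac_on_linear[OF S(1)[of v] this]
    have "ac_on 0 l (\<lambda>x. c *s S v x) (\<lambda>x. A x *v (c *s S v x))"
      by (simp add: vec.scale vector_scalar_commute)
    from uniq[OF this] show "S (c *s v) l = c *s S v l" by (simp add: S(2))
  qed
  from matrix_works[OF this] uniq have "W l = matrix (\<lambda>w. S w l) *v W 0"
    if "ac_on 0 l W (\<lambda>x. A x *v W x)" for W using that by simp
  with that show ?thesis by blast
qed

section \<open>Square summable two-sided sequences\<close>

text \<open>
  The squared norm in \<open>\<ell>\<^sup>2(\<int>)\<close> as an extended nonnegative real: sums can be exchanged and shifted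
  before finiteness is known.
\<close>

definition l2_sq :: "(int \<Rightarrow> 'a::real_normed_vector) \<Rightarrow> ennreal" where
  "l2_sq w = (\<integral>\<^sup>+n. ennreal ((norm (w n))\<^sup>2) \<partial>count_space UNIV)"

lemma l2_sq_shift: "l2_sq (\<lambda>n. w (n + k)) = l2_sq w"
proof -
  have "bij (\<lambda>n::int. n + k)" by (rule bij_plus_right)
  from nn_integral_bij_count_space[OF this, of "\<lambda>n. ennreal ((norm (w n))\<^sup>2)"]
  show ?thesis by (simp add: l2_sq_def)
qed

lemma l2_sq_scale_le:
  assumes "\<And>n. norm (v n) \<le> c * norm (w n)" 
  shows "l2_sq v \<le> ennreal (c\<^sup>2) * l2_sq w"
proof -
  have "l2_sq v \<le> (\<integral>\<^sup>+n. ennreal (c\<^sup>2) * ennreal ((norm (w n))\<^sup>2) \<partial>count_space UNIV)"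
    unfolding l2_sq_def
  proof (rule nn_integral_mono)
    fix n
    have "(norm (v n))\<^sup>2 \<le> (c * norm (w n))\<^sup>2"
      using assms[of n] by (intro power_mono) auto
    then show "ennreal ((norm (v n))\<^sup>2) \<le> ennreal (c\<^sup>2) * ennreal ((norm (w n))\<^sup>2)"
      by (simp add: ennreal_mult[symmetric] power_mult_distrib ennreal_leI)
  qed
  then show ?thesis by (simp add: l2_sq_def nn_integral_cmult)
qed

lemma l2_sq_add_le: "l2_sq (\<lambda>n. v n + w n) \<le> 2 * l2_sq v + 2 * l2_sq w"
proof -
  have "l2_sq (\<lambda>n. v n + w n) \<le> (\<integral>\<^sup>+n. 2 * ennreal ((norm (v n))\<^sup>2) + 2 * ennreal ((norm (w n))\<^sup>2) \<partial>count_space UNIV)"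
    unfolding l2_sq_def
  proof (rule nn_integral_mono)
    fix n
    have "ennreal ((norm (v n + w n))\<^sup>2) \<le> ennreal (2 * (norm (v n))\<^sup>2 + 2 * (norm (w n))\<^sup>2)"
      by (intro ennreal_leI norm_add_power2_le)
    then show "ennreal ((norm (v n + w n))\<^sup>2) \<le> 2 * ennreal ((norm (v n))\<^sup>2) + 2 * ennreal ((norm (w n))\<^sup>2)"
      by (simp add: ennreal_plus ennreal_mult)
  qed
  then show ?thesis by (simp add: l2_sq_def nn_integral_cmult nn_integral_add)
qed

lemma l2_sq_finite_add: "l2_sq v < \<infinity> \<Longrightarrow> l2_sq w < \<infinity> \<Longrightarrow> l2_sq (\<lambda>n. v n + w n) < \<infinity>"
  by (rule le_less_trans[OF l2_sq_add_le]) (simp add: ennreal_mult_less_top)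

lemma l2_sq_finite_scale:
  assumes "\<And>n. norm (v n) \<le> c * norm (w n)" "l2_sq w < \<infinity>"
  shows "l2_sq v < \<infinity>"
  by (rule le_less_trans[OF l2_sq_scale_le[OF assms(1)]]) (use assms in \<open>auto simp: ennreal_mult_less_top\<close>)

lemma l2_sq_finite_diff: "l2_sq v < \<infinity> \<Longrightarrow> l2_sq w < \<infinity> \<Longrightarrow> l2_sq (\<lambda>n. v n - w n) < \<infinity>"
  using l2_sq_finite_add[of v "\<lambda>n. - w n"] l2_sq_finite_scale[of "\<lambda>n. - w n" 1 w] by simp

lemma l2_sq_eq_0: "l2_sq w = 0 \<Longrightarrow> w n = 0"
  by (auto simp: l2_sq_def nn_integral_0_iff_AE AE_count_space ennreal_eq_0_iff)

lemma norm_le_l2_sq: "ennreal ((norm (w n))\<^sup>2) \<le> l2_sq w"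
proof -
  have "ennreal ((norm (w n))\<^sup>2) = (\<integral>\<^sup>+k. ennreal ((norm (w n))\<^sup>2) * indicator {n} k \<partial>count_space UNIV)"
    by (simp add: nn_integral_cmult_indicator)
  also have "\<dots> \<le> l2_sq w"
    unfolding l2_sq_def by (intro nn_integral_mono) (auto split: split_indicator)
  finally show ?thesis .
qed

text \<open>
  Young's inequality for convolution with a sequence dominated by a geometric one: the
  Cauchy-Schwarz inequality with weight \<open>r\<^sup>j\<close> in each term, then an exchange of the two sums and the
  invariance of the norm under shifts.
\<close>

lemma l2_sq_convolution:
  fixes g :: "int \<Rightarrow> complex ^ 'n::finite" and c :: "nat \<Rightarrow> complex" and \<sigma> :: "nat \<Rightarrow> int"
  assumes r: "0 \<le> r" "r < 1" and c: "\<And>j. norm (c j) \<le> r ^ j" and g: "l2_sq g < \<infinity>"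
  shows "summable (\<lambda>j. c j *s g (n + \<sigma> j))"
    and "l2_sq (\<lambda>n. \<Sum>j. c j *s g (n + \<sigma> j)) \<le> ennreal ((1 / (1 - r))\<^sup>2) * l2_sq g"
proof -
  obtain B where B: "l2_sq g = ennreal B" "B \<ge> 0" using g by (cases "l2_sq g") auto
  have gB: "norm (g n) \<le> sqrt B" for n
    using norm_le_l2_sq[of g n] B by (auto simp: intro!: real_le_rsqrt)
  have term_le: "norm (c j *s g (n + \<sigma> j)) \<le> r ^ j * norm (g (n + \<sigma> j))" for n j
    by (simp add: norm_vector_scalar_mult c mult_right_mono)
  have sum1: "summable (\<lambda>j. r ^ j * norm (g (n + \<sigma> j)))" for n
  proof (rule summable_comparison_test')
    show "summable (\<lambda>j. r ^ j * sqrt B)" using r by (intro summable_mult2 summable_geometric) auto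
    show "norm (r ^ j * norm (g (n + \<sigma> j))) \<le> r ^ j * sqrt B" for j
      using r gB[of "n + \<sigma> j"] by (auto intro!: mult_left_mono)
  qed
  have sum2: "summable (\<lambda>j. norm (c j *s g (n + \<sigma> j)))" for n
    by (rule summable_comparison_test'[OF sum1[of n]]) (use term_le in auto)
  then show "summable (\<lambda>j. c j *s g (n + \<sigma> j))" by (rule summable_norm_cancel)
  have pt: "ennreal ((norm (\<Sum>j. c j *s g (n + \<sigma> j)))\<^sup>2)
      \<le> ennreal (1 / (1 - r)) * (\<Sum>j. ennreal (r ^ j) * ennreal ((norm (g (n + \<sigma> j)))\<^sup>2))" for n
  proof -
    have "norm (\<Sum>j. c j *s g (n + \<sigma> j)) \<le> (\<Sum>j. r ^ j * norm (g (n + \<sigma> j)))"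
      by (rule order_trans[OF summable_norm[OF sum2]] suminf_le term_le sum1 sum2)+
    then have "ennreal (norm (\<Sum>j. c j *s g (n + \<sigma> j))) \<le> ennreal (\<Sum>j. r ^ j * norm (g (n + \<sigma> j)))"
      by (rule ennreal_leI)
    also have "\<dots> = (\<Sum>j. ennreal (r ^ j * norm (g (n + \<sigma> j))))"
      by (rule suminf_ennreal_eq[symmetric]) (use sum1 r in \<open>auto simp: summable_sums\<close>)
    also have "\<dots> = (\<integral>\<^sup>+j. ennreal (sqrt (r ^ j)) * ennreal (sqrt (r ^ j) * norm (g (n + \<sigma> j))) \<partial>count_space UNIV)"
      using r by (simp add: nn_integral_count_space_nat ennreal_mult[symmetric] mult.assoc[symmetric])
    finally have "(ennreal (norm (\<Sum>j. c j *s g (n + \<sigma> j))))\<^sup>2 \<le>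
        (\<integral>\<^sup>+j. ennreal (sqrt (r ^ j)) * ennreal (sqrt (r ^ j) * norm (g (n + \<sigma> j))) \<partial>count_space UNIV)\<^sup>2"
      by (rule power_mono) simp
    also have "\<dots> \<le> (\<integral>\<^sup>+j. (ennreal (sqrt (r ^ j)))\<^sup>2 \<partial>count_space UNIV) *
        (\<integral>\<^sup>+j. (ennreal (sqrt (r ^ j) * norm (g (n + \<sigma> j))))\<^sup>2 \<partial>count_space UNIV)"
      by (rule Cauchy_Schwarz_nn_integral) auto
    also have "\<dots> = (\<Sum>j. ennreal (r ^ j)) * (\<Sum>j. ennreal (r ^ j) * ennreal ((norm (g (n + \<sigma> j)))\<^sup>2))"
      using r by (simp add: nn_integral_count_space_nat ennreal_power power_mult_distrib ennreal_mult)
    also have "(\<Sum>j. ennreal (r ^ j)) = ennreal (1 / (1 - r))"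
      using r geometric_sums[of r] by (intro suminf_ennreal_eq) auto
    finally show ?thesis by (simp add: ennreal_power)
  qed
  have "l2_sq (\<lambda>n. \<Sum>j. c j *s g (n + \<sigma> j)) \<le>
     (\<integral>\<^sup>+n. ennreal (1 / (1 - r)) * (\<Sum>j. ennreal (r ^ j) * ennreal ((norm (g (n + \<sigma> j)))\<^sup>2)) \<partial>count_space UNIV)"
    unfolding l2_sq_def by (intro nn_integral_mono pt)
  also have "\<dots> = ennreal (1 / (1 - r)) * (\<Sum>j. ennreal (r ^ j) * l2_sq (\<lambda>n. g (n + \<sigma> j)))"
    unfolding l2_sq_def by (simp add: nn_integral_cmult nn_integral_suminf)
  also have "\<dots> = ennreal (1 / (1 - r)) * ((\<Sum>j. ennreal (r ^ j)) * l2_sq g)"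
    by (simp add: l2_sq_shift)
  also have "(\<Sum>j. ennreal (r ^ j)) = ennreal (1 / (1 - r))"
    using r geometric_sums[of r] by (intro suminf_ennreal_eq) auto
  finally show "l2_sq (\<lambda>n. \<Sum>j. c j *s g (n + \<sigma> j)) \<le> ennreal ((1 / (1 - r))\<^sup>2) * l2_sq g"
    using r by (simp add: ennreal_mult[symmetric] power2_eq_square mult.assoc[symmetric])
qed

text \<open>
  Inversion of \<open>S - \<mu>\<close>: the geometric series in \<open>\<mu> S\<^sup>-\<^sup>1\<close> runs over the past if \<open>|\<mu>| < 1\<close>, the one in
  \<open>\<mu>\<^sup>-\<^sup>1 S\<close> over the future if \<open>|\<mu>| > 1\<close>.
\<close>

lemma scalar_recurrence_exists:
  assumes "norm \<mu> \<noteq> 1"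
  obtains C :: real where "C \<ge> 0"
    "\<And>g :: int \<Rightarrow> complex ^ 'n::finite. l2_sq g < \<infinity> \<Longrightarrow>
       \<exists>w. (\<forall>n. w (n + 1) = \<mu> *s w n + g n) \<and> l2_sq w \<le> ennreal C * l2_sq g"
proof -
  interpret sm: bounded_bilinear "(*s) :: complex \<Rightarrow> complex ^ 'n \<Rightarrow> _"
    by (rule bounded_bilinear_vector_scalar_mult)
  consider "norm \<mu> < 1" | "norm \<mu> > 1" using assms by linarith
  then show ?thesis
  proof cases
    case 1
    show ?thesis
    proof (rule that[of "(1 / (1 - norm \<mu>))\<^sup>2"])
      fix g :: "int \<Rightarrow> complex ^ 'n" assume g: "l2_sq g < \<infinity>"
      define \<sigma> where "\<sigma> j = - 1 - int j" for j
      define w where "w n = (\<Sum>j. \<mu> ^ j *s g (n + \<sigma> j))" for n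
      note conv = l2_sq_convolution[where r = "norm \<mu>" and c = "\<lambda>j. \<mu> ^ j" and g = g and \<sigma> = \<sigma>, OF norm_ge_zero 1 _ g]
      have "w (n + 1) = \<mu> *s w n + g n" for n
      proof -
        have s: "summable (\<lambda>j. \<mu> ^ j *s g (n + \<sigma> j))" for n by (rule conv(1)) (simp add: norm_power)
        have "w (n + 1) = (\<Sum>j. \<mu> ^ Suc j *s g (n + 1 + \<sigma> (Suc j))) + g n"
          unfolding w_def using suminf_split_head[OF s[of "n+1"]] by (simp add: \<sigma>_def)
        also have "(\<Sum>j. \<mu> ^ Suc j *s g (n + 1 + \<sigma> (Suc j))) = (\<Sum>j. \<mu> *s (\<mu> ^ j *s g (n + \<sigma> j)))"
          by (rule suminf_cong) (simp add: \<sigma>_def algebra_simps)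
        also have "\<dots> = \<mu> *s w n"
          unfolding w_def by (rule bounded_linear.suminf[OF sm.bounded_linear_right s, symmetric])
        finally show ?thesis .
      qed
      moreover have "l2_sq w \<le> ennreal ((1 / (1 - norm \<mu>))\<^sup>2) * l2_sq g"
        unfolding w_def by (rule conv(2)) (simp add: norm_power)
      ultimately show "\<exists>w. (\<forall>n. w (n + 1) = \<mu> *s w n + g n) \<and> l2_sq w \<le> ennreal ((1 / (1 - norm \<mu>))\<^sup>2) * l2_sq g"
        by blast
    qed simp
  next
    case 2
    then have \<mu>0: "\<mu> \<noteq> 0" by auto
    define r where "r = norm (1 / \<mu>)"
    have r: "0 \<le> r" "r < 1" using 2 by (auto simp: r_def norm_divide divide_simps)
    show ?thesis
    proof (rule that[of "(1 / (1 - r))\<^sup>2"])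
      fix g :: "int \<Rightarrow> complex ^ 'n" assume g: "l2_sq g < \<infinity>"
      define c where "c j = - ((1 / \<mu>) ^ Suc j)" for j
      define w where "w n = (\<Sum>j. c j *s g (n + int j))" for n
      have cr: "norm (c j) \<le> r ^ j" for j
      proof -
        have "norm (c j) = r ^ Suc j" by (simp only: c_def norm_minus_cancel norm_power r_def)
        also have "\<dots> \<le> r ^ j" using r by (intro power_decreasing) auto
        finally show ?thesis .
      qed
      note conv = l2_sq_convolution[where r = r and c = c and g = g and \<sigma> = int, OF r cr g]
      have "w (n + 1) = \<mu> *s w n + g n" for n
      proof -
        have "\<mu> *s w n = (\<Sum>j. \<mu> *s (c j *s g (n + int j)))"
          unfolding w_def by (rule bounded_linear.suminf[OF sm.bounded_linear_right conv(1)])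
        also have "\<dots> = (\<Sum>j. (\<mu> * c (Suc j)) *s g (n + int (Suc j))) + (\<mu> * c 0) *s g n"
          using suminf_split_head[of "\<lambda>j. \<mu> *s (c j *s g (n + int j))"]
            bounded_linear.summable[OF sm.bounded_linear_right conv(1), of \<mu> n] by simp
        also have "(\<lambda>j. (\<mu> * c (Suc j)) *s g (n + int (Suc j))) = (\<lambda>j. c j *s g (n + 1 + int j))"
          using \<mu>0 by (auto simp: c_def add_ac)
        also have "\<mu> * c 0 = - 1" using \<mu>0 by (simp add: c_def)
        finally show ?thesis unfolding w_def by simp
      qed
      moreover have "l2_sq w \<le> ennreal ((1 / (1 - r))\<^sup>2) * l2_sq g"
        unfolding w_def by (rule conv(2))
      ultimately show "\<exists>w. (\<forall>n. w (n + 1) = \<mu> *s w n + g n) \<and> l2_sq w \<le> ennreal ((1 / (1 - r))\<^sup>2) * l2_sq g"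
        by blast
    qed simp
  qed
qed

text \<open>
  The shift preserves the norm, while multiplication by \<open>\<mu>\<close> scales it by \<open>|\<mu>| \<noteq> 1\<close>.
\<close>

lemma scalar_recurrence_unique:
  fixes w :: "int \<Rightarrow> complex ^ 'n::finite"
  assumes "norm \<mu> \<noteq> 1" "\<And>n. w (n + 1) = \<mu> *s w n" "l2_sq w < \<infinity>"
  shows "w n = 0"
proof -
  obtain B where B: "l2_sq w = ennreal B" "B \<ge> 0" using assms(3) by (cases "l2_sq w") auto
  have "l2_sq w = l2_sq (\<lambda>n. \<mu> *s w n)"
    using l2_sq_shift[of w 1] assms(2) by simp
  also have "\<dots> = ennreal ((norm \<mu>)\<^sup>2) * l2_sq w"
    unfolding l2_sq_def
    by (simp add: nn_integral_cmult[symmetric] norm_vector_scalar_mult power_mult_distrib ennreal_mult)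
  finally have "ennreal B = ennreal ((norm \<mu>)\<^sup>2 * B)" using B by (simp add: ennreal_mult)
  then have "B = (norm \<mu>)\<^sup>2 * B" using B by simp
  moreover have "(norm \<mu>)\<^sup>2 \<noteq> 1" using assms(1) by (simp add: power2_eq_1_iff) (metis norm_ge_zero not_one_le_zero neg_0_le_iff_le)
  ultimately have "B = 0" by auto
  then show ?thesis using l2_sq_eq_0[of w n] B by simp
qed

section \<open>Linear recurrences with hyperbolic matrix\<close>

text \<open>
  The product \<open>(M - \<mu>\<^sub>1) \<cdots> (M - \<mu>\<^sub>r)\<close> of commuting factors, applied to a vector.
\<close>

fun apply_factors :: "complex ^ 'n::finite ^ 'n \<Rightarrow> complex list \<Rightarrow> complex ^ 'n \<Rightarrow> complex ^ 'n" where
  "apply_factors M [] v = v"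
| "apply_factors M (\<mu> # \<mu>s) v = apply_factors M \<mu>s (M *v v - \<mu> *s v)"

lemma apply_factors_add: "apply_factors M \<mu>s (v + w) = apply_factors M \<mu>s v + apply_factors M \<mu>s w"
proof (induction \<mu>s arbitrary: v w)
  case (Cons \<mu> \<mu>s)
  have "M *v (v + w) - \<mu> *s (v + w) = (M *v v - \<mu> *s v) + (M *v w - \<mu> *s w)"
    by (simp add: matrix_vector_right_distrib vec.scale_right_distrib)
  then show ?case by (simp only: apply_factors.simps Cons)
qed simp

lemma apply_factors_scale: "apply_factors M \<mu>s (c *s v) = c *s apply_factors M \<mu>s v"
proof (induction \<mu>s arbitrary: v)
  case (Cons \<mu> \<mu>s)
  have "M *v (c *s v) - \<mu> *s (c *s v) = c *s (M *v v - \<mu> *s v)"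
    by (simp add: vector_scalar_commute[symmetric] vec.scale_right_diff_distrib mult.commute)
  then show ?case by (simp only: apply_factors.simps Cons)
qed simp

lemma apply_factors_zero [simp]: "apply_factors M \<mu>s 0 = 0"
  by (induction \<mu>s) simp_all

lemma apply_factors_diff: "apply_factors M \<mu>s (v - w) = apply_factors M \<mu>s v - apply_factors M \<mu>s w"
  using apply_factors_add[of M \<mu>s "v - w" w] by (simp add: eq_diff_eq)

lemma apply_factors_sum: "finite S \<Longrightarrow> apply_factors M \<mu>s (sum f S) = (\<Sum>i\<in>S. apply_factors M \<mu>s (f i))"
  by (induction S rule: finite_induct) (simp_all add: apply_factors_add)

lemma apply_factors_commute_matrix: "apply_factors M \<mu>s (M *v v) = M *v apply_factors M \<mu>s v"
proof (induction \<mu>s arbitrary: v)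
  case (Cons \<mu> \<mu>s)
  have "M *v (M *v v) - \<mu> *s (M *v v) = M *v (M *v v - \<mu> *s v)"
    by (simp add: matrix_vector_mult_diff_distrib vector_scalar_commute)
  then show ?case by (simp only: apply_factors.simps Cons)
qed simp

lemma apply_factors_commute: "apply_factors M \<mu>s (apply_factors M \<nu>s v) = apply_factors M \<nu>s (apply_factors M \<mu>s v)"
  by (induction \<mu>s arbitrary: v) (simp_all only: apply_factors.simps apply_factors_diff apply_factors_scale apply_factors_commute_matrix)

lemma apply_factors_append: "apply_factors M (\<mu>s @ \<nu>s) v = apply_factors M \<nu>s (apply_factors M \<mu>s v)"
  by (induction \<mu>s arbitrary: v) simp_all

text \<open>
  The vector \<open>p(M) v\<close>, by Horner's scheme.
\<close>

definition apply_poly :: "complex ^ 'n::finite ^ 'n \<Rightarrow> complex poly \<Rightarrow> complex ^ 'n \<Rightarrow> complex ^ 'n" where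
  "apply_poly M p v = fold_coeffs (\<lambda>a w. a *s v + M *v w) p 0"

lemma apply_poly_0 [simp]: "apply_poly M 0 v = 0"
  by (simp add: apply_poly_def)

lemma apply_poly_pCons: "apply_poly M (pCons a q) v = a *s v + M *v apply_poly M q v"
  unfolding apply_poly_def
  by (cases "a = 0 \<and> q = 0") (auto simp: fold_coeffs_pCons_coeff_not_0_eq fold_coeffs_pCons_not_0_0_eq)

lemma apply_poly_add: "apply_poly M (p + q) v = apply_poly M p v + apply_poly M q v"
  by (induction p q rule: poly_induct2) (simp_all add: apply_poly_pCons algebra_simps vec.scale_left_distrib)

lemma apply_poly_smult: "apply_poly M (smult c p) v = c *s apply_poly M p v"
  by (induction p) (simp_all add: apply_poly_pCons vec.scale_right_distrib vector_scalar_commute)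

lemma apply_poly_commute: "apply_poly M q (M *v v - \<mu> *s v) = M *v apply_poly M q v - \<mu> *s apply_poly M q v"
proof (induction q)
  case (pCons a q)
  show ?case
    by (simp only: apply_poly_pCons pCons.IH)
      (simp add: algebra_simps vec.scale_right_diff_distrib vec.scale_right_distrib vector_scalar_commute)
qed simp

lemma apply_poly_linear_factor: "apply_poly M ([:- \<mu>, 1:] * q) v = apply_poly M q (M *v v - \<mu> *s v)"
proof -
  have "[:- \<mu>, 1:] * q = smult (- \<mu>) q + pCons 0 q" by simp
  then show ?thesis by (simp only: apply_poly_add apply_poly_smult apply_poly_pCons apply_poly_commute) simp
qed

lemma apply_poly_monom: "apply_poly M (monom c i) v = c *s (((*v) M ^^ i) v)"
  by (induction i) (simp_all add: monom_0 monom_Suc apply_poly_pCons vector_scalar_commute)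

lemma apply_poly_sum: "finite S \<Longrightarrow> apply_poly M (sum f S) v = (\<Sum>i\<in>S. apply_poly M (f i) v)"
  by (induction S rule: finite_induct) (simp_all add: apply_poly_add)

text \<open>
  The \<open>CARD('n) + 1\<close> vectors \<open>v, M v, M\<^sup>2 v, \<dots>\<close> repeat or are linearly dependent.
\<close>

lemma annihilating_poly_exists:
  fixes M :: "complex ^ 'n::finite ^ 'n"
  shows "\<exists>p. p \<noteq> 0 \<and> apply_poly M p v = 0"
proof -
  define u where "u i = ((*v) M ^^ i) v" for i
  define N where "N = CARD('n)"
  show ?thesis
  proof (cases "inj_on u {..N}")
    case False
    then obtain i j where ij: "u i = u j" "i \<noteq> j" by (auto simp: inj_on_def)
    have "apply_poly M (monom 1 i + smult (-1) (monom 1 j)) v = 0"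
      unfolding apply_poly_add apply_poly_smult apply_poly_monom using ij by (simp add: u_def)
    moreover have "coeff (monom 1 i + smult (-1) (monom (1::complex) j)) i = 1"
      using ij by simp
    then have "monom 1 i + smult (-1) (monom (1::complex) j) \<noteq> 0" by (metis coeff_0 zero_neq_one)
    ultimately show ?thesis by blast
  next
    case True
    have "vec.dependent (u ` {..N})"
    proof (rule ccontr)
      assume "\<not> vec.dependent (u ` {..N})"
      then have "card (u ` {..N}) \<le> vec.dim (UNIV :: (complex ^ 'n) set)"
        by (intro vec.independent_card_le_dim) auto
      then show False using True by (simp add: card_image N_def vec_dim_card card_cart_basis)
    qed
    then obtain k where k: "\<exists>w\<in>u ` {..N}. k w \<noteq> 0" "(\<Sum>w\<in>u ` {..N}. k w *s w) = 0"
      using vec.dependent_finite[of "u ` {..N}"] by auto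
    define p where "p = (\<Sum>i\<le>N. monom (k (u i)) i)"
    have "apply_poly M p v = (\<Sum>i\<le>N. k (u i) *s u i)"
      unfolding p_def by (simp add: apply_poly_sum apply_poly_monom u_def)
    also have "\<dots> = 0" using k(2) True by (simp add: sum.reindex)
    finally have "apply_poly M p v = 0" .
    moreover obtain i where i: "i \<le> N" "k (u i) \<noteq> 0" using k(1) by auto
    have "coeff p i = k (u i)"
      unfolding p_def coeff_sum using i(1) by (simp add: if_distrib cong: if_cong)
    with i have "p \<noteq> 0" by auto
    ultimately show ?thesis by blast
  qed
qed

text \<open>
  Split off linear factors by the fundamental theorem of algebra.
\<close>

lemma annihilating_roots_exist:
  fixes M :: "complex ^ 'n::finite ^ 'n"
  assumes "p \<noteq> 0" "apply_poly M p v = 0"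
  shows "\<exists>\<mu>s. apply_factors M \<mu>s v = 0"
  using assms
proof (induction "degree p" arbitrary: p v rule: less_induct)
  case less
  show ?case
  proof (cases "degree p = 0")
    case True
    then obtain a where a: "p = [:a:]" by (meson degree_eq_zeroE)
    then have "a \<noteq> 0" "a *s v = 0" using less.prems by (auto simp: apply_poly_pCons)
    then have "apply_factors M [] v = 0" by simp
    then show ?thesis by blast
  next
    case False
    then have "\<not> constant (poly p)" by (simp add: constant_degree)
    then obtain \<mu> where "poly p \<mu> = 0" using fundamental_theorem_of_algebra by blast
    then obtain q where q: "p = [:- \<mu>, 1:] * q" by (auto simp: poly_eq_0_iff_dvd)
    then have q0: "q \<noteq> 0" using less.prems by auto
    have "degree p = Suc (degree q)" unfolding q using q0 by (subst degree_mult_eq) auto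
    moreover have "apply_poly M q (M *v v - \<mu> *s v) = 0"
      using less.prems(2) unfolding q apply_poly_linear_factor .
    ultimately obtain \<mu>s where "apply_factors M \<mu>s (M *v v - \<mu> *s v) = 0"
      using less.hyps[of q "M *v v - \<mu> *s v"] q0 by auto
    then have "apply_factors M (\<mu> # \<mu>s) v = 0" by simp
    then show ?thesis by blast
  qed
qed

text \<open>
  If \<open>\<mu>\<close> is no eigenvalue, then \<open>M - \<mu>\<close> is injective and can be cancelled from the product.
\<close>

lemma apply_factors_drop_non_eigenvalues:
  assumes "apply_factors M \<mu>s v = 0"
  shows "\<exists>\<nu>s. (\<forall>\<nu>\<in>set \<nu>s. matrix_eigenvalue M \<nu>) \<and> apply_factors M \<nu>s v = 0"
  using assms
proof (induction \<mu>s arbitrary: v)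
  case Nil
  then show ?case by (intro exI[of _ "[]"]) auto
next
  case (Cons \<mu> \<mu>s)
  then obtain \<nu>s where \<nu>s: "\<forall>\<nu>\<in>set \<nu>s. matrix_eigenvalue M \<nu>" "apply_factors M \<nu>s (M *v v - \<mu> *s v) = 0"
    by fastforce
  show ?case
  proof (cases "matrix_eigenvalue M \<mu>")
    case True
    then show ?thesis using \<nu>s by (intro exI[of _ "\<mu> # \<nu>s"]) auto
  next
    case False
    have "M *v apply_factors M \<nu>s v = \<mu> *s apply_factors M \<nu>s v"
      using \<nu>s(2) by (simp add: apply_factors_diff apply_factors_scale apply_factors_commute_matrix)
    then have "apply_factors M \<nu>s v = 0" using False by (auto simp: matrix_eigenvalue_def)
    then show ?thesis using \<nu>s(1) by blast
  qed
qed

text \<open>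
  Concatenating the lists that annihilate the standard basis vectors annihilates the whole space,
  since the factors commute.
\<close>

lemma annihilating_eigenvalues_exist:
  fixes M :: "complex ^ 'n::finite ^ 'n"
  shows "\<exists>\<mu>s. (\<forall>\<mu>\<in>set \<mu>s. matrix_eigenvalue M \<mu>) \<and> (\<forall>v. apply_factors M \<mu>s v = 0)"
proof -
  have *: "\<exists>\<mu>s. (\<forall>\<mu>\<in>set \<mu>s. matrix_eigenvalue M \<mu>) \<and> (\<forall>v\<in>S. apply_factors M \<mu>s v = 0)" if "finite S" for S
    using that
  proof (induction S rule: finite_induct)
    case empty
    then show ?case by (intro exI[of _ "[]"]) auto
  next
    case (insert v S)
    then obtain \<mu>s where \<mu>s: "\<forall>\<mu>\<in>set \<mu>s. matrix_eigenvalue M \<mu>" "\<forall>v\<in>S. apply_factors M \<mu>s v = 0" by blast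
    obtain \<nu>s where \<nu>s: "\<forall>\<nu>\<in>set \<nu>s. matrix_eigenvalue M \<nu>" "apply_factors M \<nu>s v = 0"
      using apply_factors_drop_non_eigenvalues annihilating_roots_exist annihilating_poly_exists by metis
    have "\<forall>w\<in>insert v S. apply_factors M (\<mu>s @ \<nu>s) w = 0"
      using \<mu>s(2) \<nu>s(2) apply_factors_commute[of M \<nu>s \<mu>s v] by (auto simp: apply_factors_append)
    then show ?case using \<mu>s \<nu>s by (intro exI[of _ "\<mu>s @ \<nu>s"]) auto
  qed
  obtain \<mu>s where \<mu>s: "\<forall>\<mu>\<in>set \<mu>s. matrix_eigenvalue M \<mu>" "\<And>i. apply_factors M \<mu>s (axis i 1) = 0"
    using *[of "range (\<lambda>i. axis i 1)"] by auto
  have "apply_factors M \<mu>s v = 0" for v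
  proof -
    have "apply_factors M \<mu>s v = apply_factors M \<mu>s (\<Sum>i\<in>UNIV. (v $ i) *s axis i 1)"
      by (simp only: basis_expansion)
    also have "\<dots> = 0" by (simp add: apply_factors_sum apply_factors_scale \<mu>s(2))
    finally show ?thesis .
  qed
  with \<mu>s(1) show ?thesis by blast
qed

text \<open>
  Induction along the annihilating list: \<open>(M - \<mu>) w\<close> solves the same recurrence and is killed by the
  shorter product, hence vanishes, and \<open>w\<close> solves the scalar recurrence.
\<close>

lemma recurrence_unique:
  fixes w :: "int \<Rightarrow> complex ^ 'n::finite"
  assumes "\<And>\<mu>. matrix_eigenvalue M \<mu> \<Longrightarrow> norm \<mu> \<noteq> 1" "\<And>n. w (n + 1) = M *v w n" "l2_sq w < \<infinity>"
  shows "w n = 0"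
proof -
  obtain \<mu>s where \<mu>s: "\<forall>\<mu>\<in>set \<mu>s. matrix_eigenvalue M \<mu>" "\<And>v. apply_factors M \<mu>s v = 0"
    using annihilating_eigenvalues_exist[of M] by blast
  have "w n = 0" if "\<forall>\<mu>\<in>set \<mu>s. norm \<mu> \<noteq> 1" "\<And>n. apply_factors M \<mu>s (w n) = 0"
      "\<And>n. w (n + 1) = M *v w n" "l2_sq w < \<infinity>" for w n
    using that
  proof (induction \<mu>s arbitrary: w n)
    case (Cons \<mu> \<mu>s)
    define z where "z n = M *v w n - \<mu> *s w n" for n
    have "z n = 0" for n
    proof (rule Cons.IH)
      show "z (n + 1) = M *v z n" for n
        by (simp add: z_def Cons.prems(3) matrix_vector_mult_diff_distrib vector_scalar_commute)
      have "norm (M *v v) \<le> norm M * norm v" for v by (rule norm_matrix_vector_mult_le)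
      then show "l2_sq z < \<infinity>"
        unfolding z_def
        by (intro l2_sq_finite_diff l2_sq_finite_scale[OF _ Cons.prems(4), of _ "norm M"]
            l2_sq_finite_scale[OF _ Cons.prems(4), of _ "norm \<mu>"]) (auto simp: norm_vector_scalar_mult)
    qed (use Cons.prems in \<open>auto simp: z_def\<close>)
    then have "w (n + 1) = \<mu> *s w n" for n using Cons.prems(3)[of n] by (simp add: z_def)
    then show ?case using scalar_recurrence_unique[of \<mu> w n] Cons.prems by auto
  qed simp
  then show ?thesis using \<mu>s assms by blast
qed

text \<open>
  Induction along the annihilating list, for right-hand sides killed by the product: let \<open>w1\<close> solve
  \<open>(S - M) w1 = (M - \<mu>) g\<close> and put \<open>w = (S - \<mu>)\<^sup>-\<^sup>1 (w1 + g)\<close>. Then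
  \<open>(S - \<mu>)(S - M) w = (M - \<mu>) g + (S - M) g = (S - \<mu>) g\<close>, and \<open>S - \<mu>\<close> is injective.
\<close>

lemma recurrence_exists:
  fixes M :: "complex ^ 'n::finite ^ 'n"
  assumes "\<And>\<mu>. matrix_eigenvalue M \<mu> \<Longrightarrow> norm \<mu> \<noteq> 1"
  obtains C :: real where "C \<ge> 0"
    "\<And>g. l2_sq g < \<infinity> \<Longrightarrow> \<exists>w. (\<forall>n. w (n + 1) = M *v w n + g n) \<and> l2_sq w \<le> ennreal C * l2_sq g"
proof -
  have *: "\<exists>C\<ge>0. \<forall>g. l2_sq g < \<infinity> \<longrightarrow> (\<forall>n. apply_factors M \<mu>s (g n) = 0) \<longrightarrow>
      (\<exists>w. (\<forall>n. w (n + 1) = M *v w n + g n) \<and> l2_sq w \<le> ennreal C * l2_sq g)"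
    if "\<forall>\<mu>\<in>set \<mu>s. norm \<mu> \<noteq> 1" for \<mu>s
    using that
  proof (induction \<mu>s)
    case Nil
    have "\<exists>w. (\<forall>n. w (n + 1) = M *v w n + g n) \<and> l2_sq w \<le> ennreal 0 * l2_sq g"
      if "\<forall>n. apply_factors M [] (g n) = 0" for g
      using that by (intro exI[of _ "\<lambda>_. 0"]) (simp add: l2_sq_def)
    then show ?case by blast
  next
    case (Cons \<mu> \<mu>s)
    then obtain C where C: "C \<ge> 0" "\<And>g. l2_sq g < \<infinity> \<Longrightarrow> (\<forall>n. apply_factors M \<mu>s (g n) = 0) \<Longrightarrow>
      (\<exists>w. (\<forall>n. w (n + 1) = M *v w n + g n) \<and> l2_sq w \<le> ennreal C * l2_sq g)" by auto
    have \<mu>: "norm \<mu> \<noteq> 1" using Cons.prems by simp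
    obtain C1 where C1: "C1 \<ge> 0" "\<And>g :: int \<Rightarrow> complex ^ 'n. l2_sq g < \<infinity> \<Longrightarrow>
       \<exists>w. (\<forall>n. w (n + 1) = \<mu> *s w n + g n) \<and> l2_sq w \<le> ennreal C1 * l2_sq g"
      using scalar_recurrence_exists[OF \<mu>] by blast
    define c where "c = norm M + norm \<mu>"
    define C2 where "C2 = C1 * (2 * (C * c\<^sup>2) + 2)"
    have C2: "C2 \<ge> 0" using C C1 by (simp add: C2_def)
    have "\<exists>w. (\<forall>n. w (n + 1) = M *v w n + g n) \<and> l2_sq w \<le> ennreal C2 * l2_sq g"
      if g: "l2_sq g < \<infinity>" "\<forall>n. apply_factors M (\<mu> # \<mu>s) (g n) = 0" for g
    proof -
      define h where "h n = M *v g n - \<mu> *s g n" for n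
      have hn: "norm (h n) \<le> c * norm (g n)" for n
        unfolding h_def c_def
        using norm_triangle_ineq4[of "M *v g n" "\<mu> *s g n"] norm_matrix_vector_mult_le[of M "g n"]
        by (simp add: norm_vector_scalar_mult algebra_simps)
      have hf: "l2_sq h < \<infinity>" by (rule l2_sq_finite_scale[OF hn g(1)])
      obtain w1 where w1: "\<And>n. w1 (n + 1) = M *v w1 n + h n" "l2_sq w1 \<le> ennreal C * l2_sq h"
        using C(2)[OF hf] g(2) by (auto simp: h_def)
      have w1f: "l2_sq w1 < \<infinity>"
        by (rule le_less_trans[OF w1(2)]) (use hf in \<open>auto simp: ennreal_mult_less_top\<close>)
      have sf: "l2_sq (\<lambda>n. w1 n + g n) < \<infinity>" by (rule l2_sq_finite_add[OF w1f g(1)])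
      obtain w where w: "\<And>n. w (n + 1) = \<mu> *s w n + (w1 n + g n)" "l2_sq w \<le> ennreal C1 * l2_sq (\<lambda>n. w1 n + g n)"
        using C1(2)[OF sf] by auto
      have wf: "l2_sq w < \<infinity>"
        by (rule le_less_trans[OF w(2)]) (use sf in \<open>auto simp: ennreal_mult_less_top\<close>)
      \<comment> \<open>The defect of \<open>w\<close> is annihilated by \<open>S - \<mu>\<close>.\<close>
      define D where "D n = w (n + 1) - M *v w n - g n" for n
      have "D n = 0" for n
      proof (rule scalar_recurrence_unique[OF \<mu>])
        show "D (n + 1) = \<mu> *s D n" for n
          unfolding D_def w(1)[of "n + 1"] w1(1)[of n] w(1)[of n] h_def
          by (simp add: algebra_simps vec.scale_right_diff_distrib vec.scale_right_distrib vector_scalar_commute)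
        show "l2_sq D < \<infinity>"
          unfolding D_def
          by (intro l2_sq_finite_diff l2_sq_finite_scale[OF norm_matrix_vector_mult_le wf] g(1))
            (use wf in \<open>simp add: l2_sq_shift\<close>)
      qed
      moreover have "w (n + 1) - (M *v w n + g n) = D n" for n
        by (simp only: D_def diff_diff_eq)
      ultimately have "w (n + 1) = M *v w n + g n" for n by simp
      moreover have "l2_sq w \<le> ennreal C2 * l2_sq g"
      proof -
        have "l2_sq w1 \<le> ennreal C * (ennreal (c\<^sup>2) * l2_sq g)"
          by (rule order_trans[OF w1(2)]) (intro mult_left_mono l2_sq_scale_le hn, simp)
        then have "2 * l2_sq w1 + 2 * l2_sq g \<le> 2 * (ennreal C * (ennreal (c\<^sup>2) * l2_sq g)) + 2 * l2_sq g"
          by (intro add_mono mult_left_mono) auto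
        then have "ennreal C1 * l2_sq (\<lambda>n. w1 n + g n) \<le> ennreal C1 * (2 * (ennreal C * (ennreal (c\<^sup>2) * l2_sq g)) + 2 * l2_sq g)"
          by (intro mult_left_mono order_trans[OF l2_sq_add_le]) auto
        also have "\<dots> = ennreal C2 * l2_sq g"
          using C C1 by (simp add: C2_def ennreal_mult ennreal_plus algebra_simps)
        finally show ?thesis using w(2) by (rule order_trans[rotated])
      qed
      ultimately show ?thesis by blast
    qed
    then show ?case using C2 by blast
  qed
  obtain \<mu>s where \<mu>s: "\<forall>\<mu>\<in>set \<mu>s. matrix_eigenvalue M \<mu>" "\<And>v. apply_factors M \<mu>s v = 0"
    using annihilating_eigenvalues_exist[of M] by blast
  with *[of \<mu>s] assms that show ?thesis by auto
qed

text \<open>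
  By uniqueness every square summable solution is the one constructed above.
\<close>

lemma recurrence_bound:
  fixes M :: "complex ^ 'n::finite ^ 'n"
  assumes M: "\<And>\<mu>. matrix_eigenvalue M \<mu> \<Longrightarrow> norm \<mu> \<noteq> 1"
  obtains C :: real where "C \<ge> 0"
    "\<And>w. l2_sq w < \<infinity> \<Longrightarrow> l2_sq w \<le> ennreal C * l2_sq (\<lambda>n. w (n + 1) - M *v w n)"
proof -
  obtain C where C: "C \<ge> 0"
    "\<And>g. l2_sq g < \<infinity> \<Longrightarrow> \<exists>w. (\<forall>n. w (n + 1) = M *v w n + g n) \<and> l2_sq w \<le> ennreal C * l2_sq g"
    using recurrence_exists[of M] M by metis
  have "l2_sq w \<le> ennreal C * l2_sq (\<lambda>n. w (n + 1) - M *v w n)" if w: "l2_sq w < \<infinity>" for w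
  proof -
    define g where "g n = w (n + 1) - M *v w n" for n
    have g: "l2_sq g < \<infinity>"
      unfolding g_def
      by (intro l2_sq_finite_diff l2_sq_finite_scale[OF norm_matrix_vector_mult_le w]) (use w in \<open>simp add: l2_sq_shift\<close>)
    obtain v where v: "\<And>n. v (n + 1) = M *v v n + g n" "l2_sq v \<le> ennreal C * l2_sq g"
      using C(2)[OF g] by blast
    have vf: "l2_sq v < \<infinity>"
      by (rule le_less_trans[OF v(2)]) (use g in \<open>auto simp: ennreal_mult_less_top\<close>)
    have "w n - v n = 0" for n
    proof (rule recurrence_unique[OF M])
      show "w (n + 1) - v (n + 1) = M *v (w n - v n)" for n
        using v(1)[of n] by (simp add: g_def matrix_vector_mult_diff_distrib)
      show "l2_sq (\<lambda>n. w n - v n) < \<infinity>" by (rule l2_sq_finite_diff[OF w vf])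
    qed
    then have "v = w" by auto
    then show ?thesis using v(2) unfolding g_def by simp
  qed
  with C(1) that show ?thesis by blast
qed

section \<open>The Riemann-Lebesgue lemma\<close>

lemma set_integrable_cis: 
  assumes "S \<in> sets lebesgue" "S \<subseteq> {a..b}"
  shows "set_integrable lebesgue S (\<lambda>x. cis (k * x))"
proof (rule set_integrable_subset)
  show "set_integrable lebesgue {a..b} (\<lambda>x. cis (k * x))"
    by (intro absolutely_integrable_continuous_real continuous_intros)
qed (use assms in auto)

lemma norm_integral_cis_le:
  assumes "S \<in> sets lebesgue" "S \<subseteq> {a..b}"
  shows "norm (LINT x:S|lebesgue. cis (k * x)) \<le> measure lebesgue S"
proof -
  have "norm (LINT x:S|lebesgue. cis (k * x)) \<le> (LINT x:S|lebesgue. norm (cis (k * x)))"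
    by (rule set_integral_norm_bound[OF set_integrable_cis[OF assms]])
  also have "\<dots> = measure lebesgue S"
    using assms by (simp add: set_lebesgue_integral_def)
  finally show ?thesis .
qed

lemma integral_cis_interval_tendsto:
  "((\<lambda>k. LINT x:{a..b}|lebesgue. cis (k * x)) \<longlongrightarrow> 0) at_infinity"
proof (cases "a \<le> b")
  case False
  then show ?thesis by (simp add: set_lebesgue_integral_def)
next
  case True
  have bound: "norm (LINT x:{a..b}|lebesgue. cis (k * x)) \<le> 2 * inverse (norm k)" if "k \<noteq> 0" for k :: real
  proof -
    define w where "w = \<i> * complex_of_real k"
    have w: "w \<noteq> 0" "\<And>x. cis (k * x) = exp (x *\<^sub>R w)"
      using that by (auto simp: w_def cis_conv_exp scaleR_conv_of_real mult_ac)
    have "((\<lambda>x. cis (k * x)) has_integral (cis (k * b) / (\<i> * k) - cis (k * a) / (\<i> * k))) {a..b}"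
    proof (rule fundamental_theorem_of_calculus[OF True])
      fix x
      have "((\<lambda>x. exp (x *\<^sub>R w) / w) has_vector_derivative (exp (x *\<^sub>R w) * w) / w) (at x within {a..b})"
        by (intro has_vector_derivative_divide exp_scaleR_has_vector_derivative_right)
      then show "((\<lambda>x. cis (k * x) / (\<i> * k)) has_vector_derivative cis (k * x)) (at x within {a..b})"
        using w by (simp flip: w_def)
    qed
    then have e: "(LINT x:{a..b}|lebesgue. cis (k * x)) = (cis (k * b) - cis (k * a)) / (\<i> * k)"
      using set_lebesgue_integral_eq_integral(2)[OF set_integrable_cis[of "{a..b}" a b k]]
      by (simp add: integral_unique diff_divide_distrib)
    have "norm (cis (k * b) - cis (k * a)) \<le> 2"
      using norm_triangle_ineq4[of "cis (k * b)" "cis (k * a)"] by simp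
    then have "norm (cis (k * b) - cis (k * a)) / norm k \<le> 2 / norm k"
      by (rule divide_right_mono) simp
    then show ?thesis
      unfolding e by (simp add: norm_divide norm_mult divide_inverse[of 2])
  qed
  have "((\<lambda>k::real. 2 * inverse (norm k)) \<longlongrightarrow> 2 * 0) at_infinity"
    by (intro tendsto_mult tendsto_const tendsto_inverse_0_at_top filterlim_norm_at_top)
  then have lim: "((\<lambda>k::real. 2 * inverse (norm k)) \<longlongrightarrow> 0) at_infinity" by simp
  have "\<forall>\<^sub>F k in at_infinity. norm (LINT x:{a..b}|lebesgue. cis (k * x)) \<le> 2 * inverse (norm k)"
    using eventually_not_equal_at_infinity[of 0] by eventually_elim (rule bound)
  from Lim_null_comparison[OF this lim] show ?thesis .
qed

text \<open>
  The sets \<open>S\<close> with this property form a Dynkin system, which contains all half-lines by explicit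
  integration. Countable disjoint unions are handled by Tannery's theorem, because the integrals over
  the pieces are dominated by their measures uniformly in \<open>k\<close>.
\<close>

lemma integral_cis_borel_tendsto:
  assumes "S \<in> sets borel"
  shows "((\<lambda>k. LINT x:{a..b} \<inter> S|lebesgue. cis (k * x)) \<longlongrightarrow> 0) at_infinity"
proof -
  have meas: "{a..b} \<inter> S \<in> sets lebesgue" if "S \<in> sets borel" for S :: "real set"
    using that by auto
  have "Int_stable (range (atMost :: real \<Rightarrow> _))"
    by (auto simp: Int_stable_def)
  moreover have "range (atMost :: real \<Rightarrow> _) \<subseteq> Pow UNIV" by simp
  moreover have "S \<in> sigma_sets UNIV (range atMost)"
    using assms by (simp add: borel_eq_atMost sets_measure_of)
  ultimately show ?thesis
  proof (induction S rule: sigma_sets_induct_disjoint)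
    case (basic S)
    then obtain c where "S = {..c}" by auto
    then have "{a..b} \<inter> S = {a..min b c}" by auto
    then show ?case using integral_cis_interval_tendsto by simp
  next
    case empty
    show ?case by (simp add: set_lebesgue_integral_def)
  next
    case (compl S)
    then have S: "S \<in> sets borel" by (simp add: borel_eq_atMost sets_measure_of)
    have "(LINT x:{a..b} \<inter> (UNIV - S)|lebesgue. cis (k * x))
      = (LINT x:{a..b}|lebesgue. cis (k * x)) - (LINT x:{a..b} \<inter> S|lebesgue. cis (k * x))" for k
    proof -
      have "(LINT x:({a..b} \<inter> S) \<union> ({a..b} \<inter> (UNIV - S))|lebesgue. cis (k * x)) =
         (LINT x:{a..b} \<inter> S|lebesgue. cis (k * x)) + (LINT x:{a..b} \<inter> (UNIV - S)|lebesgue. cis (k * x))"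
        by (rule set_integral_Un) (use S in \<open>auto intro!: set_integrable_cis\<close>)
      moreover have "({a..b} \<inter> S) \<union> ({a..b} \<inter> (UNIV - S)) = {a..b}" by auto
      ultimately show ?thesis by simp
    qed
    then show ?case using tendsto_diff[OF integral_cis_interval_tendsto[of a b] compl.IH] by simp
  next
    case (union A)
    then have A: "A i \<in> sets borel" for i by (auto simp: borel_eq_atMost sets_measure_of)
    have disj: "disjoint_family (\<lambda>i. {a..b} \<inter> A i)"
      using union.hyps(1) by (auto simp: disjoint_family_on_def)
    have eq: "(LINT x:{a..b} \<inter> (\<Union>i. A i)|lebesgue. cis (k * x)) = (\<Sum>i. LINT x:{a..b} \<inter> A i|lebesgue. cis (k * x))" for k
    proof -
      have "(LINT x:(\<Union>i. {a..b} \<inter> A i)|lebesgue. cis (k * x)) = (\<Sum>i. LINT x:{a..b} \<inter> A i|lebesgue. cis (k * x))"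
        by (rule lebesgue_integral_countable_add)
          (use A meas disj in \<open>auto simp: disjoint_family_on_def intro!: set_integrable_cis[of _ a b]\<close>)
      moreover have "(\<Union>i. {a..b} \<inter> A i) = {a..b} \<inter> (\<Union>i. A i)" by auto
      ultimately show ?thesis by simp
    qed
    have fin: "emeasure lebesgue (\<Union>i. {a..b} \<inter> A i) \<noteq> \<infinity>"
    proof -
      have "emeasure lebesgue (\<Union>i. {a..b} \<inter> A i) \<le> emeasure lebesgue {a..b}"
        by (rule emeasure_mono) auto
      also have "\<dots> < \<infinity>" by (cases "a \<le> b") auto
      finally show ?thesis by simp
    qed
    have "(\<lambda>i. measure lebesgue ({a..b} \<inter> A i)) sums measure lebesgue (\<Union>i. {a..b} \<inter> A i)"
      by (rule measure_UNION) (use disj fin meas A in auto)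
    then have S: "summable (\<lambda>i. measure lebesgue ({a..b} \<inter> A i))" by (rule sums_summable)
    define I where "I i k = (LINT x:{a..b} \<inter> A i|lebesgue. cis (k * x))" for i k
    have B: "\<forall>\<^sub>F (i, k) in sequentially \<times>\<^sub>F at_infinity. norm (I i k) \<le> measure lebesgue ({a..b} \<inter> A i)"
      unfolding I_def by (intro always_eventually) (auto intro!: norm_integral_cis_le[of _ a b] meas A)
    have L: "((\<lambda>k. I i k) \<longlongrightarrow> 0) at_infinity" for i
      unfolding I_def by (rule union.IH)
    have "((\<lambda>k. \<Sum>i. I i k) \<longlongrightarrow> suminf (\<lambda>_. 0)) at_infinity"
      using tannerys_theorem[OF L B S trivial_limit_at_infinity] by blast
    then have "((\<lambda>k. \<Sum>i. LINT x:{a..b} \<inter> A i|lebesgue. cis (k * x)) \<longlongrightarrow> 0) at_infinity"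
      by (simp add: I_def)
    then show ?case by (simp add: eq)
  qed
qed

lemma integrable_cis_mult:
  fixes f :: "real \<Rightarrow> complex"
  assumes "integrable lebesgue f"
  shows "set_integrable lebesgue {a..b} (\<lambda>x. cis (k * x) * f x)"
proof -
  have "(\<lambda>x::real. cis (k * x)) \<in> borel_measurable lebesgue"
    using continuous_imp_measurable_on_sets_lebesgue[of UNIV "\<lambda>x::real. cis (k * x)"]
    by (simp add: continuous_intros lebesgue_on_UNIV_eq)
  then have "integrable lebesgue (\<lambda>x. cis (k * x) * f x)"
    using assms by (intro Bochner_Integration.integrable_bound[OF assms]) (auto simp: norm_mult)
  then show ?thesis unfolding set_integrable_def by (intro integrable_mult_indicator) auto
qed

text \<open>
  Approximation by simple functions; the error is bounded in \<open>L\<^sup>1\<close>, uniformly in \<open>k\<close>.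
\<close>

lemma Riemann_Lebesgue_integrable:
  fixes f :: "real \<Rightarrow> complex"
  assumes "integrable lebesgue f"
  shows "((\<lambda>k. LINT x:{a..b}|lebesgue. cis (k * x) * f x) \<longlongrightarrow> 0) at_infinity"
  using assms
proof (induction f rule: integrable_induct)
  case (base A c)
  obtain C T where C: "fsigma C" "T \<in> null_sets lebesgue" "C \<union> T = A"
    using lebesgue_set_almost_fsigma[OF base(1)] by metis
  have CB: "C \<in> sets borel" using C(1) by (auto elim!: fsigma.cases)
  have "(LINT x:{a..b}|lebesgue. cis (k * x) * (indicator A x *\<^sub>R c)) = (LINT x:{a..b} \<inter> C|lebesgue. cis (k * x)) * c" for k
  proof -
    have "(LINT x:{a..b}|lebesgue. cis (k * x) * (indicator A x *\<^sub>R c)) = (LINT x:{a..b} \<inter> A|lebesgue. cis (k * x) * c)"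
      unfolding set_lebesgue_integral_def
      by (intro Bochner_Integration.integral_cong) (auto split: split_indicator)
    also have "\<dots> = (LINT x:{a..b} \<inter> A|lebesgue. cis (k * x)) * c"
      by simp
    also have "(LINT x:{a..b} \<inter> A|lebesgue. cis (k * x)) = (LINT x:{a..b} \<inter> C|lebesgue. cis (k * x))"
    proof (rule set_integral_cong_set)
      have "{a..b} \<inter> A \<in> sets lebesgue" using base by (intro sets.Int) auto
      then show "set_borel_measurable lebesgue ({a..b} \<inter> C) (\<lambda>x. cis (k * x))"
        "set_borel_measurable lebesgue ({a..b} \<inter> A) (\<lambda>x. cis (k * x))"
        using set_integrable_cis[of "{a..b} \<inter> C" a b k] set_integrable_cis[of "{a..b} \<inter> A" a b k] base CB
        by (auto simp: set_integrable_def set_borel_measurable_def)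
      show "AE x in lebesgue. x \<in> {a..b} \<inter> C \<longleftrightarrow> x \<in> {a..b} \<inter> A"
        using AE_not_in[OF C(2)] C(3) by (auto elim!: eventually_mono)
    qed
    finally show ?thesis .
  qed
  then show ?case by (simp only: tendsto_mult_left_zero[OF integral_cis_borel_tendsto[OF CB]])
next
  case (add f g)
  then show ?case
    using tendsto_add[OF add.IH] by (simp add: distrib_left integrable_cis_mult set_integral_add)
next
  case (lim f s)
  have "((\<lambda>i. LINT x|lebesgue. norm (s i x - f x)) \<longlongrightarrow> (LINT x|(lebesgue :: real measure). 0)) sequentially"
  proof (rule integral_dominated_convergence[where s = "\<lambda>i x. norm (s i x - f x)" and f = "\<lambda>x. 0" and w = "\<lambda>x. 3 * norm (f x)"])
    show "integrable lebesgue (\<lambda>x. 3 * norm (f x))" using lim by auto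
    show "AE x in lebesgue. (\<lambda>i. norm (s i x - f x)) \<longlonglongrightarrow> 0"
      using lim.hyps(2) by (intro AE_I2 tendsto_norm_zero LIM_zero) auto
    show "AE x in lebesgue. norm (norm (s i x - f x)) \<le> 3 * norm (f x)" for i
    proof (rule AE_I2)
      fix x
      show "norm (norm (s i x - f x)) \<le> 3 * norm (f x)"
        using lim.hyps(3)[of x i] norm_triangle_ineq4[of "s i x" "f x"] by simp
    qed
  qed (use lim in auto)
  then have L: "(\<lambda>i. LINT x|lebesgue. norm (s i x - f x)) \<longlonglongrightarrow> 0" by simp
  have diff_le: "norm ((LINT x:{a..b}|lebesgue. cis (k * x) * s i x) - (LINT x:{a..b}|lebesgue. cis (k * x) * f x))
     \<le> (LINT x|lebesgue. norm (s i x - f x))" for i k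
  proof -
    have I: "integrable lebesgue (\<lambda>x. s i x - f x)" using lim by auto
    have "(LINT x:{a..b}|lebesgue. cis (k * x) * s i x) - (LINT x:{a..b}|lebesgue. cis (k * x) * f x)
      = (LINT x:{a..b}|lebesgue. cis (k * x) * (s i x - f x))"
      using lim by (simp add: right_diff_distrib integrable_cis_mult set_integral_diff)
    also have "norm \<dots> \<le> (LINT x|lebesgue. norm (s i x - f x))"
      unfolding set_lebesgue_integral_def
    proof (rule Bochner_Integration.integral_norm_bound_integral)
      show "integrable lebesgue (\<lambda>x. indicat_real {a..b} x *\<^sub>R (cis (k * x) * (s i x - f x)))"
        using integrable_cis_mult[OF I] by (simp add: set_integrable_def)
    qed (use I in \<open>auto simp: norm_mult split: split_indicator\<close>)
    finally show ?thesis .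
  qed
  show ?case
  proof (rule tendstoI)
    fix e :: real assume "e > 0"
    then obtain i where i: "(LINT x|lebesgue. norm (s i x - f x)) < e/2"
      using order_tendstoD(2)[OF L, of "e/2"] by (auto simp: eventually_sequentially)
    have "\<forall>\<^sub>F k in at_infinity. norm (LINT x:{a..b}|lebesgue. cis (k * x) * s i x) < e/2"
      using tendstoD[OF lim.IH[of i], of "e/2"] \<open>e > 0\<close> by simp
    then show "\<forall>\<^sub>F k in at_infinity. dist (LINT x:{a..b}|lebesgue. cis (k * x) * f x) 0 < e"
    proof eventually_elim
      case (elim k)
      then show ?case
        using diff_le[where k = k and i = i] i
          norm_triangle_sub[of "LINT x:{a..b}|lebesgue. cis (k * x) * f x" "LINT x:{a..b}|lebesgue. cis (k * x) * s i x"]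
        by (simp add: norm_minus_commute)
    qed
  qed
qed

lemma Riemann_Lebesgue:
  fixes f :: "real \<Rightarrow> complex"
  assumes "f absolutely_integrable_on {a..b}"
  shows "((\<lambda>k. integral {a..b} (\<lambda>x. cis (k * x) * f x)) \<longlongrightarrow> 0) at_infinity"
proof -
  define g where "g x = indicator {a..b} x *\<^sub>R f x" for x
  have g: "integrable lebesgue g" using assms unfolding g_def set_integrable_def .
  have "integral {a..b} (\<lambda>x. cis (k * x) * f x) = (LINT x:{a..b}|lebesgue. cis (k * x) * g x)" for k
    unfolding set_lebesgue_integral_eq_integral(2)[OF integrable_cis_mult[OF g]]
    by (rule Henstock_Kurzweil_Integration.integral_cong) (simp add: g_def)
  then show ?thesis using Riemann_Lebesgue_integrable[OF g] by simp
qed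

section \<open>Floquet multipliers at large energies\<close>

text \<open>
  The numbers \<open>\<nu> = 2ik(\<alpha> - 1)\<close> with \<open>|\<alpha>| = 1\<close> lie on a circle of radius \<open>2|k|\<close> that touches the real
  axis at \<open>0\<close>: \<open>4|k| |Im \<nu>| = |\<nu>|\<^sup>2\<close>. The large ones exceed the norm of \<open>A\<close>; the remaining ones are
  close to real numbers, for which \<open>A - t\<close> is bounded below by compactness.
\<close>

lemma no_real_eigenvalue_bound:
  fixes A :: "complex ^ 'm::finite ^ 'm"
  assumes "\<And>\<mu>. matrix_eigenvalue A \<mu> \<Longrightarrow> \<mu> \<notin> \<real>"
  obtains c k0 :: real where "c > 0" "k0 > 0"
    "\<And>k \<alpha> u. \<bar>k\<bar> \<ge> k0 \<Longrightarrow> norm \<alpha> = 1 \<Longrightarrow> c * norm u \<le> norm (A *v u - (2 * \<i> * of_real k * (\<alpha> - 1)) *s u)"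
proof -
  define R where "R = norm A + 1"
  have R: "R > 0" by (simp add: R_def add_nonneg_pos)
  define f where "f = (\<lambda>(t, u). norm (A *v u - complex_of_real t *s u))"
  interpret sm: bounded_bilinear "(*s) :: complex \<Rightarrow> complex ^ 'm \<Rightarrow> _"
    by (rule bounded_bilinear_vector_scalar_mult)
  have "continuous_on ({-R..R} \<times> sphere 0 1) f"
    unfolding f_def case_prod_beta
    by (intro continuous_intros sm.continuous_on linear_continuous_on_compose[OF _ matrix_vector_mul_linear])
  moreover have "compact ({-R..R} \<times> sphere (0 :: complex ^ 'm) 1)"
    by (intro compact_Times) auto
  moreover have "{-R..R} \<times> sphere (0 :: complex ^ 'm) 1 \<noteq> {}"
    using R by auto
  ultimately obtain z where z: "z \<in> {-R..R} \<times> sphere 0 1" "\<And>w. w \<in> {-R..R} \<times> sphere 0 1 \<Longrightarrow> f z \<le> f w"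
    using continuous_attains_inf[of "{-R..R} \<times> sphere (0 :: complex ^ 'm) 1" f] by metis
  define m where "m = f z"
  have m: "m > 0"
  proof -
    obtain t u where tu: "z = (t, u)" by force
    have "u \<noteq> 0" using z(1) tu by auto
    moreover have "complex_of_real t \<in> \<real>" by simp
    ultimately have "A *v u \<noteq> complex_of_real t *s u"
      using assms[of "complex_of_real t"] unfolding matrix_eigenvalue_def by blast
    then show ?thesis unfolding m_def f_def tu by simp
  qed
  have real_bound: "m * norm u \<le> norm (A *v u - complex_of_real t *s u)" if "\<bar>t\<bar> \<le> R" for t u
  proof (cases "u = 0")
    case False
    define v where "v = (1 / complex_of_real (norm u)) *s u"
    have nv: "norm v = 1" using False by (simp add: v_def norm_vector_scalar_mult norm_divide)
    have u: "u = complex_of_real (norm u) *s v" using False by (simp add: v_def)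
    have "m \<le> norm (A *v v - complex_of_real t *s v)"
      using z(2)[of "(t, v)"] that nv by (simp add: m_def f_def abs_le_iff)
    then have "norm u * m \<le> norm u * norm (A *v v - complex_of_real t *s v)"
      by (intro mult_left_mono) auto
    also have "\<dots> = norm (complex_of_real (norm u) *s (A *v v - complex_of_real t *s v))"
      by (subst norm_vector_scalar_mult) simp
    also have "complex_of_real (norm u) *s (A *v v - complex_of_real t *s v) = A *v u - complex_of_real t *s u"
      by (subst (2 3) u) (simp add: vec.scale_right_diff_distrib vector_scalar_commute mult.commute)
    finally show ?thesis by (simp add: mult.commute)
  qed simp
  show ?thesis
  proof (rule that[of "min 1 (m/2)" "R\<^sup>2 / (2 * m) + 1"])
    show "min 1 (m/2) > 0" "R\<^sup>2 / (2 * m) + 1 > 0" using m by (auto intro: add_nonneg_pos)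
    fix k :: real and \<alpha> :: complex and u :: "complex ^ 'm"
    assume k: "\<bar>k\<bar> \<ge> R\<^sup>2 / (2 * m) + 1" and \<alpha>: "norm \<alpha> = 1"
    have kpos: "\<bar>k\<bar> > 0" using k m by (smt (verit) divide_nonneg_pos zero_le_power2)
    define \<nu> where "\<nu> = 2 * \<i> * of_real k * (\<alpha> - 1)"
    have "(norm \<nu>)\<^sup>2 = 4 * \<bar>k\<bar> * \<bar>Im \<nu>\<bar>"
    proof -
      have "(Re \<alpha>)\<^sup>2 + (Im \<alpha>)\<^sup>2 = 1" using \<alpha> by (metis cmod_power2 one_power2)
      then have a: "(norm (\<alpha> - 1))\<^sup>2 = 2 * (1 - Re \<alpha>)" by (simp add: cmod_power2 power2_diff)
      have re: "Re \<alpha> \<le> 1" using \<alpha> complex_Re_le_cmod[of \<alpha>] by simp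
      have "(norm \<nu>)\<^sup>2 = 4 * k\<^sup>2 * (2 * (1 - Re \<alpha>))"
        unfolding \<nu>_def by (simp add: norm_mult power_mult_distrib a)
      moreover have "\<bar>Im \<nu>\<bar> = 2 * \<bar>k\<bar> * (1 - Re \<alpha>)"
        unfolding \<nu>_def using re by (simp add: abs_mult)
      moreover have "k\<^sup>2 = \<bar>k\<bar> * \<bar>k\<bar>" by (simp add: power2_eq_square)
      ultimately show ?thesis by (simp only:)
    qed
    show "min 1 (m/2) * norm u \<le> norm (A *v u - \<nu> *s u)"
    proof (cases "norm \<nu> \<ge> R")
      case True
      have "norm (\<nu> *s u) \<le> norm (A *v u) + norm (A *v u - \<nu> *s u)"
        using norm_triangle_ineq4[of "A *v u" "A *v u - \<nu> *s u"] by simp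
      then have "norm \<nu> * norm u \<le> norm A * norm u + norm (A *v u - \<nu> *s u)"
        using norm_matrix_vector_mult_le[of A u] by (simp add: norm_vector_scalar_mult)
      moreover have "R * norm u \<le> norm \<nu> * norm u" using True by (intro mult_right_mono) auto
      ultimately have "1 * norm u \<le> norm (A *v u - \<nu> *s u)" by (simp add: R_def algebra_simps)
      moreover have "min 1 (m/2) * norm u \<le> 1 * norm u" by (intro mult_right_mono) auto
      ultimately show ?thesis by linarith
    next
      case False
      have "4 * \<bar>k\<bar> * \<bar>Im \<nu>\<bar> \<le> R\<^sup>2"
        unfolding \<open>(norm \<nu>)\<^sup>2 = 4 * \<bar>k\<bar> * \<bar>Im \<nu>\<bar>\<close>[symmetric] using False by (intro power_mono) auto
      moreover have "R\<^sup>2 \<le> 2 * m * \<bar>k\<bar>"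
        using k m by (simp add: field_simps)
      ultimately have "4 * \<bar>k\<bar> * \<bar>Im \<nu>\<bar> \<le> 2 * m * \<bar>k\<bar>" by linarith
      then have "\<bar>k\<bar> * (2 * \<bar>Im \<nu>\<bar>) \<le> \<bar>k\<bar> * m" by (simp add: algebra_simps)
      then have im: "\<bar>Im \<nu>\<bar> \<le> m/2" using kpos by simp
      have "\<bar>Re \<nu>\<bar> \<le> R" using False abs_Re_le_cmod[of \<nu>] by linarith
      then have "m * norm u \<le> norm (A *v u - complex_of_real (Re \<nu>) *s u)" by (rule real_bound)
      also have "A *v u - complex_of_real (Re \<nu>) *s u = (A *v u - \<nu> *s u) + (\<i> * of_real (Im \<nu>)) *s u"
        by (subst (2) complex_eq[of \<nu>]) (simp add: vec.scale_left_distrib)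
      also have "norm \<dots> \<le> norm (A *v u - \<nu> *s u) + \<bar>Im \<nu>\<bar> * norm u"
        using norm_triangle_ineq[of "A *v u - \<nu> *s u" "(\<i> * of_real (Im \<nu>)) *s u"]
        by (simp add: norm_vector_scalar_mult norm_mult)
      also have "\<bar>Im \<nu>\<bar> * norm u \<le> m/2 * norm u" using im by (intro mult_right_mono) auto
      finally have "m/2 * norm u \<le> norm (A *v u - \<nu> *s u)" by simp
      moreover have "min 1 (m/2) * norm u \<le> m/2 * norm u" by (intro mult_right_mono) auto
      ultimately show ?thesis by linarith
    qed
  qed
qed


text \<open>
  The integrating factor \<open>e\<^bsup>-\<omega>x\<^esup>\<close>.
\<close>

lemma ac_on_rotated:
  fixes p :: "real \<Rightarrow> complex ^ 'm::finite"
  assumes "ac_on a b p (\<lambda>x. \<omega> *s p x + g x)"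
  shows "ac_on a b (\<lambda>x. exp (- \<omega> * of_real x) *s p x) (\<lambda>x. exp (- \<omega> * of_real x) *s g x)"
proof -
  have e: "exp (- \<omega> * of_real x) = exp (x *\<^sub>R (- \<omega>))" for x
    by (simp add: scaleR_conv_of_real mult.commute)
  have "ac_on a b (\<lambda>x. exp (x *\<^sub>R (- \<omega>)) *s p x)
      (\<lambda>x. (exp (x *\<^sub>R (- \<omega>)) * (- \<omega>)) *s p x + exp (x *\<^sub>R (- \<omega>)) *s (\<omega> *s p x + g x))"
    by (rule ac_on_scaled[OF assms bounded_bilinear_vector_scalar_mult
          exp_scaleR_has_vector_derivative_right]) (intro continuous_intros)
  then show ?thesis
    unfolding e by (rule ac_on_cong) (auto simp: vec.scale_right_distrib mult.commute)
qed

lemma bounded_linear_matrix_vector_left: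
  "bounded_linear (\<lambda>M :: complex ^ 'n::finite ^ 'k::finite. M *v w)"
  using bilinear_matrix_vector_mult unfolding bilinear_def by (auto simp: linear_conv_bounded_linear)

lemma absolutely_integrable_cis_scale:
  fixes f :: "real \<Rightarrow> complex ^ 'n::finite"
  assumes "f absolutely_integrable_on {a..b}"
  shows "(\<lambda>s. cis (k * s) *s f s) absolutely_integrable_on {a..b}"
  by (intro absolutely_integrable_bounded_measurable_product[of "(*s)"] assms
      bounded_bilinear_vector_scalar_mult[THEN bilinear_conv_bounded_bilinear[THEN iffD2]]
      continuous_imp_measurable_on_sets_lebesgue compact_imp_bounded compact_continuous_image continuous_intros) auto

text \<open>
  The system satisfied by \<open>U = e\<^bsup>-ikx\<^esup> (y' + ik y)\<close> and \<open>V = e\<^bsup>ikx\<^esup> (y' - ik y)\<close> for a solution of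
  \<open>-y'' + Q y = k\<^sup>2 y\<close>.
\<close>

definition amplitude_equations ::
    "real \<Rightarrow> (real \<Rightarrow> complex ^ 'm ^ 'm::finite) \<Rightarrow> real \<Rightarrow>
     (real \<Rightarrow> complex ^ 'm) \<Rightarrow> (real \<Rightarrow> complex ^ 'm) \<Rightarrow> bool" where
  "amplitude_equations l Q k U V \<longleftrightarrow>
     ac_on 0 l U (\<lambda>s. (1 / (2 * \<i> * of_real k)) *s (Q s *v U s - cis (- 2 * k * s) *s (Q s *v V s))) \<and>
     ac_on 0 l V (\<lambda>s. (1 / (2 * \<i> * of_real k)) *s (cis (2 * k * s) *s (Q s *v U s) - Q s *v V s))"

text \<open>
  The maximum \<open>B\<close> of \<open>|U|\<close> and \<open>|V|\<close> is at most twice \<open>|U(0)|\<close>, because neither function moves by more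
  than \<open>B H / |k| \<le> B / 2\<close>. So \<open>U\<close> and \<open>V\<close> can be replaced by their initial values in the integral
  for \<open>U(l) - U(0)\<close> at the cost of a term of order \<open>1/|k|\<close>.
\<close>

lemma oscillatory_increment:
  fixes Q :: "real \<Rightarrow> complex ^ 'm::finite ^ 'm"
  assumes Q: "L2_on 0 l Q" and l: "l > 0" and k: "k \<noteq> 0"
    and eqs: "amplitude_equations l Q k U V"
    and H: "H = integral {0..l} (\<lambda>s. norm (Q s))" "2 * H \<le> \<bar>k\<bar>"
    and UV: "norm (V 0) \<le> norm (U 0)"
  shows "norm ((2 * \<i> * of_real k) *s (U l - U 0) - (integral {0..l} Q *v U 0 - integral {0..l} (\<lambda>s. cis (- 2 * k * s) *s (Q s *v V 0))))
     \<le> 4 * H\<^sup>2 / \<bar>k\<bar> * norm (U 0)"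
proof -
  note U = eqs[unfolded amplitude_equations_def, THEN conjunct1]
    and V = eqs[unfolded amplitude_equations_def, THEN conjunct2]
  have Qi: "Q absolutely_integrable_on {0..l}" by (rule L2_on_imp_integrable[OF Q])
  have hi: "(\<lambda>s. norm (Q s)) integrable_on {0..l}" using Qi by (simp add: absolutely_integrable_on_def)
  have hix: "(\<lambda>s. norm (Q s)) integrable_on {0..x}" if "x \<le> l" for x
    by (rule integrable_on_subinterval[OF hi]) (use that in auto)
  have Hx: "integral {0..x} (\<lambda>s. norm (Q s)) \<le> H" if "x \<le> l" for x
    unfolding H(1) by (rule integral_subset_le) (use hi hix that in auto)
  have H0: "H \<ge> 0" unfolding H(1) by (rule integral_nonneg[OF hi]) auto
  define b0 where "b0 = norm (U 0)"
  have "continuous_on {0..l} (\<lambda>x. max (norm (U x)) (norm (V x)))"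
    by (intro continuous_intros ac_on_continuous[OF U] ac_on_continuous[OF V])
  then obtain z where z: "z \<in> {0..l}" "\<And>x. x \<in> {0..l} \<Longrightarrow> max (norm (U x)) (norm (V x)) \<le> max (norm (U z)) (norm (V z))"
    using continuous_attains_sup[of "{0..l}" "\<lambda>x. max (norm (U x)) (norm (V x))"] l by auto
  define B where "B = max (norm (U z)) (norm (V z))"
  have B0: "B \<ge> 0" unfolding B_def by (simp add: le_max_iff_disj)
  have UB: "norm (U x) \<le> B" and VB: "norm (V x) \<le> B" if "x \<in> {0..l}" for x
    using z(2)[OF that] unfolding B_def by auto
  have QU: "norm (Q s *v w) \<le> norm (Q s) * c" if "norm w \<le> c" for s w c
    using norm_matrix_vector_mult_le[of "Q s" w] mult_left_mono[OF that norm_ge_zero[of "Q s"]] by linarith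
  have k1: "norm (1 / (2 * \<i> * complex_of_real k)) = 1 / (2 * \<bar>k\<bar>)"
    by (simp add: norm_divide norm_mult)
  have incr: "norm (W x - W 0) \<le> B / \<bar>k\<bar> * H"
    if W: "ac_on 0 l W (\<lambda>s. (1 / (2 * \<i> * of_real k)) *s G s)"
      and G: "\<And>s. s \<in> {0..l} \<Longrightarrow> norm (G s) \<le> norm (Q s) * B + norm (Q s) * B" and x: "x \<in> {0..l}" for W G x
  proof -
    have "norm (W x - W 0) \<le> integral {0..x} (\<lambda>s. B / \<bar>k\<bar> * norm (Q s))"
    proof (rule ac_on_norm_increment_le[OF W])
      show "(\<lambda>s. B / \<bar>k\<bar> * norm (Q s)) integrable_on {0..x}"
        using integrable_cmul[OF hix, of x "B / \<bar>k\<bar>"] x by simp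
      fix s assume "s \<in> {0..x}"
      with x have "1 / (2 * \<bar>k\<bar>) * norm (G s) \<le> 1 / (2 * \<bar>k\<bar>) * (norm (Q s) * B + norm (Q s) * B)"
        by (intro mult_left_mono G) auto
      then show "norm ((1 / (2 * \<i> * of_real k)) *s G s) \<le> B / \<bar>k\<bar> * norm (Q s)"
        unfolding norm_vector_scalar_mult k1 by (simp add: field_simps)
    qed (use x in auto)
    also have "\<dots> \<le> B / \<bar>k\<bar> * H"
      using mult_left_mono[OF Hx[of x], of "B / \<bar>k\<bar>"] B0 x by simp
    finally show ?thesis .
  qed
  have dU: "norm (U x - U 0) \<le> B / \<bar>k\<bar> * H" if x: "x \<in> {0..l}" for x
  proof (rule incr[OF U _ x])
    fix s assume s: "s \<in> {0..l}"
    show "norm (Q s *v U s - cis (- 2 * k * s) *s (Q s *v V s)) \<le> norm (Q s) * B + norm (Q s) * B"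
      using norm_triangle_ineq4[of "Q s *v U s" "cis (- 2 * k * s) *s (Q s *v V s)"] QU[OF UB[OF s], of s] QU[OF VB[OF s], of s]
      unfolding norm_vector_scalar_mult norm_cis mult_1 by linarith
  qed
  have dV: "norm (V x - V 0) \<le> B / \<bar>k\<bar> * H" if x: "x \<in> {0..l}" for x
  proof (rule incr[OF V _ x])
    fix s assume s: "s \<in> {0..l}"
    show "norm (cis (2 * k * s) *s (Q s *v U s) - Q s *v V s) \<le> norm (Q s) * B + norm (Q s) * B"
      using norm_triangle_ineq4[of "cis (2 * k * s) *s (Q s *v U s)" "Q s *v V s"] QU[OF UB[OF s], of s] QU[OF VB[OF s], of s]
      unfolding norm_vector_scalar_mult norm_cis mult_1 by linarith
  qed
  have "B / \<bar>k\<bar> * H \<le> B / 2"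
    using H(2) k B0 mult_left_mono[OF H(2) B0] by (simp add: field_simps)
  moreover have "norm (U z) \<le> b0 + norm (U z - U 0)" "norm (V z) \<le> b0 + norm (V z - V 0)"
    using norm_triangle_sub[of "U z" "U 0"] norm_triangle_sub[of "V z" "V 0"] UV by (auto simp: b0_def)
  ultimately have "B \<le> b0 + B / 2" using dU[OF z(1)] dV[OF z(1)] unfolding B_def by linarith
  then have B: "B \<le> 2 * b0" by simp
  have D: "B / \<bar>k\<bar> * H \<le> 2 * b0 * H / \<bar>k\<bar>"
    using mult_right_mono[OF B H0] by (simp add: divide_right_mono)
  define E where "E s = Q s *v (U s - U 0) - cis (- 2 * k * s) *s (Q s *v (V s - V 0))" for s
  have "ac_on 0 l (\<lambda>s. (2 * \<i> * of_real k) *s U s) (\<lambda>s. Q s *v U s - cis (- 2 * k * s) *s (Q s *v V s))"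
    by (rule ac_on_cong[OF ac_on_linear[OF U bounded_bilinear.bounded_linear_right[OF
              bounded_bilinear_vector_scalar_mult, of "2 * \<i> * of_real k"]]]) (use k in auto)
  from ac_on_increment[OF this, of 0 l] ac_on_integrable_subinterval(1)[OF this, of 0 l] l
  have I1: "((\<lambda>s. Q s *v U s - cis (- 2 * k * s) *s (Q s *v V s)) has_integral (2 * \<i> * of_real k) *s (U l - U 0)) {0..l}"
    by (simp add: vec.scale_right_diff_distrib has_integral_iff)
  have I2: "((\<lambda>s. Q s *v U 0) has_integral integral {0..l} Q *v U 0) {0..l}"
  proof -
    from has_integral_linear[OF integrable_integral bounded_linear_matrix_vector_left] Qi
    show ?thesis by (auto simp: o_def absolutely_integrable_on_def)
  qed
  have "(\<lambda>s. cis (- 2 * k * s) *s (Q s *v V 0)) absolutely_integrable_on {0..l}"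
    using absolutely_integrable_cis_scale[OF absolutely_integrable_linear[OF Qi bounded_linear_matrix_vector_left], of "- 2 * k" "V 0"]
    by (simp add: o_def)
  then have I3: "((\<lambda>s. cis (- 2 * k * s) *s (Q s *v V 0)) has_integral integral {0..l} (\<lambda>s. cis (- 2 * k * s) *s (Q s *v V 0))) {0..l}"
    by (auto simp: absolutely_integrable_on_def)
  have I: "(E has_integral ((2 * \<i> * of_real k) *s (U l - U 0) - (integral {0..l} Q *v U 0 - integral {0..l} (\<lambda>s. cis (- 2 * k * s) *s (Q s *v V 0))))) {0..l}"
    using has_integral_diff[OF I1 has_integral_diff[OF I2 I3]]
    unfolding E_def by (rule has_integral_eq[rotated]) (simp add: matrix_vector_mult_diff_distrib vec.scale_right_diff_distrib)
  have E: "norm (E s) \<le> 4 * b0 * H / \<bar>k\<bar> * norm (Q s)" if s: "s \<in> {0..l}" for s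
  proof -
    have "norm (E s) \<le> norm (Q s) * (2 * b0 * H / \<bar>k\<bar>) + norm (Q s) * (2 * b0 * H / \<bar>k\<bar>)"
      unfolding E_def
      using norm_triangle_ineq4[of "Q s *v (U s - U 0)" "cis (- 2 * k * s) *s (Q s *v (V s - V 0))"]
        QU[OF order_trans[OF dU[OF s] D], of s] QU[OF order_trans[OF dV[OF s] D], of s]
      unfolding norm_vector_scalar_mult norm_cis mult_1 by linarith
    also have "\<dots> = 4 * b0 * H / \<bar>k\<bar> * norm (Q s)" by simp
    finally show ?thesis .
  qed
  have "norm (integral {0..l} E) \<le> integral {0..l} (\<lambda>s. 4 * b0 * H / \<bar>k\<bar> * norm (Q s))"
    by (rule Henstock_Kurzweil_Integration.integral_norm_bound_integral)
      (use I E integrable_cmul[OF hi, of "4 * b0 * H / \<bar>k\<bar>"] in auto)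
  also have "\<dots> = 4 * H\<^sup>2 / \<bar>k\<bar> * b0"
    by (simp add: H(1)[symmetric] power2_eq_square)
  finally show ?thesis using I by (simp add: integral_unique b0_def)
qed

text \<open>
  The Riemann-Lebesgue lemma for each entry of the matrix.
\<close>

lemma Fourier_coefficient_small:
  fixes Q :: "real \<Rightarrow> complex ^ 'm::finite ^ 'm"
  assumes Q: "Q absolutely_integrable_on {a..b}"
  obtains \<rho> :: "real \<Rightarrow> real" where "(\<rho> \<longlongrightarrow> 0) at_infinity"
    "\<And>k v. norm (integral {a..b} (\<lambda>s. cis (k * s) *s (Q s *v v))) \<le> \<rho> k * norm v"
proof -
  define q where "q i j k = integral {a..b} (\<lambda>s. cis (k * s) * Q s $ i $ j)" for i j k
  have Qij: "(\<lambda>s. Q s $ i $ j) absolutely_integrable_on {a..b}" for i j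
    using absolutely_integrable_linear[OF Q bounded_linear_compose[OF bounded_linear_vec_nth[of j] bounded_linear_vec_nth[of i]]]
    by (simp add: o_def)
  have cQ: "(\<lambda>s. cis (k * s) * Q s $ i $ j) absolutely_integrable_on {a..b}" for i j k
    by (intro absolutely_integrable_bounded_measurable_product[of "(*)"] bilinear_times Qij
        continuous_imp_measurable_on_sets_lebesgue compact_imp_bounded compact_continuous_image continuous_intros) auto
  define \<rho> where "\<rho> k = (\<Sum>i\<in>UNIV. \<Sum>j\<in>UNIV. norm (q i j k))" for k
  show ?thesis
  proof (rule that)
    have "(\<rho> \<longlongrightarrow> (\<Sum>i\<in>(UNIV::'m set). \<Sum>j\<in>(UNIV::'m set). 0)) at_infinity"
      unfolding \<rho>_def q_def
      by (intro tendsto_sum tendsto_norm_zero Riemann_Lebesgue Qij)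
    then show "(\<rho> \<longlongrightarrow> 0) at_infinity" by simp
    fix k v
    define r where "r = integral {a..b} (\<lambda>s. cis (k * s) *s (Q s *v v))"
    have r: "r $ i = (\<Sum>j\<in>UNIV. q i j k * v $ j)" for i
    proof -
      have "(\<lambda>s. cis (k * s) *s (Q s *v v)) integrable_on {a..b}"
        using absolutely_integrable_cis_scale[OF absolutely_integrable_linear[OF Q bounded_linear_matrix_vector_left], of k v]
        by (simp add: o_def absolutely_integrable_on_def)
      from integral_linear[OF this bounded_linear_vec_nth[of i]]
      have "r $ i = integral {a..b} (\<lambda>s. \<Sum>j\<in>UNIV. (cis (k * s) * Q s $ i $ j) * v $ j)"
        by (simp add: r_def o_def matrix_vector_mult_def sum_distrib_left mult.assoc)
      also have "\<dots> = (\<Sum>j\<in>UNIV. q i j k * v $ j)"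
        unfolding q_def
        by (intro integral_unique has_integral_sum has_integral_mult_left integrable_integral)
          (use cQ in \<open>auto simp: absolutely_integrable_on_def\<close>)
      finally show ?thesis .
    qed
    have "norm r \<le> (\<Sum>i\<in>UNIV. norm (r $ i))"
      unfolding norm_vec_def by (rule L2_set_le_sum) simp
    also have "\<dots> \<le> (\<Sum>i\<in>UNIV. \<Sum>j\<in>UNIV. norm (q i j k) * norm v)"
      unfolding r
      by (intro sum_mono order_trans[OF norm_sum])
        (auto simp: norm_mult intro!: mult_left_mono Finite_Cartesian_Product.norm_nth_le)
    also have "\<dots> = \<rho> k * norm v" by (simp add: \<rho>_def sum_distrib_right)
    finally show "norm (integral {a..b} (\<lambda>s. cis (k * s) *s (Q s *v v))) \<le> \<rho> k * norm v" unfolding r_def .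
  qed
qed


text \<open>
  The assumption \<open>|V(0)| \<le> |U(0)|\<close> loses no generality: replacing \<open>k\<close> by \<open>-k\<close> exchanges the roles of
  \<open>U\<close> and \<open>V\<close>.
\<close>

lemma multiplier_estimate_positive:
  fixes Q :: "real \<Rightarrow> complex ^ 'm::finite ^ 'm"
  assumes Q: "L2_on 0 l Q" and l: "l > 0"
    and A: "\<And>\<mu>. matrix_eigenvalue (integral {0..l} Q) \<mu> \<Longrightarrow> \<mu> \<notin> \<real>"
  obtains k0 where "k0 > 0"
    "\<And>k U V \<alpha>. \<bar>k\<bar> \<ge> k0 \<Longrightarrow>
       amplitude_equations l Q k U V \<Longrightarrow>
       norm (V 0) \<le> norm (U 0) \<Longrightarrow> U l = \<alpha> *s U 0 \<Longrightarrow> norm \<alpha> = 1 \<Longrightarrow> U 0 = 0"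
proof -
  obtain c k1 where c: "c > 0" "k1 > 0"
    "\<And>k \<alpha> u. \<bar>k\<bar> \<ge> k1 \<Longrightarrow> norm \<alpha> = 1 \<Longrightarrow> c * norm u \<le> norm (integral {0..l} Q *v u - (2 * \<i> * of_real k * (\<alpha> - 1)) *s u)"
    using no_real_eigenvalue_bound[OF A] by blast
  obtain \<rho> :: "real \<Rightarrow> real" where \<rho>: "(\<rho> \<longlongrightarrow> 0) at_infinity"
    "\<And>k v. norm (integral {0..l} (\<lambda>s. cis (k * s) *s (Q s *v v))) \<le> \<rho> k * norm v"
    using Fourier_coefficient_small[OF L2_on_imp_integrable[OF Q]] by blast
  obtain b where b: "\<And>k. b \<le> \<bar>k\<bar> \<Longrightarrow> \<rho> k < c / 2"
    using order_tendstoD(2)[OF \<rho>(1), of "c/2"] c(1) by (auto simp: eventually_at_infinity)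
  define H where "H = integral {0..l} (\<lambda>s. norm (Q s))"
  \<comment> \<open>The Fourier term costs at most half of the lower bound \<open>c\<close>; the term \<open>8 H\<^sup>2 / c\<close> makes the
    remainder \<open>4 H\<^sup>2 / |k|\<close> smaller than the other half.\<close>
  define k0 where "k0 = \<bar>b\<bar> + \<bar>k1\<bar> + 2 * \<bar>H\<bar> + 8 * H\<^sup>2 / c + 1"
  have pos: "8 * H\<^sup>2 / c \<ge> 0" using c(1) by simp
  show ?thesis
  proof (rule that)
    show "k0 > 0" unfolding k0_def using pos by linarith
    fix k U V \<alpha>
    assume k: "\<bar>k\<bar> \<ge> k0"
      and eqs: "amplitude_equations l Q k U V"
      and UV: "norm (V 0) \<le> norm (U 0)" and \<alpha>: "U l = \<alpha> *s U 0" "norm \<alpha> = 1"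
    have k': "\<bar>b\<bar> \<le> \<bar>k\<bar>" "k1 \<le> \<bar>k\<bar>" "2 * H \<le> \<bar>k\<bar>" "8 * H\<^sup>2 / c < \<bar>k\<bar>" "\<bar>k\<bar> > 0"
      using k pos unfolding k0_def by linarith+
    define r where "r = integral {0..l} (\<lambda>s. cis (- 2 * k * s) *s (Q s *v V 0))"
    define n where "n = norm (U 0)"
    have "b \<le> \<bar>- 2 * k\<bar>" using k' by simp
    then have "\<rho> (- 2 * k) \<le> c / 2" by (rule less_imp_le[OF b])
    then have "\<rho> (- 2 * k) * norm (V 0) \<le> c / 2 * n"
      using UV c(1) unfolding n_def by (intro mult_mono) auto
    then have r: "norm r \<le> c / 2 * n"
      using \<rho>(2)[of "- 2 * k" "V 0"] unfolding r_def by linarith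
    have "norm ((2 * \<i> * of_real k) *s (U l - U 0) - (integral {0..l} Q *v U 0 - r)) \<le> 4 * H\<^sup>2 / \<bar>k\<bar> * n"
      unfolding r_def n_def by (rule oscillatory_increment[OF Q l _ eqs H_def k'(3) UV]) (use k' in auto)
    moreover have "(2 * \<i> * of_real k) *s (U l - U 0) = (2 * \<i> * of_real k * (\<alpha> - 1)) *s U 0"
      unfolding \<alpha>(1) by (simp add: vec_eq_iff algebra_simps)
    ultimately have "norm ((integral {0..l} Q *v U 0 - (2 * \<i> * of_real k * (\<alpha> - 1)) *s U 0) - r) \<le> 4 * H\<^sup>2 / \<bar>k\<bar> * n"
      by (simp add: norm_minus_commute algebra_simps)
    then have "norm (integral {0..l} Q *v U 0 - (2 * \<i> * of_real k * (\<alpha> - 1)) *s U 0) \<le> 4 * H\<^sup>2 / \<bar>k\<bar> * n + c / 2 * n"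
      using norm_triangle_sub[of "integral {0..l} Q *v U 0 - (2 * \<i> * of_real k * (\<alpha> - 1)) *s U 0" r] r by linarith
    with c(3)[OF k'(2) \<alpha>(2), of "U 0"] have "c / 2 * n \<le> 4 * H\<^sup>2 / \<bar>k\<bar> * n" unfolding n_def by linarith
    moreover have "4 * H\<^sup>2 / \<bar>k\<bar> < c / 2" using k'(4,5) c(1) by (simp add: field_simps)
    ultimately have "n \<le> 0" by (metis mult_less_cancel_right_disj not_le)
    then show "U 0 = 0" by (simp add: n_def)
  qed
qed

text \<open>
  The component \<open>p\<close> grows like \<open>e\<^bsup>\<kappa>x\<^esup>\<close>, so it is integrated backwards from the end of the period, \<open>q\<close>
  forwards from its beginning. As the multiplier has modulus one, the boundary values come back with
  the factor \<open>e\<^bsup>-\<kappa>l\<^esup> \<le> 1/2\<close> and are absorbed. With \<open>Y\<close> the maximum of \<open>|y|\<close> this gives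
  \<open>|p|, |q| \<le> 3 H Y\<close> at the maximum point, hence \<open>2 \<kappa> Y \<le> 6 H Y\<close>.
\<close>

lemma multiplier_estimate_negative:
  fixes Q :: "real \<Rightarrow> complex ^ 'm::finite ^ 'm"
  assumes Q: "L2_on 0 l Q" and l: "l > 0"
    and \<kappa>: "\<kappa> > 3 * integral {0..l} (\<lambda>s. norm (Q s))" "\<kappa> * l \<ge> 1"
    and p: "ac_on 0 l p (\<lambda>s. of_real \<kappa> *s p s + Q s *v y s)"
    and q: "ac_on 0 l q (\<lambda>s. - of_real \<kappa> *s q s + Q s *v y s)"
    and y: "\<And>s. s \<in> {0..l} \<Longrightarrow> of_real (2 * \<kappa>) *s y s = p s - q s" "continuous_on {0..l} y"
    and \<zeta>: "p l = \<zeta> *s p 0" "q l = \<zeta> *s q 0" "norm \<zeta> = 1"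
  shows "p 0 = 0 \<and> q 0 = 0"
proof -
  have Qi: "Q absolutely_integrable_on {0..l}" by (rule L2_on_imp_integrable[OF Q])
  have hi: "(\<lambda>s. norm (Q s)) integrable_on {0..l}" using Qi by (simp add: absolutely_integrable_on_def)
  define H where "H = integral {0..l} (\<lambda>s. norm (Q s))"
  have H0: "H \<ge> 0" unfolding H_def by (rule integral_nonneg[OF hi]) auto
  have \<kappa>0: "\<kappa> > 0" using \<kappa>(1) H0 by (simp add: H_def)
  obtain z where z: "z \<in> {0..l}" "\<And>x. x \<in> {0..l} \<Longrightarrow> norm (y x) \<le> norm (y z)"
    using continuous_attains_sup[OF compact_Icc _ continuous_on_norm[OF y(2)]] l by force
  define Y where "Y = norm (y z)"
  have Y0: "Y \<ge> 0" by (simp add: Y_def)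
  have incr: "norm (W b - W a) \<le> c * (H * Y)"
    if W: "ac_on 0 l W (\<lambda>s. e s *s (Q s *v y s))" and e: "\<And>s. s \<in> {a..b} \<Longrightarrow> norm (e s) \<le> c"
      and ab: "0 \<le> a" "a \<le> b" "b \<le> l" for W a b c e
  proof -
    have c0: "c \<ge> 0" using e[of a] ab norm_ge_zero[of "e a"] by (meson atLeastAtMost_iff order_refl order_trans)
    have hab: "(\<lambda>s. norm (Q s)) integrable_on {a..b}"
      by (rule integrable_on_subinterval[OF hi]) (use ab in auto)
    have "norm (W b - W a) \<le> integral {a..b} (\<lambda>s. c * Y * norm (Q s))"
    proof (rule ac_on_norm_increment_le[OF W ab])
      show "(\<lambda>s. c * Y * norm (Q s)) integrable_on {a..b}" using integrable_cmul[OF hab, of "c * Y"] by simp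
      fix s assume s: "s \<in> {a..b}"
      have "norm (Q s *v y s) \<le> norm (Q s) * norm (y s)" by (rule norm_matrix_vector_mult_le)
      also have "\<dots> \<le> norm (Q s) * Y" using z(2)[of s] s ab by (auto simp: Y_def intro!: mult_left_mono)
      finally have "norm (e s) * norm (Q s *v y s) \<le> c * (norm (Q s) * Y)"
        using e[OF s] c0 by (intro mult_mono) auto
      then show "norm (e s *s (Q s *v y s)) \<le> c * Y * norm (Q s)"
        by (simp add: norm_vector_scalar_mult mult_ac)
    qed
    also have "\<dots> = c * Y * integral {a..b} (\<lambda>s. norm (Q s))" by simp
    also have "\<dots> \<le> c * Y * H"
      unfolding H_def by (intro mult_left_mono integral_subset_le hab hi) (use ab c0 Y0 in auto)
    finally show ?thesis by (simp add: mult_ac)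
  qed
  have e2: "exp (- \<kappa> * l) \<le> 1 / 2"
  proof -
    have "2 \<le> exp (\<kappa> * l)" using exp_ge_add_one_self[of "\<kappa> * l"] \<kappa>(2) by linarith
    then show ?thesis by (simp add: exp_minus field_simps)
  qed
  note U = ac_on_rotated[OF p]
  note V = ac_on_rotated[OF q]
  have pb: "norm (p x) \<le> exp (- \<kappa> * (l - x)) * norm (p 0) + H * Y" if x: "x \<in> {0..l}" for x
  proof -
    have "norm (exp (- of_real \<kappa> * of_real l) *s p l - exp (- of_real \<kappa> * of_real x) *s p x) \<le> exp (- \<kappa> * x) * (H * Y)"
      using x \<kappa>0 by (intro incr[OF U]) (auto simp: norm_exp_eq_Re)
    moreover have "norm (exp (- of_real \<kappa> * of_real x) *s p x) = exp (- \<kappa> * x) * norm (p x)"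
      by (simp add: norm_vector_scalar_mult norm_exp_eq_Re)
    moreover have "norm (exp (- of_real \<kappa> * of_real l) *s p l) = exp (- \<kappa> * l) * norm (p 0)"
      by (simp add: norm_vector_scalar_mult norm_exp_eq_Re norm_mult \<zeta>)
    ultimately have "exp (- \<kappa> * x) * norm (p x) \<le> exp (- \<kappa> * l) * norm (p 0) + exp (- \<kappa> * x) * (H * Y)"
      using norm_triangle_sub[of "exp (- of_real \<kappa> * of_real x) *s p x" "exp (- of_real \<kappa> * of_real l) *s p l"]
      by (simp add: norm_minus_commute)
    then have "exp (\<kappa> * x) * (exp (- \<kappa> * x) * norm (p x)) \<le> exp (\<kappa> * x) * (exp (- \<kappa> * l) * norm (p 0) + exp (- \<kappa> * x) * (H * Y))"
      by (intro mult_left_mono) auto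
    moreover have "exp (\<kappa> * x) * exp (- \<kappa> * x) = 1" "exp (\<kappa> * x) * exp (- \<kappa> * l) = exp (- \<kappa> * (l - x))"
      by (simp_all add: mult_exp_exp algebra_simps)
    ultimately show ?thesis by (simp only: distrib_left mult.assoc[symmetric] mult_1)
  qed
  have qb: "norm (q x) \<le> exp (- \<kappa> * x) * norm (q 0) + H * Y" if x: "x \<in> {0..l}" for x
  proof -
    have "norm (exp (- (- of_real \<kappa>) * of_real x) *s q x - exp (- (- of_real \<kappa>) * of_real 0) *s q 0) \<le> exp (\<kappa> * x) * (H * Y)"
      using x \<kappa>0 by (intro incr[OF V]) (auto simp: norm_exp_eq_Re)
    moreover have "norm (exp (- (- of_real \<kappa>) * of_real x) *s q x) = exp (\<kappa> * x) * norm (q x)"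
      by (simp add: norm_vector_scalar_mult norm_exp_eq_Re)
    ultimately have "exp (\<kappa> * x) * norm (q x) \<le> norm (q 0) + exp (\<kappa> * x) * (H * Y)"
      using norm_triangle_sub[of "exp (- (- of_real \<kappa>) * of_real x) *s q x" "exp (- (- of_real \<kappa>) * of_real 0) *s q 0"]
      by simp
    then have "exp (- \<kappa> * x) * (exp (\<kappa> * x) * norm (q x)) \<le> exp (- \<kappa> * x) * (norm (q 0) + exp (\<kappa> * x) * (H * Y))"
      by (intro mult_left_mono) auto
    then show ?thesis by (simp add: exp_minus algebra_simps divide_simps)
  qed
  have half: "exp (- \<kappa> * l) * n \<le> n / 2" if "n \<ge> 0" for n
    using mult_right_mono[OF e2 that] by simp
  have "norm (p 0) \<le> norm (p 0) / 2 + H * Y"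
    using pb[of 0] half[of "norm (p 0)"] l by simp
  then have p0: "norm (p 0) \<le> 2 * (H * Y)" by simp
  have "norm (q 0) \<le> norm (q 0) / 2 + H * Y"
    using qb[of l] half[of "norm (q 0)"] l \<zeta> by (simp add: norm_vector_scalar_mult)
  then have q0: "norm (q 0) \<le> 2 * (H * Y)" by simp
  have HY: "H * Y \<ge> 0" using H0 Y0 by simp
  have "exp (- \<kappa> * (l - z)) * norm (p 0) \<le> 1 * (2 * (H * Y))"
    using z(1) \<kappa>0 HY by (intro mult_mono p0) auto
  then have pz: "norm (p z) \<le> 3 * (H * Y)" using pb[OF z(1)] by linarith
  have "exp (- \<kappa> * z) * norm (q 0) \<le> 1 * (2 * (H * Y))"
    using z(1) \<kappa>0 HY by (intro mult_mono q0) auto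
  then have qz: "norm (q z) \<le> 3 * (H * Y)" using qb[OF z(1)] by linarith
  have "2 * \<kappa> * Y = norm (of_real (2 * \<kappa>) *s y z)"
    unfolding norm_vector_scalar_mult norm_of_real Y_def using \<kappa>0 by simp
  also have "\<dots> \<le> 3 * (H * Y) + 3 * (H * Y)"
    unfolding y(1)[OF z(1)] using norm_triangle_ineq4[of "p z" "q z"] pz qz by linarith
  finally have "(\<kappa> - 3 * H) * Y \<le> 0" by (simp add: algebra_simps)
  then have "Y = 0" using \<kappa>(1) Y0 by (auto simp: H_def mult_le_0_iff)
  then show ?thesis using p0 q0 by simp
qed

text \<open>
  With \<open>\<omega>\<^sup>2 = -E\<close> the functions \<open>p = y' + \<omega> y\<close> and \<open>q = y' - \<omega> y\<close> satisfy \<open>p' = \<omega> p + Q y\<close> and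
  \<open>q' = -\<omega> q + Q y\<close>. Here \<open>\<omega>\<close> is imaginary for positive \<open>E\<close> and real for negative \<open>E\<close>.
\<close>

theorem no_unimodular_multiplier:
  fixes Q :: "real \<Rightarrow> complex ^ 'm::finite ^ 'm"
  assumes Q: "L2_on 0 l Q" and l: "l > 0"
    and A: "\<And>\<mu>. matrix_eigenvalue (integral {0..l} Q) \<mu> \<Longrightarrow> \<mu> \<notin> \<real>"
  obtains R :: real where "R > 0"
    "\<And>E y y' \<zeta>. \<bar>E\<bar> \<ge> R \<Longrightarrow> ac_on 0 l y y' \<Longrightarrow> ac_on 0 l y' (\<lambda>s. Q s *v y s - complex_of_real E *s y s) \<Longrightarrow>
       y l = \<zeta> *s y 0 \<Longrightarrow> y' l = \<zeta> *s y' 0 \<Longrightarrow> norm \<zeta> = 1 \<Longrightarrow> y 0 = 0 \<and> y' 0 = 0"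
proof -
  obtain k0 where k0: "k0 > 0"
    "\<And>k U V \<alpha>. \<bar>k\<bar> \<ge> k0 \<Longrightarrow>
       amplitude_equations l Q k U V \<Longrightarrow>
       norm (V 0) \<le> norm (U 0) \<Longrightarrow> U l = \<alpha> *s U 0 \<Longrightarrow> norm \<alpha> = 1 \<Longrightarrow> U 0 = 0"
    using multiplier_estimate_positive[OF Q l A] by blast
  define H where "H = integral {0..l} (\<lambda>s. norm (Q s))"
  define K where "K = max k0 (max (3 * H + 1) (1 / l))"
  have K: "K > 0" "k0 \<le> K" "3 * H + 1 \<le> K" "1 / l \<le> K" using k0(1) by (auto simp: K_def)
  have factor: "ac_on 0 l (\<lambda>s. y' s + \<omega> *s y s) (\<lambda>s. \<omega> *s (y' s + \<omega> *s y s) + Q s *v y s)"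
    if "ac_on 0 l y y'" "ac_on 0 l y' (\<lambda>s. Q s *v y s - E *s y s)" "\<omega> * \<omega> = - E" for y y' and \<omega> E :: complex
  proof -
    have "ac_on 0 l (\<lambda>s. y' s + \<omega> *s y s) (\<lambda>s. (Q s *v y s - E *s y s) + \<omega> *s y' s)"
      by (rule ac_on_add[OF that(2) ac_on_linear[OF that(1)
              bounded_bilinear.bounded_linear_right[OF bounded_bilinear_vector_scalar_mult, of \<omega>]]])
    then show ?thesis
      by (rule ac_on_cong) (auto simp: vec.scale_right_distrib that(3) vec.scale_minus_left)
  qed
  show ?thesis
  proof (rule that)
    show "K\<^sup>2 > 0" using K by simp
    fix E :: real and y y' :: "real \<Rightarrow> complex ^ 'm" and \<zeta> :: complex
    assume lam: "\<bar>E\<bar> \<ge> K\<^sup>2" and y: "ac_on 0 l y y'" and y': "ac_on 0 l y' (\<lambda>s. Q s *v y s - complex_of_real E *s y s)"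
      and \<zeta>: "y l = \<zeta> *s y 0" "y' l = \<zeta> *s y' 0" "norm \<zeta> = 1"
    define k where "k = sqrt \<bar>E\<bar>"
    have kK: "k \<ge> K" unfolding k_def using lam K(1) by (intro real_le_rsqrt) 
    have kk: "k * k = \<bar>E\<bar>" unfolding k_def by simp
    have kpos: "k > 0" using kK K(1) by simp
    show "y 0 = 0 \<and> y' 0 = 0"
    proof (cases "E \<le> 0")
      case True
      then have lk: "complex_of_real k * complex_of_real k = - complex_of_real E"
        using kk by (simp flip: of_real_mult of_real_minus)
      have lk': "(- complex_of_real k) * (- complex_of_real k) = - complex_of_real E" using lk by simp
      note p = factor[OF y y' lk]
      note q = factor[OF y y' lk']
      have "y' 0 + of_real k *s y 0 = 0 \<and> y' 0 + (- of_real k) *s y 0 = 0"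
      proof (rule multiplier_estimate_negative[OF Q l _ _ p q])
        show "3 * integral {0..l} (\<lambda>s. norm (Q s)) < k" using kK K(3) by (simp add: H_def)
        have "1 / l * l \<le> k * l" by (rule mult_right_mono) (use kK K(4) l in auto)
        then show "1 \<le> k * l" using l by simp
        show "continuous_on {0..l} y" by (rule ac_on_continuous[OF y])
        show "of_real (2 * k) *s y s = y' s + of_real k *s y s - (y' s + (- of_real k) *s y s)" for s
          by (simp add: vec_eq_iff algebra_simps)
        show "y' l + of_real k *s y l = \<zeta> *s (y' 0 + of_real k *s y 0)"
          "y' l + (- of_real k) *s y l = \<zeta> *s (y' 0 + (- of_real k) *s y 0)"
          by (simp_all add: \<zeta> vec_eq_iff algebra_simps)
      qed (rule \<zeta>)
      moreover have "2 *s y' 0 = (y' 0 + of_real k *s y 0) + (y' 0 + (- of_real k) *s y 0)"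
        "of_real (2 * k) *s y 0 = (y' 0 + of_real k *s y 0) - (y' 0 + (- of_real k) *s y 0)"
        by (simp_all add: vec_eq_iff algebra_simps)
      ultimately have "2 *s y' 0 = 0" "of_real (2 * k) *s y 0 = 0"
        by (simp_all only: add_0 diff_self)
      then show ?thesis using kpos by simp
    next
      case False
      define \<omega> where "\<omega> = \<i> * complex_of_real k"
      have w: "\<omega> * \<omega> = - complex_of_real E" "(- \<omega>) * (- \<omega>) = - complex_of_real E"
        using False kk by (simp_all add: \<omega>_def mult_ac flip: of_real_mult) 
      have w0: "\<omega> \<noteq> 0" using kpos by (simp add: \<omega>_def)
      define p where "p s = y' s + \<omega> *s y s" for s
      define q where "q s = y' s + (- \<omega>) *s y s" for s
      have p: "ac_on 0 l p (\<lambda>s. \<omega> *s p s + Q s *v y s)" unfolding p_def by (rule factor[OF y y' w(1)])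
      have q: "ac_on 0 l q (\<lambda>s. (- \<omega>) *s q s + Q s *v y s)" unfolding q_def by (rule factor[OF y y' w(2)])
      define U where "U s = exp (- \<omega> * of_real s) *s p s" for s
      define V where "V s = exp (- (- \<omega>) * of_real s) *s q s" for s
      have cis: "exp (\<omega> * of_real s) = cis (k * s)" "exp (- \<omega> * of_real s) = cis (- k * s)" for s
        by (simp_all add: \<omega>_def cis_conv_exp mult_ac)
      have pU: "p s = cis (k * s) *s U s" and qV: "q s = cis (- k * s) *s V s" for s
      proof -
        have "cis (k * s) * exp (- \<omega> * of_real s) = 1" "cis (- k * s) * exp (- (- \<omega>) * of_real s) = 1"
          unfolding minus_minus cis by (simp_all add: cis_mult)
        then show "p s = cis (k * s) *s U s" "q s = cis (- k * s) *s V s"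
          unfolding U_def V_def by (simp_all only: vec.scale_scale vec.scale_one)
      qed
      have ys: "y s = (1 / (2 * \<omega>)) *s (cis (k * s) *s U s - cis (- k * s) *s V s)" for s
        unfolding pU[symmetric] qV[symmetric] p_def q_def using w0 by (simp add: vec_eq_iff field_simps)
      have Qy: "Q s *v y s = (1 / (2 * \<omega>)) *s (cis (k * s) *s (Q s *v U s) - cis (- k * s) *s (Q s *v V s))" for s
        unfolding ys by (simp add: vector_scalar_commute matrix_vector_mult_diff_distrib)
      have U: "ac_on 0 l U (\<lambda>s. (1 / (2 * \<omega>)) *s (Q s *v U s - cis (- 2 * k * s) *s (Q s *v V s)))"
        unfolding U_def
      proof (rule ac_on_cong[OF ac_on_rotated[OF p]])
        fix s
        have "exp (- \<omega> * of_real s) *s (Q s *v y s) = (1 / (2 * \<omega>)) *s ((cis (- k * s) * cis (k * s)) *s (Q s *v U s) - (cis (- k * s) * cis (- k * s)) *s (Q s *v V s))"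
          unfolding cis Qy by (simp add: vec_eq_iff algebra_simps)
        also have "\<dots> = (1 / (2 * \<omega>)) *s (Q s *v U s - cis (- 2 * k * s) *s (Q s *v V s))"
          by (simp add: cis_mult mult.assoc)
        finally show "exp (- \<omega> * of_real s) *s (Q s *v y s) = (1 / (2 * \<omega>)) *s (Q s *v (exp (- \<omega> * of_real s) *s p s) - cis (- 2 * k * s) *s (Q s *v V s))"
          unfolding U_def .
      qed simp
      have V: "ac_on 0 l V (\<lambda>s. (1 / (2 * \<omega>)) *s (cis (2 * k * s) *s (Q s *v U s) - Q s *v V s))"
        unfolding V_def
      proof (rule ac_on_cong[OF ac_on_rotated[OF q]])
        fix s
        have "exp (- (- \<omega>) * of_real s) *s (Q s *v y s) = (1 / (2 * \<omega>)) *s ((cis (k * s) * cis (k * s)) *s (Q s *v U s) - (cis (k * s) * cis (- k * s)) *s (Q s *v V s))"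
          unfolding minus_minus cis Qy by (simp add: vec_eq_iff algebra_simps)
        also have "\<dots> = (1 / (2 * \<omega>)) *s (cis (2 * k * s) *s (Q s *v U s) - Q s *v V s)"
          by (simp add: cis_mult mult.assoc)
        finally show "exp (- (- \<omega>) * of_real s) *s (Q s *v y s) = (1 / (2 * \<omega>)) *s (cis (2 * k * s) *s (Q s *v U s) - Q s *v (exp (- (- \<omega>) * of_real s) *s q s))"
          unfolding V_def .
      qed simp
      have U0: "U 0 = p 0" and V0: "V 0 = q 0" by (simp_all add: U_def V_def)
      have Ul: "U l = (cis (- k * l) * \<zeta>) *s U 0" 
        unfolding U_def cis by (simp add: p_def \<zeta> vec_eq_iff algebra_simps)
      have Vl: "V l = (cis (k * l) * \<zeta>) *s V 0"
        unfolding V_def minus_minus cis by (simp add: q_def \<zeta> vec_eq_iff algebra_simps)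
      have n1: "norm (cis (- k * l) * \<zeta>) = 1" "norm (cis (k * l) * \<zeta>) = 1" using \<zeta>(3) by (simp_all add: norm_mult)
      have "U 0 = 0 \<and> V 0 = 0"
      proof (cases "norm (V 0) \<le> norm (U 0)")
        case True
        have "U 0 = 0"
          by (rule k0(2)[of k U V, OF _ _ True Ul n1(1)])
            (use U V kK K(2) kpos in \<open>auto simp: amplitude_equations_def \<omega>_def mult.assoc\<close>)
        then show ?thesis using True by simp
      next
        case False
        then have UV: "norm (U 0) \<le> norm (V 0)" by simp
        have m: "(1 / (2 * \<i> * complex_of_real (- k))) *s (a - b) = (1 / (2 * \<omega>)) *s (b - a)" for a b :: "complex ^ 'm"
          using w0 by (simp add: \<omega>_def vec_eq_iff field_simps)
        have "V 0 = 0"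
        proof (rule k0(2)[of "- k" V U, OF _ _ UV Vl n1(2)])
          show "k0 \<le> \<bar>- k\<bar>" using kK K(2) by simp
          show "amplitude_equations l Q (- k) V U"
            unfolding amplitude_equations_def m using U V by simp
        qed
        then show ?thesis using UV by simp
      qed
      then have "p 0 + q 0 = 0" "p 0 - q 0 = 0" using U0 V0 by auto
      moreover have "2 *s y' 0 = p 0 + q 0" "(2 * \<omega>) *s y 0 = p 0 - q 0"
        unfolding p_def q_def by (simp_all add: vec_eq_iff algebra_simps)
      ultimately have "2 *s y' 0 = 0" "(2 * \<omega>) *s y 0 = 0" by simp_all
      then show ?thesis using w0 by simp
    qed
  qed
qed

section \<open>Square integrable functions on the line\<close>

text \<open>
  The squared norm of \<open>L\<^sub>2(\<real>)\<close> as an extended nonnegative real.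
\<close>

definition L2_sq :: "(real \<Rightarrow> 'a::real_normed_vector) \<Rightarrow> ennreal" where
  "L2_sq f = (\<integral>\<^sup>+x. ennreal ((norm (f x))\<^sup>2) \<partial>lebesgue)"

definition L2_local :: "(real \<Rightarrow> 'a::euclidean_space) \<Rightarrow> bool" where
  "L2_local f \<longleftrightarrow> f \<in> borel_measurable lebesgue \<and> (\<forall>a b. L2_on a b f)"

definition cell_norm :: "real \<Rightarrow> (real \<Rightarrow> 'a::real_normed_vector) \<Rightarrow> int \<Rightarrow> real" where
  "cell_norm l f n = sqrt (integral {0..l} (\<lambda>x. (norm (f (x + of_int n * l)))\<^sup>2))"

lemma L2_on_shift:
  assumes "L2_local f"
  shows "L2_on a b (\<lambda>x. f (x + c))"
proof -
  have f: "L2_on (a + c) (b + c) f" using assms by (simp add: L2_local_def)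
  have "f absolutely_integrable_on {a + c..b + c}" by (rule L2_on_imp_integrable[OF f])
  then have "(\<lambda>x. f (x + c)) absolutely_integrable_on {a..b}"
    using absolutely_integrable_shift[where f = f and c = c and a = "a + c" and b = "b + c"] by simp
  then have "(\<lambda>x. f (x + c)) \<in> borel_measurable (lebesgue_on {a..b})"
    by (rule absolutely_integrable_imp_borel_measurable) simp
  then show ?thesis
    using f integrable_shift_real_ivl[of "\<lambda>x. (norm (f x))\<^sup>2" "a + c" "b + c" c] by (simp add: L2_on_def)
qed

text \<open>
  The isometry of \<open>L\<^sub>2(\<real>)\<close> with square summable sequences of functions on one period.
\<close>

lemma L2_sq_cells:
  assumes f: "L2_local f" and l: "l > 0"
  shows "L2_sq f = l2_sq (cell_norm l f)"
proof -
  have fm: "f \<in> borel_measurable lebesgue" using f by (simp add: L2_local_def)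
  define C where "C n = {of_int n * l..<of_int (n + 1) * l}" for n :: int
  have C: "x \<in> C n \<longleftrightarrow> n = \<lfloor>x / l\<rfloor>" for x n
  proof -
    have "x \<in> C n \<longleftrightarrow> of_int n \<le> x / l \<and> x / l < of_int n + 1"
      using l by (auto simp: C_def field_simps)
    also have "\<dots> \<longleftrightarrow> n = \<lfloor>x / l\<rfloor>" unfolding floor_eq_iff[symmetric] by auto
    finally show ?thesis .
  qed
  have "L2_sq f = (\<integral>\<^sup>+x. \<integral>\<^sup>+n. ennreal ((norm (f x))\<^sup>2) * indicator (C n) x \<partial>count_space UNIV \<partial>lebesgue)"
    unfolding L2_sq_def
  proof (rule nn_integral_cong)
    fix x
    have "(\<integral>\<^sup>+n. ennreal ((norm (f x))\<^sup>2) * indicator (C n) x \<partial>count_space UNIV)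
      = (\<integral>\<^sup>+n. ennreal ((norm (f x))\<^sup>2) * indicator {\<lfloor>x / l\<rfloor>} n \<partial>count_space UNIV)"
      by (intro nn_integral_cong) (simp add: indicator_def C)
    then show "ennreal ((norm (f x))\<^sup>2) = (\<integral>\<^sup>+n. ennreal ((norm (f x))\<^sup>2) * indicator (C n) x \<partial>count_space UNIV)"
      by (simp add: nn_integral_cmult_indicator)
  qed
  also have "\<dots> = (\<integral>\<^sup>+n. \<integral>\<^sup>+x. ennreal ((norm (f x))\<^sup>2) * indicator (C n) x \<partial>lebesgue \<partial>count_space UNIV)"
  proof (rule nn_integral_count_space_nn_integral)
    show "(\<lambda>x. ennreal ((norm (f x))\<^sup>2) * indicator (C n) x) \<in> borel_measurable lebesgue" for n
    proof -
      have "C n \<in> sets lebesgue" by (simp add: C_def)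
      then show ?thesis using fm by measurable
    qed
  qed auto
  also have "\<dots> = l2_sq (cell_norm l f)"
    unfolding l2_sq_def
  proof (rule nn_integral_cong)
    fix n :: int
    define I where "I = integral {0..l} (\<lambda>x. (norm (f (x + of_int n * l)))\<^sup>2)"
    have F: "L2_on (of_int n * l) (of_int (n + 1) * l) f" using f by (simp add: L2_local_def)
    have I: "I = integral {of_int n * l..of_int (n + 1) * l} (\<lambda>x. (norm (f x))\<^sup>2)"
      using integral_shift_real_ivl[of "of_int n * l" "of_int n * l" "of_int (n + 1) * l" "\<lambda>x. (norm (f x))\<^sup>2"]
      unfolding I_def by (simp add: algebra_simps)
    then have "((\<lambda>x. (norm (f x))\<^sup>2) has_integral I) {of_int n * l..of_int (n + 1) * l}"
      using F by (simp add: L2_on_def integrable_integral)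
    then have "((\<lambda>x. (norm (f x))\<^sup>2) has_integral I) (C n)"
      by (rule has_integral_spike_set_eq[THEN iffD1, rotated 2])
        (rule negligible_subset[of "{of_int (n + 1) * l}"], simp, force simp: C_def)+
    from nn_integral_has_integral_lebesgue'[OF _ this]
    have "(\<integral>\<^sup>+x. ennreal ((norm (f x))\<^sup>2) * indicator (C n) x \<partial>lebesgue) = ennreal I"
      by (simp add: nn_integral_completion)
    moreover have "I \<ge> 0"
      unfolding I using F by (intro integral_nonneg) (auto simp: L2_on_def)
    ultimately show "(\<integral>\<^sup>+x. ennreal ((norm (f x))\<^sup>2) * indicator (C n) x \<partial>lebesgue) = ennreal ((norm (cell_norm l f n))\<^sup>2)"
      by (simp add: cell_norm_def I_def)
  qed
  finally show ?thesis .
qed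

lemma has_ac_derivative_L2_local: "has_ac_derivative f f' \<Longrightarrow> L2_local f"
proof -
  assume f: "has_ac_derivative f f'"
  have c: "continuous_on {a..b} f" for a b
    using f ac_on_continuous[of a b f f'] by (cases "a \<le> b") (auto simp: has_ac_derivative_iff_ac_on)
  have "isCont f x" for x
    using c[of "x - 1" "x + 1"] by (auto intro: continuous_on_interior)
  then have "f \<in> borel_measurable lebesgue"
    using continuous_imp_measurable_on_sets_lebesgue[of UNIV f]
    by (simp add: continuous_at_imp_continuous_on lebesgue_on_UNIV_eq)
  then show "L2_local f" using c by (simp add: L2_local_def L2_on_continuous)
qed

lemma L2_sq_mono: "(\<And>x. norm (f x) \<le> norm (g x)) \<Longrightarrow> L2_sq f \<le> L2_sq g"
  unfolding L2_sq_def by (intro nn_integral_mono ennreal_leI power_mono) auto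

lemma L2_space_iff: "f \<in> L2_space \<longleftrightarrow> f \<in> borel_measurable lebesgue \<and> L2_sq f < \<infinity>"
proof -
  have "(\<lambda>x. (norm (f x))\<^sup>2) \<in> borel_measurable lebesgue" if "f \<in> borel_measurable lebesgue"
    using that by measurable
  then show ?thesis by (auto simp: L2_space_def L2_sq_def integrable_iff_bounded)
qed

lemma L2_space_L2_local:
  assumes "f \<in> L2_space"
  shows "L2_local f"
proof -
  have m: "f \<in> borel_measurable lebesgue" and i: "integrable lebesgue (\<lambda>x. (norm (f x))\<^sup>2)"
    using assms by (auto simp: L2_space_def)
  have "(\<lambda>x. (norm (f x))\<^sup>2) integrable_on {a..b}" for a b
    by (rule integrable_on_subinterval[OF integrable_on_lebesgue[OF i]]) auto
  then show ?thesis using m by (auto simp: L2_local_def L2_on_def intro: measurable_restrict_space1)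
qed

lemma L2_space_scale:
  assumes "y \<in> L2_space"
  shows "(\<lambda>x. z *s y x) \<in> L2_space"
proof -
  have "y \<in> borel_measurable lebesgue" using assms by (simp add: L2_space_def)
  then have "(\<lambda>x. z *s y x) \<in> borel_measurable lebesgue"
    by (rule measurable_compose)
      (intro borel_measurable_continuous_onI linear_continuous_on
        bounded_bilinear.bounded_linear_right[OF bounded_bilinear_vector_scalar_mult])
  then show ?thesis using assms by (simp add: L2_space_def norm_vector_scalar_mult power_mult_distrib)
qed

lemma L2_space_add:
  assumes "f \<in> L2_space" "g \<in> L2_space"
  shows "(\<lambda>x. f x + g x) \<in> L2_space"
proof -
  have m: "f \<in> borel_measurable lebesgue" "g \<in> borel_measurable lebesgue"
    using assms by (auto simp: L2_space_def)
  then have m': "(\<lambda>x. (norm (f x + g x))\<^sup>2) \<in> borel_measurable lebesgue" by measurable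
  have "integrable lebesgue (\<lambda>x. 2 * (norm (f x))\<^sup>2 + 2 * (norm (g x))\<^sup>2)"
    using assms by (auto simp: L2_space_def)
  then have "integrable lebesgue (\<lambda>x. (norm (f x + g x))\<^sup>2)"
    by (rule Bochner_Integration.integrable_bound[OF _ m']) (simp add: norm_add_power2_le)
  then show ?thesis using m by (simp add: L2_space_def)
qed

lemma L2_space_norm_eq: "f \<in> L2_space \<Longrightarrow> L2_space_norm f = sqrt (enn2real (L2_sq f))"
  unfolding L2_space_norm_def L2_sq_def L2_space_def
  by (subst integral_eq_nn_integral) auto

lemma has_ac_derivative_cong_AE:
  assumes f: "has_ac_derivative f f'" and ae: "AE x in lebesgue. f' x = g' x"
  shows "has_ac_derivative f g'"
proof -
  obtain N where N: "N \<in> null_sets lebesgue" "\<And>x. x \<notin> N \<Longrightarrow> f' x = g' x"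
    using ae unfolding completion.AE_iff_null_sets by auto
  then have neg: "negligible N" by (simp add: negligible_iff_null_sets)
  show ?thesis
    unfolding has_ac_derivative_iff_ac_on
  proof (intro allI impI ac_onI)
    fix a b x :: real assume "a \<le> b"
    then have ab: "ac_on a b f f'" using f by (simp add: has_ac_derivative_iff_ac_on)
    show "g' absolutely_integrable_on {a..b}"
      by (rule absolutely_integrable_spike[OF ac_on_integrable[OF ab] neg]) (use N in auto)
    assume x: "a \<le> x" "x \<le> b"
    have "integral {a..x} f' = integral {a..x} g'"
      by (rule integral_spike[OF neg]) (use N in auto)
    then show "f x - f a = integral {a..x} g'" using ac_on_increment[OF ab order_refl x] by simp
  qed
qed

lemma has_ac_derivative_linear:
  assumes "has_ac_derivative f f'" "bounded_linear L"
  shows "has_ac_derivative (\<lambda>x. L (f x)) (\<lambda>x. L (f' x))"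
  using assms ac_on_linear[OF _ assms(2)] by (auto simp: has_ac_derivative_iff_ac_on)

section \<open>Hyperbolic periodic systems on the line\<close>

lemma periodic_shift:
  fixes f :: "real \<Rightarrow> 'a"
  assumes "\<And>x. f (x + l) = f x"
  shows "f (x + of_int n * l) = f x"
proof -
  have p: "f (x + of_nat k * l) = f x" for k x
  proof (induction k)
    case (Suc k)
    have "f (x + of_nat (Suc k) * l) = f ((x + of_nat k * l) + l)" by (simp add: algebra_simps)
    then show ?case using assms Suc by simp
  qed simp
  show ?thesis
  proof (cases n)
    case (nonneg k)
    then show ?thesis using p[of x k] by simp
  next
    case (neg k)
    have "x + of_int n * l + of_nat (Suc k) * l = x" unfolding neg by (simp add: algebra_simps)
    then show ?thesis using p[of "x + of_int n * l" "Suc k"] by (simp only:)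
  qed
qed

lemma cell_solution:
  assumes "has_ac_derivative W (\<lambda>x. A x *v W x + F x)" "\<And>x. A (x + l) = A x" "l > 0"
  shows "ac_on 0 l (\<lambda>x. W (x + of_int n * l)) (\<lambda>x. A x *v W (x + of_int n * l) + F (x + of_int n * l))"
proof -
  have "ac_on (of_int n * l) (of_int n * l + l) W (\<lambda>x. A x *v W x + F x)"
    using assms(1,3) by (simp add: has_ac_derivative_iff_ac_on)
  from ac_on_shift[OF this, of "of_int n * l"] show ?thesis
    by (simp add: periodic_shift[of A, OF assms(2)])
qed

text \<open>
  At the period points the a priori bound for the recurrence applies; within a period the
  solution is controlled by its initial value and the right-hand side.
\<close>

lemma periodic_system_bound:
  fixes A :: "real \<Rightarrow> complex ^ 'n::finite ^ 'n"
  assumes A: "L2_on 0 l A" "\<And>x. A (x + l) = A x" and l: "l > 0"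
    and M: "\<And>W. ac_on 0 l W (\<lambda>x. A x *v W x) \<Longrightarrow> W l = M *v W 0"
    and mult: "\<And>\<mu>. matrix_eigenvalue M \<mu> \<Longrightarrow> norm \<mu> \<noteq> 1"
  obtains C :: real where
    "\<And>F W. L2_local F \<Longrightarrow> has_ac_derivative W (\<lambda>x. A x *v W x + F x) \<Longrightarrow> l2_sq (\<lambda>n. W (of_int n * l)) < \<infinity>
       \<Longrightarrow> L2_sq W \<le> ennreal C * L2_sq F"
proof -
  obtain C1 where C1: "C1 > 0"
    "\<And>F W x. L2_on 0 l F \<Longrightarrow> ac_on 0 l W (\<lambda>x. A x *v W x + F x) \<Longrightarrow> 0 \<le> x \<Longrightarrow> x \<le> l
      \<Longrightarrow> norm (W x) \<le> C1 * (norm (W 0) + sqrt (integral {0..l} (\<lambda>x. (norm (F x))\<^sup>2)))"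
    using linear_ode_bound[OF A(1) l] by blast
  obtain C2 where C2: "C2 \<ge> 0" "\<And>w. l2_sq w < \<infinity> \<Longrightarrow> l2_sq w \<le> ennreal C2 * l2_sq (\<lambda>n. w (n + 1) - M *v w n)"
    using recurrence_bound[of M] mult by metis
  define C where "C = (sqrt l * C1)\<^sup>2 * (2 * (C2 * C1\<^sup>2) + 2)"
  show ?thesis
  proof (rule that)
    fix F W
    assume F: "L2_local F" and W: "has_ac_derivative W (\<lambda>x. A x *v W x + F x)" and fin: "l2_sq (\<lambda>n. W (of_int n * l)) < \<infinity>"
    define w where "w n = W (of_int n * l)" for n :: int
    note cell = cell_solution[OF W A(2) l]
    have Fn: "L2_on 0 l (\<lambda>x. F (x + of_int n * l))" for n :: int by (rule L2_on_shift[OF F])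
    have g: "norm (w (n + 1) - M *v w n) \<le> C1 * norm (cell_norm l F n)" for n
    proof -
      obtain S where S: "ac_on 0 l S (\<lambda>x. A x *v S x)" "S 0 = w n"
        using linear_ode_exists[OF A(1) l, of "\<lambda>_. 0" "w n"] by auto
      have "ac_on 0 l (\<lambda>x. W (x + of_int n * l) - S x) (\<lambda>x. A x *v (W (x + of_int n * l) - S x) + F (x + of_int n * l))"
        using ac_on_diff[OF cell[of n] S(1)] by (simp add: matrix_vector_mult_diff_distrib algebra_simps)
      from C1(2)[OF Fn this, of l] l
      have "norm (W (l + of_int n * l) - S l) \<le> C1 * cell_norm l F n"
        by (simp add: cell_norm_def S(2) w_def)
      also have "\<dots> \<le> C1 * norm (cell_norm l F n)" using C1(1) by (intro mult_left_mono) auto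
      finally show ?thesis using M[OF S(1)] S(2) by (simp add: w_def algebra_simps)
    qed
    have "l2_sq w \<le> ennreal C2 * l2_sq (\<lambda>n. w (n + 1) - M *v w n)"
      by (rule C2(2)) (use fin in \<open>simp add: w_def[abs_def]\<close>)
    also have "\<dots> \<le> ennreal C2 * (ennreal (C1\<^sup>2) * L2_sq F)"
      unfolding L2_sq_cells[OF F l] by (intro mult_left_mono l2_sq_scale_le g) auto
    finally have wF: "l2_sq w \<le> ennreal C2 * (ennreal (C1\<^sup>2) * L2_sq F)" .
    have "norm (cell_norm l W n) \<le> (sqrt l * C1) * norm (norm (w n) + norm (cell_norm l F n))" for n
    proof -
      define b where "b = C1 * (norm (w n) + norm (cell_norm l F n))"
      have b0: "b \<ge> 0" using C1(1) by (simp add: b_def)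
      have Wx: "norm (W (x + of_int n * l)) \<le> b" if "x \<in> {0..l}" for x
        using C1(2)[OF Fn cell[of n], of x] that C1(1) unfolding b_def w_def cell_norm_def
        by (smt (verit) add_0 atLeastAtMost_iff mult_left_mono norm_ge_zero real_norm_def)
      have "continuous_on {0..l} (\<lambda>x. W (x + of_int n * l))" by (rule ac_on_continuous[OF cell])
      then have "(\<lambda>x. (norm (W (x + of_int n * l)))\<^sup>2) integrable_on {0..l}"
        by (intro integrable_continuous_interval continuous_intros)
      then have "integral {0..l} (\<lambda>x. (norm (W (x + of_int n * l)))\<^sup>2) \<le> integral {0..l} (\<lambda>x. b\<^sup>2)"
        by (intro integral_le power_mono Wx) auto
      then have "(cell_norm l W n)\<^sup>2 \<le> l * b\<^sup>2"
        using l unfolding cell_norm_def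
        by (subst real_sqrt_pow2) (auto intro!: integral_nonneg \<open>(\<lambda>x. (norm (W (x + of_int n * l)))\<^sup>2) integrable_on {0..l}\<close>)
      also have "\<dots> = (sqrt l * b)\<^sup>2" using l by (simp add: power_mult_distrib)
      finally have "\<bar>cell_norm l W n\<bar> \<le> \<bar>sqrt l * b\<bar>" by (simp only: abs_le_square_iff)
      also have "\<dots> = sqrt l * b" using b0 l by simp
      finally have "\<bar>cell_norm l W n\<bar> \<le> sqrt l * b" .
      then show ?thesis by (simp add: b_def)
    qed
    then have "L2_sq W \<le> ennreal ((sqrt l * C1)\<^sup>2) * l2_sq (\<lambda>n. norm (w n) + norm (cell_norm l F n))"
      unfolding L2_sq_cells[OF has_ac_derivative_L2_local[OF W] l] by (rule l2_sq_scale_le)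
    also have "\<dots> \<le> ennreal ((sqrt l * C1)\<^sup>2) * (2 * l2_sq w + 2 * L2_sq F)"
      using l2_sq_add_le[of "\<lambda>n. norm (w n)" "\<lambda>n. norm (cell_norm l F n)"]
      unfolding L2_sq_cells[OF F l] by (intro mult_left_mono) (auto simp: l2_sq_def)
    also have "\<dots> \<le> ennreal ((sqrt l * C1)\<^sup>2) * (2 * (ennreal C2 * (ennreal (C1\<^sup>2) * L2_sq F)) + 2 * L2_sq F)"
      by (intro mult_left_mono add_mono wF) auto
    also have "\<dots> = ennreal C * L2_sq F"
      using C1(1) C2(1) by (simp add: C_def ennreal_mult ennreal_plus distrib_left distrib_right mult.assoc[symmetric])
    finally show "L2_sq W \<le> ennreal C * L2_sq F" .
  qed
qed

text \<open>
  Solve on each period with initial value \<open>0\<close>; the end values are the inhomogeneity \<open>g\<close> of the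
  recurrence. Restarting from its solution \<open>w\<close> makes the pieces fit together.
\<close>

lemma periodic_system_exists:
  fixes A :: "real \<Rightarrow> complex ^ 'n::finite ^ 'n"
  assumes A: "L2_on 0 l A" "\<And>x. A (x + l) = A x" and l: "l > 0"
    and M: "\<And>W. ac_on 0 l W (\<lambda>x. A x *v W x) \<Longrightarrow> W l = M *v W 0"
    and mult: "\<And>\<mu>. matrix_eigenvalue M \<mu> \<Longrightarrow> norm \<mu> \<noteq> 1"
    and F: "L2_local F" "L2_sq F < \<infinity>"
  shows "\<exists>W. has_ac_derivative W (\<lambda>x. A x *v W x + F x) \<and> l2_sq (\<lambda>n. W (of_int n * l)) < \<infinity>"
proof -
  obtain C1 where C1: "C1 > 0"
    "\<And>F W x. L2_on 0 l F \<Longrightarrow> ac_on 0 l W (\<lambda>x. A x *v W x + F x) \<Longrightarrow> 0 \<le> x \<Longrightarrow> x \<le> l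
      \<Longrightarrow> norm (W x) \<le> C1 * (norm (W 0) + sqrt (integral {0..l} (\<lambda>x. (norm (F x))\<^sup>2)))"
    using linear_ode_bound[OF A(1) l] by blast
  obtain C2 :: real where C2: "C2 \<ge> 0"
    "\<And>g. l2_sq g < \<infinity> \<Longrightarrow> \<exists>w. (\<forall>n. w (n + 1) = M *v w n + g n) \<and> l2_sq w \<le> ennreal C2 * l2_sq g"
    using recurrence_exists[of M] mult by metis
  have Fn: "L2_on 0 l (\<lambda>x. F (x + of_int n * l))" for n :: int by (rule L2_on_shift[OF F(1)])
  have sol: "\<exists>V. ac_on 0 l V (\<lambda>x. A x *v V x + F (x + of_int n * l)) \<and> V 0 = v" for n :: int and v
    using linear_ode_exists[OF A(1) l L2_on_imp_integrable[OF Fn]] .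
  have "\<forall>n :: int. \<exists>V. ac_on 0 l V (\<lambda>x. A x *v V x + F (x + of_int n * l)) \<and> V 0 = 0"
    using sol by blast
  from choice[OF this] obtain V where V: "\<And>n :: int. ac_on 0 l (V n) (\<lambda>x. A x *v V n x + F (x + of_int n * l))" "\<And>n. V n 0 = 0"
    by blast
  have "norm (V n l) \<le> C1 * norm (cell_norm l F n)" for n
  proof -
    have "norm (V n l) \<le> C1 * cell_norm l F n"
      using C1(2)[OF Fn V(1), of l n] l V(2)[of n] by (simp add: cell_norm_def)
    also have "\<dots> \<le> C1 * norm (cell_norm l F n)" using C1(1) by (intro mult_left_mono) auto
    finally show ?thesis .
  qed
  then have gf: "l2_sq (\<lambda>n. V n l) < \<infinity>"
    by (rule l2_sq_finite_scale) (use F(2) in \<open>simp add: L2_sq_cells[OF F(1) l]\<close>)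
  obtain w where w: "\<And>n. w (n + 1) = M *v w n + V n l" "l2_sq w \<le> ennreal C2 * l2_sq (\<lambda>n. V n l)"
    using C2(2)[OF gf] by blast
  have wf: "l2_sq w < \<infinity>"
    by (rule le_less_trans[OF w(2)]) (use gf in \<open>auto simp: ennreal_mult_less_top\<close>)
  have "\<forall>n :: int. \<exists>V. ac_on 0 l V (\<lambda>x. A x *v V x + F (x + of_int n * l)) \<and> V 0 = w n"
    using sol by blast
  from choice[OF this] obtain Wn where Wn: "\<And>n :: int. ac_on 0 l (Wn n) (\<lambda>x. A x *v Wn n x + F (x + of_int n * l))" "\<And>n. Wn n 0 = w n"
    by blast
  have Wl: "Wn n l = w (n + 1)" for n
  proof -
    have "ac_on 0 l (\<lambda>x. Wn n x - V n x) (\<lambda>x. A x *v (Wn n x - V n x))"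
      using ac_on_diff[OF Wn(1)[of n] V(1)[of n]] by (simp add: matrix_vector_mult_diff_distrib)
    from M[OF this] show ?thesis using w(1)[of n] by (simp add: Wn(2) V(2) algebra_simps)
  qed
  define W where "W x = Wn \<lfloor>x / l\<rfloor> (x - of_int \<lfloor>x / l\<rfloor> * l)" for x
  have W: "W x = Wn n (x - of_int n * l)" if x: "x \<in> {of_int n * l..of_int (n + 1) * l}" for x n
  \<comment> \<open>The right end of a cell belongs to the next one; there \<open>w (n + 1)\<close> is the common value.\<close>
  proof (cases "x = of_int (n + 1) * l")
    case True
    then have "x / l = of_int (n + 1)" using l by simp
    then have "\<lfloor>x / l\<rfloor> = n + 1" by (metis floor_of_int)
    then have "W x = w (n + 1)" unfolding W_def using True Wn(2) by simp
    moreover have "x - of_int n * l = l" using True by (simp add: algebra_simps)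
    ultimately show ?thesis using Wl by simp
  next
    case False
    then have "of_int n \<le> x / l" "x / l < of_int n + 1" using x l by (auto simp: field_simps)
    then have "\<lfloor>x / l\<rfloor> = n" by (rule floor_unique)
    then show ?thesis by (simp add: W_def)
  qed
  have "has_ac_derivative W (\<lambda>x. A x *v W x + F x)"
  proof (rule has_ac_derivative_from_cells[OF l])
    fix n :: int
    have As: "A (x - of_int n * l) = A x" for x
      using periodic_shift[of A l x "- n", OF A(2)] by simp
    from ac_on_shift[OF Wn(1)[of n], of "- of_int n * l"]
    have "ac_on (of_int n * l) (l + of_int n * l) (\<lambda>x. Wn n (x - of_int n * l))
        (\<lambda>x. A x *v Wn n (x - of_int n * l) + F x)"
      by (simp add: As)
    then have *: "ac_on (of_int n * l) (of_int (n + 1) * l) (\<lambda>x. Wn n (x - of_int n * l))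
        (\<lambda>x. A x *v Wn n (x - of_int n * l) + F x)"
      by (simp add: algebra_simps)
    show "ac_on (of_int n * l) (of_int (n + 1) * l) W (\<lambda>x. A x *v W x + F x)"
      by (rule ac_on_cong[OF *]) (simp_all only: W)
  qed
  moreover have "W (of_int n * l) = w n" for n
    using W[of "of_int n * l" n] l Wn(2) by (simp add: mult_right_mono)
  ultimately show ?thesis using wf by (intro exI[of _ W]) simp
qed

section \<open>Block vectors and the companion matrix\<close>

definition vjoin :: "complex ^ 'm::finite \<Rightarrow> complex ^ 'm \<Rightarrow> complex ^ ('m + 'm)" where
  "vjoin a b = (\<chi> k. case k of Inl i \<Rightarrow> a $ i | Inr i \<Rightarrow> b $ i)"

definition vleft :: "complex ^ ('m::finite + 'm) \<Rightarrow> complex ^ 'm" where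
  "vleft v = (\<chi> i. v $ Inl i)"

definition vright :: "complex ^ ('m::finite + 'm) \<Rightarrow> complex ^ 'm" where
  "vright v = (\<chi> i. v $ Inr i)"

text \<open>
  The coefficient matrix of the first-order system for \<open>y'' = B y\<close> in the unknown \<open>(y, y')\<close>.
\<close>

definition companion :: "complex ^ 'm ^ 'm::finite \<Rightarrow> complex ^ ('m + 'm) ^ ('m + 'm)" where
  "companion B = (\<chi> k. case k of Inl i \<Rightarrow> vjoin 0 (axis i 1) | Inr i \<Rightarrow> vjoin (B $ i) 0)"

lemma vjoin_nth [simp]: "vjoin a b $ Inl i = a $ i" "vjoin a b $ Inr i = b $ i"
  by (simp_all add: vjoin_def)

lemma vleft_vjoin [simp]: "vleft (vjoin a b) = a" and vright_vjoin [simp]: "vright (vjoin a b) = b"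
  by (simp_all add: vleft_def vright_def vec_eq_iff)

lemma vjoin_vleft_vright [simp]: "vjoin (vleft v) (vright v) = v"
  unfolding vec_eq_iff
proof
  fix k
  show "vjoin (vleft v) (vright v) $ k = v $ k"
    by (cases k) (simp_all add: vleft_def vright_def)
qed

lemma vec_eq_sum_iff: "v = w \<longleftrightarrow> vleft v = vleft w \<and> vright v = vright w"
  by (metis vjoin_vleft_vright)

lemma vleft_simps [simp]: "vleft (v + w) = vleft v + vleft w" "vleft (c *s v) = c *s vleft v" "vleft 0 = 0"
    "vleft (r *\<^sub>R v) = r *\<^sub>R vleft v"
  and vright_simps [simp]: "vright (v + w) = vright v + vright w" "vright (c *s v) = c *s vright v" "vright 0 = 0"
    "vright (r *\<^sub>R v) = r *\<^sub>R vright v"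
  by (simp_all add: vleft_def vright_def vec_eq_iff)

lemma vjoin_add: "vjoin a b + vjoin c d = vjoin (a + c) (b + d)"
  by (simp add: vec_eq_sum_iff)

lemma bounded_linear_vleft: "bounded_linear vleft" and bounded_linear_vright: "bounded_linear vright"
  by (auto intro!: linearI simp flip: linear_conv_bounded_linear)

lemma bounded_linear_vjoin_left: "bounded_linear (\<lambda>a. vjoin a 0)"
  and bounded_linear_vjoin_right: "bounded_linear (\<lambda>b. vjoin 0 b)"
  by (auto intro!: linearI simp: vec_eq_sum_iff simp flip: linear_conv_bounded_linear)

lemma norm_vjoin: "(norm (vjoin a b))\<^sup>2 = (norm a)\<^sup>2 + (norm b)\<^sup>2"
proof -
  have "(norm (vjoin a b))\<^sup>2 = (\<Sum>k\<in>UNIV <+> UNIV. (norm (vjoin a b $ k))\<^sup>2)"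
    by (simp add: norm_vec_def L2_set_def sum_nonneg)
  also have "\<dots> = (\<Sum>i\<in>UNIV. (norm (a $ i))\<^sup>2) + (\<Sum>i\<in>UNIV. (norm (b $ i))\<^sup>2)"
    by (subst sum.Plus) auto
  finally show ?thesis by (simp add: norm_vec_def L2_set_def sum_nonneg)
qed

lemma norm_vleft_le: "norm (vleft v) \<le> norm v"
proof -
  have "(norm (vleft v))\<^sup>2 \<le> (norm v)\<^sup>2"
    using norm_vjoin[of "vleft v" "vright v"] by simp
  then show ?thesis by (rule power2_le_imp_le) simp
qed

lemma companion_mult:
  fixes B :: "complex ^ 'm ^ 'm::finite"
  shows "companion B *v vjoin a b = vjoin b (B *v a)"
proof -
  have s: "(\<Sum>k\<in>UNIV. f k) = (\<Sum>i\<in>UNIV. f (Inl i)) + (\<Sum>i\<in>UNIV. f (Inr i))" for f :: "'m + 'm \<Rightarrow> complex"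
    using sum.Plus[of "UNIV :: 'm set" "UNIV :: 'm set" f] by (simp add: o_def)
  show ?thesis
    unfolding vec_eq_sum_iff
    by (simp add: vleft_def vright_def vec_eq_iff matrix_vector_mult_def companion_def s axis_def if_distrib
        if_distribR cong: if_cong)
qed

lemma mat_vector_mult: "mat c *v v = c *s (v :: complex ^ 'm::finite)"
  by (simp add: vec_eq_iff mat_def matrix_vector_mult_def if_distrib if_distribR cong: if_cong)

lemma companion_L2_on:
  fixes B :: "real \<Rightarrow> complex ^ 'm ^ 'm::finite"
  assumes "L2_on a b B"
  shows "L2_on a b (\<lambda>x. companion (B x))"
proof -
  define K :: "complex ^ 'm ^ 'm \<Rightarrow> complex ^ ('m + 'm) ^ ('m + 'm)"
    where "K B = (\<chi> k. case k of Inl i \<Rightarrow> 0 | Inr i \<Rightarrow> vjoin (B $ i) 0)" for B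
  have K: "companion B = companion 0 + K B" for B :: "complex ^ 'm ^ 'm"
  proof -
    have "companion B $ k = (companion 0 + K B) $ k" for k
      by (cases k) (simp_all add: companion_def K_def vjoin_add)
    then show ?thesis by (simp add: vec_eq_iff)
  qed
  have "bounded_linear K"
    unfolding linear_conv_bounded_linear[symmetric]
  proof (rule linearI)
    fix B C :: "complex ^ 'm ^ 'm" and r :: real
    have "K (B + C) $ k = (K B + K C) $ k" for k
      by (cases k) (simp_all add: K_def vjoin_add)
    then show "K (B + C) = K B + K C" by (simp add: vec_eq_iff)
    have "K (r *\<^sub>R B) $ k = (r *\<^sub>R K B) $ k" for k
      by (cases k) (simp_all add: K_def vec_eq_sum_iff)
    then show "K (r *\<^sub>R B) = r *\<^sub>R K B" by (simp add: vec_eq_iff)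
  qed
  then have "L2_on a b (\<lambda>x. companion 0 + K (B x))"
    by (intro L2_on_add L2_on_linear[OF assms] L2_on_continuous continuous_intros)
  then show ?thesis by (simp only: K[symmetric])
qed

lemma companion_system_iff:
  "has_ac_derivative W (\<lambda>x. companion (B x) *v W x + vjoin 0 (f x)) \<longleftrightarrow>
   has_ac_derivative (\<lambda>x. vleft (W x)) (\<lambda>x. vright (W x)) \<and>
   has_ac_derivative (\<lambda>x. vright (W x)) (\<lambda>x. B x *v vleft (W x) + f x)"
proof -
  have e: "companion (B x) *v W x + vjoin 0 (f x) = vjoin (vright (W x)) (B x *v vleft (W x) + f x)" for x
    using companion_mult[of "B x" "vleft (W x)" "vright (W x)"] by (simp add: vjoin_add)
  show ?thesis
    unfolding e
  proof (intro iffI conjI)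
    assume W: "has_ac_derivative W (\<lambda>x. vjoin (vright (W x)) (B x *v vleft (W x) + f x))"
    show "has_ac_derivative (\<lambda>x. vleft (W x)) (\<lambda>x. vright (W x))"
      using has_ac_derivative_linear[OF W bounded_linear_vleft] by simp
    show "has_ac_derivative (\<lambda>x. vright (W x)) (\<lambda>x. B x *v vleft (W x) + f x)"
      using has_ac_derivative_linear[OF W bounded_linear_vright] by simp
  next
    assume *: "has_ac_derivative (\<lambda>x. vleft (W x)) (\<lambda>x. vright (W x)) \<and>
      has_ac_derivative (\<lambda>x. vright (W x)) (\<lambda>x. B x *v vleft (W x) + f x)"
    have "has_ac_derivative (\<lambda>x. vjoin (vleft (W x)) 0 + vjoin 0 (vright (W x)))
       (\<lambda>x. vjoin (vright (W x)) 0 + vjoin 0 (B x *v vleft (W x) + f x))"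
      using has_ac_derivative_linear[OF conjunct1[OF *] bounded_linear_vjoin_left]
        has_ac_derivative_linear[OF conjunct2[OF *] bounded_linear_vjoin_right]
      by (auto simp: has_ac_derivative_iff_ac_on intro!: ac_on_add)
    then show "has_ac_derivative W (\<lambda>x. vjoin (vright (W x)) (B x *v vleft (W x) + f x))"
      by (simp add: vjoin_add)
  qed
qed

section \<open>Values of square integrable solutions at the period points\<close>

text \<open>
  The functions \<open>1\<close> and \<open>x\<close> are linearly independent on the interval. The explicit constants come from
  the square \<open>|7 a + 4 l b|\<^sup>2 \<ge> 0\<close>, which bounds the mixed term \<open>l\<^sup>2 a \<bullet> b\<close> from below.
\<close>

lemma affine_L2_lower_bound:
  fixes a b :: "'a::euclidean_space"
  assumes l: "l > 0"
  shows "l / 8 * (norm a)\<^sup>2 + l ^ 3 / 21 * (norm b)\<^sup>2 \<le> integral {0..l} (\<lambda>x. (norm (a + x *\<^sub>R b))\<^sup>2)"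
proof -
  have e: "(norm (a + x *\<^sub>R b))\<^sup>2 = (norm a)\<^sup>2 + 2 * x * (a \<bullet> b) + x\<^sup>2 * (norm b)\<^sup>2" for x
    unfolding power2_norm_eq_inner by (simp add: inner_add inner_commute power2_eq_square algebra_simps)
  have "((\<lambda>x. (norm a)\<^sup>2 + 2 * x * (a \<bullet> b) + x\<^sup>2 * (norm b)\<^sup>2) has_integral
      ((norm a)\<^sup>2 * l + l\<^sup>2 * (a \<bullet> b) + l ^ 3 / 3 * (norm b)\<^sup>2) - ((norm a)\<^sup>2 * 0 + 0\<^sup>2 * (a \<bullet> b) + 0 ^ 3 / 3 * (norm b)\<^sup>2)) {0..l}"
    by (rule fundamental_theorem_of_calculus)
      (use l in \<open>auto intro!: derivative_eq_intros simp flip: has_real_derivative_iff_has_vector_derivative\<close>)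
  then have I: "integral {0..l} (\<lambda>x. (norm (a + x *\<^sub>R b))\<^sup>2) = (norm a)\<^sup>2 * l + l\<^sup>2 * (a \<bullet> b) + l ^ 3 / 3 * (norm b)\<^sup>2"
    unfolding e by (simp add: integral_unique)
  have "0 \<le> (norm ((7::real) *\<^sub>R a + (4 * l) *\<^sub>R b))\<^sup>2 * (l / 56)" using l by simp
  also have "\<dots> = 7 * l / 8 * (norm a)\<^sup>2 + l\<^sup>2 * (a \<bullet> b) + 2 * l ^ 3 / 7 * (norm b)\<^sup>2"
    unfolding power2_norm_eq_inner
    by (simp add: inner_add inner_commute power2_eq_square power3_eq_cube algebra_simps)
  finally show ?thesis unfolding I by (simp add: algebra_simps)
qed

text \<open>
  By the Cauchy-Schwarz inequality \<open>y'' = Q y - g\<close> is bounded in \<open>L\<^sup>1\<close> by the \<open>L\<^sup>2\<close> norms of \<open>y\<close> and \<open>g\<close>, so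
  \<open>y\<close> differs little from its tangent line at \<open>0\<close>, whose coefficients are controlled by its
  \<open>L\<^sup>2\<close> norm.
\<close>

lemma initial_data_bound:
  fixes Q :: "real \<Rightarrow> complex ^ 'm::finite ^ 'm"
  assumes Q: "L2_on 0 l Q" and l: "l > 0"
  obtains C where "C > 0"
    "\<And>y y' g. ac_on 0 l y y' \<Longrightarrow> ac_on 0 l y' (\<lambda>x. Q x *v y x - g x) \<Longrightarrow> L2_on 0 l g \<Longrightarrow>
      (norm (y 0))\<^sup>2 + (norm (y' 0))\<^sup>2 \<le> C * (integral {0..l} (\<lambda>x. (norm (y x))\<^sup>2) + integral {0..l} (\<lambda>x. (norm (g x))\<^sup>2))"
proof -
  define h where "h = integral {0..l} (\<lambda>x. (norm (Q x))\<^sup>2)"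
  have h: "h \<ge> 0" unfolding h_def using Q by (intro integral_nonneg) (auto simp: L2_on_def)
  define c where "c = min (l / 8) (l ^ 3 / 21)"
  have c: "c > 0" using l by (simp add: c_def)
  define D where "D = 2 + 4 * l ^ 3 * (h + l)"
  have D: "D > 0" unfolding D_def using l h by (simp add: add_pos_nonneg)
  show ?thesis
  proof (rule that[of "2 * D / c"])
    show "2 * D / c > 0" using c D by simp
    fix y y' g
    assume y: "ac_on 0 l y y'" and y': "ac_on 0 l y' (\<lambda>x. Q x *v y x - g x)" and g: "L2_on 0 l g"
    define Y where "Y = integral {0..l} (\<lambda>x. (norm (y x))\<^sup>2)"
    define G where "G = integral {0..l} (\<lambda>x. (norm (g x))\<^sup>2)"
    have y2: "L2_on 0 l y" by (rule L2_on_continuous[OF ac_on_continuous[OF y]])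
    have Yi: "(\<lambda>x. (norm (y x))\<^sup>2) integrable_on {0..l}" using y2 by (simp add: L2_on_def)
    have Y: "Y \<ge> 0" unfolding Y_def using Yi by (intro integral_nonneg) auto
    have G: "G \<ge> 0" unfolding G_def using g by (intro integral_nonneg) (auto simp: L2_on_def)
    define v1 where "v1 = integral {0..l} (\<lambda>x. norm (Q x) * norm (y x))"
    define v2 where "v2 = integral {0..l} (\<lambda>x. norm (g x))"
    have i1: "(\<lambda>x. norm (Q x) * norm (y x)) integrable_on {0..l}"
      using L2_on_product_integrable[OF bilinear_times L2_on_norm[OF Q] L2_on_norm[OF y2]]
      by (simp add: absolutely_integrable_on_def)
    have i2: "(\<lambda>x. norm (g x)) integrable_on {0..l}"
      using L2_on_imp_integrable[OF g] by (simp add: absolutely_integrable_on_def)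
    have v: "v1 \<ge> 0" "v2 \<ge> 0" unfolding v1_def v2_def by (intro integral_nonneg i1 i2; simp)+
    have "v1\<^sup>2 \<le> h * Y" unfolding v1_def h_def Y_def by (rule Cauchy_Schwarz_L2_on[OF Q y2])
    moreover have "v2\<^sup>2 \<le> l * G" unfolding v2_def G_def using L2_on_integral_norm_le[OF g] l by simp
    moreover have "(v1 + v2)\<^sup>2 \<le> 2 * v1\<^sup>2 + 2 * v2\<^sup>2"
      using norm_add_power2_le[of v1 v2] by simp
    moreover have "h * Y \<le> (h + l) * (Y + G)" "l * G \<le> (h + l) * (Y + G)"
      using h l Y G by (auto intro!: mult_mono)
    ultimately have v12: "(v1 + v2)\<^sup>2 \<le> 4 * ((h + l) * (Y + G))" by linarith
    have y'x: "norm (y' x - y' 0) \<le> v1 + v2" if x: "x \<in> {0..l}" for x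
    proof -
      have ix: "(\<lambda>x. norm (Q x) * norm (y x)) integrable_on {0..x}" "(\<lambda>x. norm (g x)) integrable_on {0..x}"
        using x by (auto intro: integrable_on_subinterval[OF i1] integrable_on_subinterval[OF i2])
      have "norm (y' x - y' 0) \<le> integral {0..x} (\<lambda>x. norm (Q x) * norm (y x) + norm (g x))"
      proof (rule ac_on_norm_increment_le[OF y'])
        show "(\<lambda>x. norm (Q x) * norm (y x) + norm (g x)) integrable_on {0..x}" by (intro integrable_add ix)
        show "norm (Q s *v y s - g s) \<le> norm (Q s) * norm (y s) + norm (g s)" for s
          using norm_triangle_ineq4[of "Q s *v y s" "g s"] norm_matrix_vector_mult_le[of "Q s" "y s"] by linarith
      qed (use x in auto)
      also have "\<dots> = integral {0..x} (\<lambda>x. norm (Q x) * norm (y x)) + integral {0..x} (\<lambda>x. norm (g x))"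
        by (rule Henstock_Kurzweil_Integration.integral_add[OF ix])
      also have "\<dots> \<le> v1 + v2"
        unfolding v1_def v2_def by (intro add_mono integral_subset_le ix i1 i2) (use x in auto)
      finally show ?thesis .
    qed
    have yx: "norm (y x - (y 0 + x *\<^sub>R y' 0)) \<le> l * (v1 + v2)" if x: "x \<in> {0..l}" for x
    proof -
      have "ac_on 0 l (\<lambda>x. x *\<^sub>R y' 0) (\<lambda>_. y' 0)"
      proof (rule ac_onI)
        show "(\<lambda>_. y' 0) absolutely_integrable_on {0..l}" by (intro absolutely_integrable_continuous_real continuous_intros)
      qed (simp add: content_real)
      from ac_on_diff[OF y this]
      have "norm ((y x - x *\<^sub>R y' 0) - (y 0 - 0 *\<^sub>R y' 0)) \<le> integral {0..x} (\<lambda>_. v1 + v2)"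
        by (rule ac_on_norm_increment_le) (use x y'x in auto)
      also have "\<dots> = x * (v1 + v2)" using x by simp
      also have "\<dots> \<le> l * (v1 + v2)" using x v by (intro mult_right_mono) auto
      finally show ?thesis by (simp add: algebra_simps)
    qed
    have "integral {0..l} (\<lambda>x. (norm (y 0 + x *\<^sub>R y' 0))\<^sup>2) \<le> integral {0..l} (\<lambda>x. 2 * (norm (y x))\<^sup>2 + 2 * (l * (v1 + v2))\<^sup>2)"
    proof (rule integral_le)
      show "(\<lambda>x. (norm (y 0 + x *\<^sub>R y' 0))\<^sup>2) integrable_on {0..l}"
        by (intro integrable_continuous_interval continuous_intros)
      show "(\<lambda>x. 2 * (norm (y x))\<^sup>2 + 2 * (l * (v1 + v2))\<^sup>2) integrable_on {0..l}"
        using integrable_cmul[OF Yi, of 2] by (intro integrable_add) auto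
      fix x assume x: "x \<in> {0..l}"
      have "norm (y 0 + x *\<^sub>R y' 0) \<le> norm (y x) + norm (y x - (y 0 + x *\<^sub>R y' 0))"
        using norm_triangle_sub[of "y 0 + x *\<^sub>R y' 0" "y x"] by (simp add: norm_minus_commute)
      also have "\<dots> \<le> norm (y x) + l * (v1 + v2)" using yx[OF x] by simp
      finally have "(norm (y 0 + x *\<^sub>R y' 0))\<^sup>2 \<le> (norm (y x) + l * (v1 + v2))\<^sup>2"
        by (intro power_mono) auto
      also have "\<dots> \<le> 2 * (norm (y x))\<^sup>2 + 2 * (l * (v1 + v2))\<^sup>2"
        using norm_add_power2_le[of "norm (y x)" "l * (v1 + v2)"] by simp
      finally show "(norm (y 0 + x *\<^sub>R y' 0))\<^sup>2 \<le> 2 * (norm (y x))\<^sup>2 + 2 * (l * (v1 + v2))\<^sup>2" .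
    qed
    also have "\<dots> = 2 * Y + l * (2 * (l * (v1 + v2))\<^sup>2)"
      using integrable_cmul[OF Yi, of 2] l unfolding Y_def
      by (subst Henstock_Kurzweil_Integration.integral_add) auto
    also have "\<dots> = 2 * Y + 2 * l ^ 3 * (v1 + v2)\<^sup>2"
      by (simp add: power_mult_distrib power2_eq_square power3_eq_cube)
    also have "\<dots> \<le> 2 * Y + 2 * l ^ 3 * (4 * ((h + l) * (Y + G)))"
      using l by (intro add_left_mono mult_left_mono v12) auto
    also have "\<dots> \<le> 2 * (D * (Y + G))"
    proof -
      have "2 * Y \<le> 4 * (Y + G)" using Y G by simp
      then show ?thesis unfolding D_def by (simp add: algebra_simps)
    qed
    finally have up: "integral {0..l} (\<lambda>x. (norm (y 0 + x *\<^sub>R y' 0))\<^sup>2) \<le> 2 * (D * (Y + G))" .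
    have "c * ((norm (y 0))\<^sup>2 + (norm (y' 0))\<^sup>2) \<le> l / 8 * (norm (y 0))\<^sup>2 + l ^ 3 / 21 * (norm (y' 0))\<^sup>2"
      unfolding distrib_left by (intro add_mono mult_right_mono) (auto simp: c_def)
    also have "\<dots> \<le> 2 * (D * (Y + G))"
      using affine_L2_lower_bound[OF l, of "y 0" "y' 0"] up by linarith
    finally have "(norm (y 0))\<^sup>2 + (norm (y' 0))\<^sup>2 \<le> 2 * (D * (Y + G)) / c"
      using c by (simp add: pos_le_divide_eq mult.commute)
    then show "(norm (y 0))\<^sup>2 + (norm (y' 0))\<^sup>2 \<le> 2 * D / c *
        (integral {0..l} (\<lambda>x. (norm (y x))\<^sup>2) + integral {0..l} (\<lambda>x. (norm (g x))\<^sup>2))"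
      unfolding Y_def G_def by simp
  qed
qed

text \<open>
  The local estimate for the initial data, summed over the period cells.
\<close>

lemma schroedinger_initial_data_l2:
  fixes Q :: "real \<Rightarrow> complex ^ 'm::finite ^ 'm"
  assumes Q: "L2_on 0 l Q" "\<And>x. Q (x + l) = Q x" and l: "l > 0"
    and y: "has_ac_derivative y y'" "has_ac_derivative y' (\<lambda>x. Q x *v y x - g x)"
    and fin: "L2_sq y < \<infinity>" and g: "L2_local g" "L2_sq g < \<infinity>"
  shows "l2_sq (\<lambda>n. vjoin (y (of_int n * l)) (y' (of_int n * l))) < \<infinity>"
proof -
  obtain C where C: "C > 0"
    "\<And>y y' g. ac_on 0 l y y' \<Longrightarrow> ac_on 0 l y' (\<lambda>x. Q x *v y x - g x) \<Longrightarrow> L2_on 0 l g \<Longrightarrow>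
      (norm (y 0))\<^sup>2 + (norm (y' 0))\<^sup>2 \<le> C * (integral {0..l} (\<lambda>x. (norm (y x))\<^sup>2) + integral {0..l} (\<lambda>x. (norm (g x))\<^sup>2))"
    using initial_data_bound[OF Q(1) l] by blast
  have yl: "L2_local y" by (rule has_ac_derivative_L2_local[OF y(1)])
  have cell_sq: "integral {0..l} (\<lambda>x. (norm (f (x + of_int n * l)))\<^sup>2) = (cell_norm l f n)\<^sup>2" if "L2_local f" for f :: "real \<Rightarrow> complex ^ 'm" and n
    unfolding cell_norm_def
    by (subst real_sqrt_pow2) (use L2_on_shift[OF that, of 0 l "of_int n * l"] in \<open>auto intro!: integral_nonneg simp: L2_on_def\<close>)
  have "norm (vjoin (y (of_int n * l)) (y' (of_int n * l))) \<le> sqrt C * norm (norm (cell_norm l y n) + norm (cell_norm l g n))" for n :: int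
  proof -
    have shift: "ac_on 0 l (\<lambda>x. f (x + of_int n * l)) (\<lambda>x. f' (x + of_int n * l))" if "has_ac_derivative f f'" for f f' :: "real \<Rightarrow> complex ^ 'm"
    proof -
      have "ac_on (of_int n * l) (of_int n * l + l) f f'" using that l by (simp add: has_ac_derivative_iff_ac_on)
      from ac_on_shift[OF this, of "of_int n * l"] show ?thesis by simp
    qed
    have "(norm (y (0 + of_int n * l)))\<^sup>2 + (norm (y' (0 + of_int n * l)))\<^sup>2 \<le> C * ((cell_norm l y n)\<^sup>2 + (cell_norm l g n)\<^sup>2)"
      unfolding cell_sq[OF yl, symmetric] cell_sq[OF g(1), symmetric]
      by (rule C(2)) (use shift[OF y(1)] shift[OF y(2)] L2_on_shift[OF g(1)] in \<open>auto simp: periodic_shift[of Q, OF Q(2)]\<close>)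
    also have "\<dots> \<le> C * (\<bar>cell_norm l y n\<bar> + \<bar>cell_norm l g n\<bar>)\<^sup>2"
      using C(1) by (intro mult_left_mono) (auto simp: power2_sum)
    also have "\<dots> = (sqrt C * (\<bar>cell_norm l y n\<bar> + \<bar>cell_norm l g n\<bar>))\<^sup>2"
      using C(1) by (simp add: power_mult_distrib)
    finally have "(norm (vjoin (y (of_int n * l)) (y' (of_int n * l))))\<^sup>2 \<le> (sqrt C * (\<bar>cell_norm l y n\<bar> + \<bar>cell_norm l g n\<bar>))\<^sup>2"
      by (simp add: norm_vjoin)
    then have "norm (vjoin (y (of_int n * l)) (y' (of_int n * l))) \<le> sqrt C * (\<bar>cell_norm l y n\<bar> + \<bar>cell_norm l g n\<bar>)"
      by (rule power2_le_imp_le) (use C(1) in auto)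
    then show ?thesis by simp
  qed
  moreover have "l2_sq (\<lambda>n. norm (cell_norm l y n) + norm (cell_norm l g n)) < \<infinity>"
    using l2_sq_finite_add[of "\<lambda>n. norm (cell_norm l y n)" "\<lambda>n. norm (cell_norm l g n)"] fin g(2)
    unfolding L2_sq_cells[OF yl l] L2_sq_cells[OF g(1) l] by (simp add: l2_sq_def)
  ultimately show ?thesis by (rule l2_sq_finite_scale)
qed

section \<open>The resolvent set\<close>

text \<open>
  The operator equation is equivalent to the system with right-hand side \<open>(0, -f)\<close>. Surjectivity comes
  from the solvability of the system; injectivity and boundedness of the inverse come from its a
  priori bound, which applies to every element of the domain.
\<close>

lemma resolvent_setI:
  fixes Q :: "real \<Rightarrow> complex ^ 'm::finite ^ 'm"
  assumes Q: "L2_on 0 l Q" "\<And>x. Q (x + l) = Q x" and l: "l > 0"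
    and mult: "\<And>y y' \<zeta>. ac_on 0 l y y' \<Longrightarrow> ac_on 0 l y' (\<lambda>s. Q s *v y s - z *s y s) \<Longrightarrow>
       y l = \<zeta> *s y 0 \<Longrightarrow> y' l = \<zeta> *s y' 0 \<Longrightarrow> norm \<zeta> = 1 \<Longrightarrow> y 0 = 0 \<and> y' 0 = 0"
  shows "z \<in> resolvent_set (schroedinger_op Q)"
proof -
  define B where "B x = Q x - mat z" for x
  have Bv: "B x *v v = Q x *v v - z *s v" for x v
    by (simp add: B_def matrix_vector_mult_diff_rdistrib mat_vector_mult)
  define A where "A x = companion (B x)" for x
  have "L2_on 0 l (\<lambda>x. Q x + (- mat z))"
    by (intro L2_on_add Q L2_on_continuous continuous_intros)
  then have A: "L2_on 0 l A" unfolding A_def B_def by (intro companion_L2_on) simp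
  have Ap: "A (x + l) = A x" for x by (simp add: A_def B_def Q(2))
  obtain M where M: "\<And>W. ac_on 0 l W (\<lambda>x. A x *v W x) \<Longrightarrow> W l = M *v W 0"
    using monodromy_matrix_exists[OF A l] by blast
  have eig: "norm \<mu> \<noteq> 1" if "matrix_eigenvalue M \<mu>" for \<mu>
  proof
    assume n: "norm \<mu> = 1"
    obtain v where v: "v \<noteq> 0" "M *v v = \<mu> *s v" using \<open>matrix_eigenvalue M \<mu>\<close> by (auto simp: matrix_eigenvalue_def)
    obtain W where W: "ac_on 0 l W (\<lambda>x. A x *v W x)" "W 0 = v"
      using linear_ode_exists[OF A l, of "\<lambda>_. 0" v] by auto
    have Wl: "W l = \<mu> *s W 0" using M[OF W(1)] v(2) W(2) by simp
    have AW: "A x *v W x = vjoin (vright (W x)) (B x *v vleft (W x))" for x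
      using companion_mult[of "B x" "vleft (W x)" "vright (W x)"] by (simp add: A_def)
    have "ac_on 0 l (\<lambda>x. vleft (W x)) (\<lambda>x. vright (W x))"
      using ac_on_linear[OF W(1) bounded_linear_vleft] by (simp add: AW)
    moreover have "ac_on 0 l (\<lambda>x. vright (W x)) (\<lambda>x. Q x *v vleft (W x) - z *s vleft (W x))"
      using ac_on_linear[OF W(1) bounded_linear_vright] by (simp add: AW Bv)
    ultimately have "vleft (W 0) = 0 \<and> vright (W 0) = 0"
      by (rule mult) (use Wl n in auto)
    then have "W 0 = 0" by (simp add: vec_eq_sum_iff)
    with v(1) W(2) show False by simp
  qed
  obtain C :: real where C: "\<And>F W. L2_local F \<Longrightarrow> has_ac_derivative W (\<lambda>x. A x *v W x + F x) \<Longrightarrow> l2_sq (\<lambda>n. W (of_int n * l)) < \<infinity>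
       \<Longrightarrow> L2_sq W \<le> ennreal C * L2_sq F"
    using periodic_system_bound[OF A Ap l M eig] by blast
  have force: "L2_local (\<lambda>x. vjoin 0 (- f x))" "L2_sq (\<lambda>x. vjoin 0 (- f x)) = L2_sq f" if f: "f \<in> L2_space" for f :: "real \<Rightarrow> complex ^ 'm"
  proof -
    have L: "bounded_linear (\<lambda>b :: complex ^ 'm. vjoin 0 (- b))"
      using bounded_linear_compose[OF bounded_linear_vjoin_right bounded_linear_minus[OF bounded_linear_ident]] .
    have "f \<in> borel_measurable lebesgue" using f by (simp add: L2_space_def)
    then have "(\<lambda>x. vjoin 0 (- f x)) \<in> borel_measurable lebesgue"
      by (rule measurable_compose) (intro borel_measurable_continuous_onI linear_continuous_on L)
    then show "L2_local (\<lambda>x. vjoin 0 (- f x))"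
      using L2_space_L2_local[OF f] L2_on_linear[OF _ L] by (auto simp: L2_local_def)
    show "L2_sq (\<lambda>x. vjoin 0 (- f x)) = L2_sq f"
      unfolding L2_sq_def norm_vjoin by simp
  qed
  have sys: "has_ac_derivative W (\<lambda>x. A x *v W x + vjoin 0 (- f x)) \<longleftrightarrow>
      has_ac_derivative (\<lambda>x. vleft (W x)) (\<lambda>x. vright (W x)) \<and>
      has_ac_derivative (\<lambda>x. vright (W x)) (\<lambda>x. Q x *v vleft (W x) - z *s vleft (W x) - f x)" for W f
    unfolding A_def companion_system_iff by (simp add: Bv)
  have bound: "L2_sq y \<le> ennreal C * L2_sq (\<lambda>x. g x - z *s y x) \<and> (\<lambda>x. g x - z *s y x) \<in> L2_space"
    if yg: "(y, g) \<in> schroedinger_op Q" for y g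
  proof -
    from yg obtain y' y'' where y: "y \<in> L2_space" "g \<in> L2_space" "has_ac_derivative y y'" "has_ac_derivative y' y''"
      "AE x in lebesgue. g x = - y'' x + Q x *v y x" by (auto simp: schroedinger_op_def)
    \<comment> \<open>The second derivative is only determined almost everywhere.\<close>
    have y': "has_ac_derivative y' (\<lambda>x. Q x *v y x - g x)"
      by (rule has_ac_derivative_cong_AE[OF y(4)]) (use y(5) in \<open>auto elim!: eventually_mono\<close>)
    define f where "f x = g x - z *s y x" for x
    have f: "f \<in> L2_space"
      using L2_space_add[OF y(2) L2_space_scale[OF y(1), of "- z"]] by (simp add: f_def[abs_def])
    define W where "W x = vjoin (y x) (y' x)" for x
    have W: "has_ac_derivative W (\<lambda>x. A x *v W x + vjoin 0 (- f x))"
      unfolding sys W_def using y(3) y' by (simp add: f_def)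
    have "l2_sq (\<lambda>n. W (of_int n * l)) < \<infinity>"
      unfolding W_def
      by (rule schroedinger_initial_data_l2[OF Q l y(3) y'])
        (use y(1,2) L2_space_L2_local[OF y(2)] in \<open>auto simp: L2_space_iff\<close>)
    from C[OF force(1)[OF f] W this] have "L2_sq W \<le> ennreal C * L2_sq f" by (simp add: force(2)[OF f])
    moreover have "L2_sq y \<le> L2_sq W"
    proof (rule L2_sq_mono)
      show "norm (y x) \<le> norm (W x)" for x using norm_vleft_le[of "W x"] by (simp add: W_def)
    qed
    ultimately show ?thesis using f unfolding f_def by (auto intro: order_trans)
  qed
  show ?thesis
    unfolding resolvent_set_def mem_Collect_eq
  proof (intro conjI ballI)
    fix f :: "real \<Rightarrow> complex ^ 'm" assume f: "f \<in> L2_space"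
    have "L2_sq f < \<infinity>" using f by (simp add: L2_space_iff)
    then obtain W where W: "has_ac_derivative W (\<lambda>x. A x *v W x + vjoin 0 (- f x))" "l2_sq (\<lambda>n. W (of_int n * l)) < \<infinity>"
      using periodic_system_exists[OF A Ap l M eig force(1)[OF f]] force(2)[OF f] by auto
    have "L2_sq W \<le> ennreal C * L2_sq f"
      using C[OF force(1)[OF f] W] by (simp add: force(2)[OF f])
    also have "\<dots> < \<infinity>" using \<open>L2_sq f < \<infinity>\<close> by (simp add: ennreal_mult_less_top)
    finally have Wf: "L2_sq W < \<infinity>" .
    define y where "y x = vleft (W x)" for x
    have y: "has_ac_derivative y (\<lambda>x. vright (W x))" "has_ac_derivative (\<lambda>x. vright (W x)) (\<lambda>x. Q x *v y x - z *s y x - f x)"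
      using W(1) unfolding sys y_def by auto
    have "L2_sq y \<le> L2_sq W" by (rule L2_sq_mono) (simp add: y_def norm_vleft_le)
    then have "y \<in> L2_space"
      using Wf has_ac_derivative_L2_local[OF y(1)] by (auto simp: L2_space_iff L2_local_def)
    moreover from this have "(\<lambda>x. z *s y x + f x) \<in> L2_space" by (intro L2_space_add L2_space_scale f)
    ultimately have "(y, \<lambda>x. z *s y x + f x) \<in> schroedinger_op Q"
      unfolding schroedinger_op_def mem_Collect_eq case_prod_conv
      by (intro conjI exI[of _ "\<lambda>x. vright (W x)"] exI[of _ "\<lambda>x. Q x *v y x - z *s y x - f x"] y) auto
    then show "\<exists>(y, g)\<in>schroedinger_op Q. AE x in lebesgue. g x - z *s y x = f x"
      by (intro bexI[of _ "(y, \<lambda>x. z *s y x + f x)"]) auto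
  next
    fix p assume p: "p \<in> schroedinger_op Q"
    obtain y g where yg: "p = (y, g)" by force
    have b: "L2_sq y \<le> ennreal C * L2_sq (\<lambda>x. g x - z *s y x)" using bound p yg by blast
    have my: "y \<in> borel_measurable lebesgue" using p yg by (auto simp: schroedinger_op_def L2_space_def)
    have "AE x in lebesgue. y x = 0" if "AE x in lebesgue. g x - z *s y x = 0"
    proof -
      have "L2_sq (\<lambda>x. g x - z *s y x) = (\<integral>\<^sup>+x. 0 \<partial>(lebesgue :: real measure))"
        unfolding L2_sq_def by (rule nn_integral_cong_AE) (use that in \<open>auto elim!: eventually_mono\<close>)
      then have "L2_sq y = 0" using b by simp
      moreover have "(\<lambda>x. ennreal ((norm (y x))\<^sup>2)) \<in> borel_measurable lebesgue" using my by measurable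
      ultimately have "AE x in lebesgue. ennreal ((norm (y x))\<^sup>2) = 0"
        by (simp add: L2_sq_def nn_integral_0_iff_AE)
      then show ?thesis by (rule eventually_mono) (simp add: ennreal_eq_0_iff)
    qed
    then show "case p of (y, g) \<Rightarrow> (AE x in lebesgue. g x - z *s y x = 0) \<longrightarrow> (AE x in lebesgue. y x = 0)"
      by (simp add: yg)
  next
    have "L2_space_norm y \<le> sqrt \<bar>C\<bar> * L2_space_norm (\<lambda>x. g x - z *s y x)" if p: "(y, g) \<in> schroedinger_op Q" for y g
    proof -
      have y: "y \<in> L2_space" using p by (auto simp: schroedinger_op_def)
      have f: "(\<lambda>x. g x - z *s y x) \<in> L2_space" using bound[OF p] by blast
      have "L2_sq y \<le> ennreal \<bar>C\<bar> * L2_sq (\<lambda>x. g x - z *s y x)"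
        using bound[OF p] by (meson abs_ge_self ennreal_leI mult_right_mono order_trans zero_le)
      moreover have "ennreal \<bar>C\<bar> * L2_sq (\<lambda>x. g x - z *s y x) < \<infinity>"
        using f by (simp add: L2_space_iff ennreal_mult_less_top)
      ultimately have "enn2real (L2_sq y) \<le> enn2real (ennreal \<bar>C\<bar> * L2_sq (\<lambda>x. g x - z *s y x))"
        by (intro enn2real_mono) auto
      also have "\<dots> = \<bar>C\<bar> * enn2real (L2_sq (\<lambda>x. g x - z *s y x))"
        by (simp add: enn2real_mult)
      finally show ?thesis
        unfolding L2_space_norm_eq[OF y] L2_space_norm_eq[OF f] real_sqrt_mult[symmetric] by (rule real_sqrt_le_mono)
    qed
    then show "\<exists>C. \<forall>(y, g)\<in>schroedinger_op Q. L2_space_norm y \<le> C * L2_space_norm (\<lambda>x. g x - z *s y x)"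
      by blast
  qed
qed

theorem theorem4:
  fixes Q :: "real \<Rightarrow> complex ^ 'm ^ 'm::finite"
    and A :: "complex ^ 'm ^ 'm"
  assumes periodic: "\<And>x. Q (x + pi) = Q x"
    and loc_sq_int: "\<And>i j. locally_square_integrable (\<lambda>x. Q x $ i $ j)"
    and A_def: "A = (LINT x:{0..pi}|lebesgue. Q x)"
    and no_real_eigenvalue: "\<And>\<mu>. matrix_eigenvalue A \<mu> \<Longrightarrow> \<mu> \<notin> \<real>"
  shows "\<exists>a b :: real. a \<le> b \<and>
           op_spectrum (schroedinger_op Q) \<inter> \<real> \<subseteq> complex_of_real ` {a..b}"
proof -
  have Q: "L2_on 0 pi Q"
    by (intro L2_on_vec locally_square_integrable_L2_on loc_sq_int)
  have A: "A = integral {0..pi} Q"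
    unfolding A_def by (rule set_lebesgue_integral_eq_integral(2)[OF L2_on_imp_integrable[OF Q]])
  have "\<mu> \<notin> \<real>" if "matrix_eigenvalue (integral {0..pi} Q) \<mu>" for \<mu>
    using no_real_eigenvalue that unfolding A by blast
  from no_unimodular_multiplier[OF Q pi_gt_zero this] obtain R :: real where R: "R > 0"
    "\<And>E y y' \<zeta>. \<bar>E\<bar> \<ge> R \<Longrightarrow> ac_on 0 pi y y' \<Longrightarrow> ac_on 0 pi y' (\<lambda>s. Q s *v y s - complex_of_real E *s y s) \<Longrightarrow>
       y pi = \<zeta> *s y 0 \<Longrightarrow> y' pi = \<zeta> *s y' 0 \<Longrightarrow> norm \<zeta> = 1 \<Longrightarrow> y 0 = 0 \<and> y' 0 = 0"
    by blast
  have "complex_of_real E \<in> resolvent_set (schroedinger_op Q)" if "\<bar>E\<bar> \<ge> R" for E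
    by (rule resolvent_setI[OF Q periodic pi_gt_zero]) (rule R(2)[OF that])
  then have "op_spectrum (schroedinger_op Q) \<inter> \<real> \<subseteq> complex_of_real ` {- R..R}"
    unfolding op_spectrum_def by (force simp: Reals_def)
  then show ?thesis using R(1) by (intro exI[of _ "- R"] exI[of _ R]) auto
qed

end
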